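(* Let $d\ge2$, let $p\in\{1,\dots,d-1\}$, and let $B=(B(t),t\ge0)$ be a standard Brownian motion on $\operatorname{H}_d$, partitioned in blocks $B=(B_{ij})_{1\le i,j\le p+1}$ with diagonal blocks of sizes $d-p,1,\dots,1$. Then the processes of the eigenvalues of the matrices $$B_{11},\qquad \begin{pmatrix} B_{11} & B_{1i} \\ B_{i1} & B_{ii} \end{pmatrix},\qquad \begin{pmatrix} B_{11} & B_{1i} & 0 \\ 0 & 0 & B_{ij} \\ B_{j1} & 0 & 0 \end{pmatrix},$$ and the complex processes $$B_{ij}B_{ji},\qquad B_{ij}B_{jk}B_{ki},$$ where $i,j,k$ range over distinct integers in $\{2,\dots,p+1\}$, taken together, form a Markov process.
   Context: $\operatorname{H}_d$ is the real vector space of $d\times d$ complex Hermitian matrices with scalar product $\langle M,N\rangle=\operatorname{Tr}(MN)$; a standard Brownian motion on $\operatorname{H}_d$ is standard with respect to this scalar product. A matrix $M\in\operatorname{M}_d(\mathbb C)$ is partitioned as $M=(M_{ij})_{1\le i,j\le p+1}$ where $M_{11}$ is the upper left $(d-p)\times(d-p)$ block, $M_{1i}$ is a $(d-p)\times1$ block and $M_{i1}$ is a $1\times(d-p)$ block for $2\le i\le p+1$, and $M_{ij}\in\mathbb C$ for $2\le i,j\le p+1$. Eigenvalues of a matrix are taken as an unordered collection with multiplicity. All the listed processes (for all admissible choices of distinct indices) are considered jointly as a single process in $t\ge0$. *)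

theory Defs
  imports "HOL-Probability.Probability" "Jordan_Normal_Form.Schur_Decomposition"
begin

section \<open>Hermitian matrices and Brownian motion\<close>

definition hermitian_mats :: "nat \<Rightarrow> complex mat set" where
  "hermitian_mats d = {A \<in> carrier_mat d d. mat_adjoint A = A}"

definition mat_trace :: "complex mat \<Rightarrow> complex" where
  "mat_trace A = (\<Sum>i<dim_row A. A $$ (i, i))"

text \<open>For Hermitian \<open>A\<close> and \<open>B\<close> of the same size the trace of \<open>A * B\<close> is real,
  so \<open>Re\<close> only changes the type.\<close>

definition herm_inner :: "complex mat \<Rightarrow> complex mat \<Rightarrow> real" where
  "herm_inner A B = Re (mat_trace (A * B))"

definition mat_borel :: "nat \<Rightarrow> complex mat measure" where
  "mat_borel d = vimage_algebra (carrier_mat d d)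
     (\<lambda>A. \<lambda>ij \<in> {..<d} \<times> {..<d}. A $$ ij) (PiM ({..<d} \<times> {..<d}) (\<lambda>_. borel))"

definition natural_filtration ::
    "'a measure \<Rightarrow> 'b measure \<Rightarrow> (real \<Rightarrow> 'a \<Rightarrow> 'b) \<Rightarrow> real \<Rightarrow> 'a measure" where
  "natural_filtration M S X s =
     sigma (space M) {X u -` A \<inter> space M | u A. 0 \<le> u \<and> u \<le> s \<and> A \<in> sets S}"

text \<open>Standard Brownian motion on the Euclidean space \<open>(hermitian_mats d, herm_inner)\<close>: it starts
  at the origin, has continuous paths, and \<open>B t - B s\<close> is independent of the past up to time
  \<open>s\<close> and is a centred Gaussian vector with covariance \<open>t - s\<close> times the identity. The last
  condition says that the scalar product of the increment with any \<open>H \<noteq> 0\<close> is a centred normal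
  variable of variance \<open>(t - s) * herm_inner H H\<close> (the second argument of
  \<open>normal_density\<close> is the standard deviation). Values at negative times play no role.\<close>

definition standard_hermitian_bm ::
    "'a measure \<Rightarrow> nat \<Rightarrow> (real \<Rightarrow> 'a \<Rightarrow> complex mat) \<Rightarrow> bool" where
  "standard_hermitian_bm M d B \<longleftrightarrow>
     prob_space M \<and>
     (\<forall>t\<ge>0. B t \<in> M \<rightarrow>\<^sub>M mat_borel d) \<and>
     (\<forall>t\<ge>0. \<forall>\<omega>\<in>space M. B t \<omega> \<in> hermitian_mats d) \<and>
     (AE \<omega> in M. B 0 \<omega> = 0\<^sub>m d d) \<and>
     (AE \<omega> in M. \<forall>i<d. \<forall>j<d. continuous_on {0..} (\<lambda>t. B t \<omega> $$ (i, j))) \<and>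
     (\<forall>s t. 0 \<le> s \<and> s < t \<longrightarrow>
        prob_space.indep_set M (sets (natural_filtration M (mat_borel d) B s))
          {(\<lambda>\<omega>. B t \<omega> - B s \<omega>) -` A \<inter> space M | A. A \<in> sets (mat_borel d)}) \<and>
     (\<forall>s t H. 0 \<le> s \<and> s < t \<and> H \<in> hermitian_mats d \<and> H \<noteq> 0\<^sub>m d d \<longrightarrow>
        distributed M lborel (\<lambda>\<omega>. herm_inner H (B t \<omega> - B s \<omega>))
          (normal_density 0 (sqrt ((t - s) * herm_inner H H))))"

section \<open>Markov processes\<close>

text \<open>Markov property with respect to the natural filtration: for \<open>s \<le> t\<close> the conditional
  law of \<open>X t\<close> given the past up to time \<open>s\<close> is its conditional law given \<open>X s\<close>.\<close>

definition markov_process :: "'a measure \<Rightarrow> 'b measure \<Rightarrow> (real \<Rightarrow> 'a \<Rightarrow> 'b) \<Rightarrow> bool" where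
  "markov_process M S X \<longleftrightarrow>
     prob_space M \<and>
     (\<forall>t\<ge>0. X t \<in> M \<rightarrow>\<^sub>M S) \<and>
     (\<forall>s t. \<forall>A\<in>sets S. 0 \<le> s \<and> s \<le> t \<longrightarrow>
        (AE \<omega> in M.
           real_cond_exp M (natural_filtration M S X s) (indicat_real (X t -` A \<inter> space M)) \<omega> =
           real_cond_exp M (vimage_algebra (space M) (X s) S) (indicat_real (X t -` A \<inter> space M)) \<omega>))"

section \<open>Eigenvalues\<close>

text \<open>The collection of eigenvalues, with algebraic multiplicity.\<close>

definition eigenvalue_mset :: "complex mat \<Rightarrow> complex multiset" where
  "eigenvalue_mset A = proots (char_poly A)"

text \<open>Sigma-algebra on finite multisets generated by the counts of points in Borel sets. On
  multisets of size \<open>n\<close> it is the Borel sigma-algebra of the quotient of the \<open>n\<close>-th power of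
  the complex plane by permutation of coordinates.\<close>

definition mset_borel :: "complex multiset measure" where
  "mset_borel = sigma UNIV {{m. size (filter_mset (\<lambda>z. z \<in> A) m) = k} | A k. A \<in> sets borel}"

section \<open>Blocks\<close>

text \<open>Block indices run from \<open>1\<close> to \<open>p + 1\<close>; block \<open>1\<close> consists of the rows (columns)
  \<open>0, \<dots>, d - p - 1\<close>, and block \<open>i \<ge> 2\<close> of the single row (column) \<open>d - p + (i - 2)\<close>.\<close>

definition block_start :: "nat \<Rightarrow> nat \<Rightarrow> nat \<Rightarrow> nat" where
  "block_start d p i = (if i = 1 then 0 else d - p + (i - 2))"

definition block_size :: "nat \<Rightarrow> nat \<Rightarrow> nat \<Rightarrow> nat" where
  "block_size d p i = (if i = 1 then d - p else 1)"

definition block :: "nat \<Rightarrow> nat \<Rightarrow> complex mat \<Rightarrow> nat \<Rightarrow> nat \<Rightarrow> complex mat" where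
  "block d p A i j = mat (block_size d p i) (block_size d p j)
     (\<lambda>(r, c). A $$ (block_start d p i + r, block_start d p j + c))"

definition block_entry :: "nat \<Rightarrow> nat \<Rightarrow> complex mat \<Rightarrow> nat \<Rightarrow> nat \<Rightarrow> complex" where
  "block_entry d p A i j = block d p A i j $$ (0, 0)"

definition bordered_mat :: "nat \<Rightarrow> nat \<Rightarrow> complex mat \<Rightarrow> nat \<Rightarrow> complex mat" where
  "bordered_mat d p A i =
     four_block_mat (block d p A 1 1) (block d p A 1 i)
                    (block d p A i 1) (block d p A i i)"

text \<open>The matrix with block rows \<open>(A11, A1i, 0)\<close>, \<open>(0, 0, Aij)\<close>, \<open>(Aj1, 0, 0)\<close>.\<close>

definition cyclic_mat :: "nat \<Rightarrow> nat \<Rightarrow> complex mat \<Rightarrow> nat \<Rightarrow> nat \<Rightarrow> complex mat" where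
  "cyclic_mat d p A i j =
     four_block_mat
       (four_block_mat (block d p A 1 1) (block d p A 1 i) (0\<^sub>m 1 (d - p)) (0\<^sub>m 1 1))
       (0\<^sub>m (d - p) 1 @\<^sub>r block d p A i j)
       (four_block_mat (block d p A j 1) (0\<^sub>m 1 1) (0\<^sub>m 0 (d - p)) (0\<^sub>m 0 1))
       (0\<^sub>m 1 1)"

section \<open>The joint process\<close>

definition index_pairs :: "nat \<Rightarrow> (nat \<times> nat) set" where
  "index_pairs p = {(i, j). i \<in> {2..p + 1} \<and> j \<in> {2..p + 1} \<and> i \<noteq> j}"

definition index_triples :: "nat \<Rightarrow> (nat \<times> nat \<times> nat) set" where
  "index_triples p = {(i, j, k). i \<in> {2..p + 1} \<and> j \<in> {2..p + 1} \<and> k \<in> {2..p + 1} \<and>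
     i \<noteq> j \<and> j \<noteq> k \<and> i \<noteq> k}"

type_synonym joint_state =
  "complex multiset \<times> (nat \<Rightarrow> complex multiset) \<times> (nat \<times> nat \<Rightarrow> complex multiset) \<times>
   (nat \<times> nat \<Rightarrow> complex) \<times> (nat \<times> nat \<times> nat \<Rightarrow> complex)"

definition joint_space :: "nat \<Rightarrow> joint_state measure" where
  "joint_space p =
     mset_borel \<Otimes>\<^sub>M
     PiM {2..p + 1} (\<lambda>_. mset_borel) \<Otimes>\<^sub>M
     PiM (index_pairs p) (\<lambda>_. mset_borel) \<Otimes>\<^sub>M
     PiM (index_pairs p) (\<lambda>_. borel) \<Otimes>\<^sub>M
     PiM (index_triples p) (\<lambda>_. borel)"

definition joint_statistics :: "nat \<Rightarrow> nat \<Rightarrow> complex mat \<Rightarrow> joint_state" where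
  "joint_statistics d p A =
    (eigenvalue_mset (block d p A 1 1),
     restrict (\<lambda>i. eigenvalue_mset (bordered_mat d p A i)) {2..p + 1},
     restrict (\<lambda>(i, j). eigenvalue_mset (cyclic_mat d p A i j)) (index_pairs p),
     restrict (\<lambda>(i, j). block_entry d p A i j * block_entry d p A j i) (index_pairs p),
     restrict (\<lambda>(i, j, k). block_entry d p A i j * block_entry d p A j k * block_entry d p A k i)
       (index_triples p))"

end

theory Submission
  imports Defs
begin

text \<open>Let \<open>n = d - p\<close>. The group of unitary matrices that are block diagonal with blocks of sizes
  \<open>n, 1, \<dots>, 1\<close> acts on Hermitian matrices by conjugation; it preserves the law of the increments
  of \<open>B\<close> and all the statistics. Outside a null set of matrices the statistics separate the orbits
  of this action. Hence \<open>P(f (X + B t - B s) \<in> A)\<close>, which is invariant as a function of \<open>X\<close>, agrees at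
  \<open>X = B s\<close> almost surely with a measurable function of the statistics \<open>f (B s)\<close>, and by independence of
  increments it is the conditional probability given the past.

  The orbits are separated as follows. The characteristic polynomials determine
  \<open>M\<^sub>i\<^sub>j * (M\<^sub>j\<^sub>1 * adj (x - M\<^sub>1\<^sub>1) * M\<^sub>1\<^sub>i)\<close> and hence, up to the phases of the numbers \<open>M\<^sub>i\<^sub>j\<close>, all moments
  \<open>M\<^sub>j\<^sub>1 * M\<^sub>1\<^sub>1\<^sup>k * M\<^sub>1\<^sub>i\<close>. If all \<open>M\<^sub>i\<^sub>j\<close> with \<open>i \<noteq> j\<close> are nonzero, their products and triple products fix them up to a
  diagonal unitary conjugation, and if the vectors \<open>M\<^sub>1\<^sub>1\<^sup>k * M\<^sub>1\<^sub>2\<close> form a basis, the moments fix the rest up to a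
  unitary matrix.\<close>

section \<open>Characteristic functions in several variables\<close>

text \<open>Being constant on orbits makes the transition probability a function of the statistics,
  but nothing makes that function Borel: the statistics are far from injective, and the continuous
  image of a Borel set is in general only analytic. This is why the statistics are recoded as a
  continuous map on a complete separable space, and why the factorisation is only almost sure, which
  conditional probabilities tolerate.

  Separation is proved for generic matrices only. For s > 0 the matrix \<open>B s\<close> is generic
  almost surely; at s = 0 it is almost surely the non-generic matrix 0, and there the transition
  probability is almost surely constant.

  Brownian motion is specified through the normal laws of its projections on fixed Hermitian
  matrices. Invariance of the increments under conjugation therefore needs uniqueness of
  characteristic functions in several real variables, which is deduced from Levy's theorem on the
  line.\<close>

lemma finite_measure_eqI_char:
  fixes M N :: "real measure"
  assumes fM: "finite_measure M" and fN: "finite_measure N"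
    and sM: "sets M = sets borel" and sN: "sets N = sets borel"
    and ch: "char M = char N"
  shows "M = N"
proof -
  interpret M: finite_measure M by fact
  interpret N: finite_measure N by fact
  have spM: "space M = UNIV" and spN: "space N = UNIV"
    using sets_eq_imp_space_eq[OF sM] sets_eq_imp_space_eq[OF sN] by simp_all
  \<comment> \<open>The characteristic function at 0 is the total mass, so both measures have mass
    \<open>c\<close>, and dividing by it gives probability measures, to which Levy's theorem
    applies. Mass 0 is treated apart.\<close>
  define c where "c = measure M UNIV"
  have c: "c = measure N UNIV"
    using fun_cong[OF ch, of 0] spM spN by (simp add: char_def c_def)
  show ?thesis
  proof (cases "c = 0")
    case True
    then have "emeasure M (space M) = 0" "emeasure N (space N) = 0"
      using c c_def spM spN by (simp_all add: M.emeasure_eq_measure N.emeasure_eq_measure)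
    then show ?thesis
      using sM sN emeasure_space[of M] emeasure_space[of N] by (intro measure_eqI) simp_all
  next
    case False
    then have cp: "c > 0" by (simp add: c_def less_le)
    define M' where "M' = density M (\<lambda>_. ennreal (1 / c))"
    define N' where "N' = density N (\<lambda>_. ennreal (1 / c))"
    have em: "ennreal (1 / c) * ennreal c = 1" using cp
      by (subst ennreal_mult[symmetric]) auto
    have "emeasure M' (space M') = 1"
      unfolding M'_def using em spM
      using sM by (subst emeasure_density_const) (auto simp: M.emeasure_eq_measure c_def)
    moreover have "emeasure N' (space N') = 1"
      unfolding N'_def using em spN
      using sN by (subst emeasure_density_const) (auto simp: N.emeasure_eq_measure c)
    ultimately have "real_distribution M'" "real_distribution N'"
      unfolding real_distribution_def real_distribution_axioms_def M'_def N'_def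
      using sM sN spM spN by (auto intro!: prob_spaceI)
    moreover have "char M' t = char M t / c" "char N' t = char N t / c" for t
      using cp sM sN unfolding M'_def N'_def char_def
      by (simp_all add: integral_density scaleR_conv_of_real measurable_cong_sets[OF sM refl]
          measurable_cong_sets[OF sN refl])
    ultimately have "M' = N'"
      using ch by (intro Levy_uniqueness) (auto simp: fun_eq_iff)
    then have eq: "emeasure M' A = emeasure N' A" for A by simp
    show ?thesis
    proof (rule measure_eqI)
      fix A assume A: "A \<in> sets M"
      then have A': "A \<in> sets N" using sM sN by simp
      have "ennreal (1 / c) * emeasure M A = ennreal (1 / c) * emeasure N A"
        using eq[of A] A A' unfolding M'_def N'_def
        by (simp add: emeasure_density nn_integral_cmult)
      then show "emeasure M A = emeasure N A"
        using cp by (simp add: ennreal_mult_cancel_left)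
    qed (simp add: sM sN)
  qed
qed

text \<open>The image under \<open>f\<close> of the measure with density \<open>w\<close> is a
  finite measure on the line whose characteristic function is the \<open>w\<close>-weighted integral
  of \<open>iexp (v * f x)\<close>, so uniqueness on the line compares all Borel sets
  \<open>C\<close>. Nonnegativity and boundedness of \<open>w\<close> make the density a finite
  measure.\<close>

lemma weighted_indicator_eqI_char:
  fixes \<mu> \<nu> :: "'a measure" and w f :: "'a \<Rightarrow> real"
  assumes fm: "finite_measure \<mu>" "finite_measure \<nu>" and st: "sets \<nu> = sets \<mu>"
    and w[measurable]: "w \<in> borel_measurable \<mu>" and f[measurable]: "f \<in> borel_measurable \<mu>"
    and w0: "\<And>x. 0 \<le> w x" and wK: "\<And>x. w x \<le> K"
    and ch: "\<And>v. (CLINT x|\<mu>. w x *\<^sub>R iexp (v * f x)) = (CLINT x|\<nu>. w x *\<^sub>R iexp (v * f x))"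
    and C[measurable]: "C \<in> sets borel"
  shows "(\<integral>x. w x * indicator C (f x) \<partial>\<mu>) = (\<integral>x. w x * indicator C (f x) \<partial>\<nu>)"
proof -
  have fin: "finite_measure (distr (density m (\<lambda>x. ennreal (w x))) borel f)"
    and eq1: "char (distr (density m (\<lambda>x. ennreal (w x))) borel f) v = (CLINT x|m. w x *\<^sub>R iexp (v * f x))"
    and eq2: "measure (distr (density m (\<lambda>x. ennreal (w x))) borel f) C = (\<integral>x. w x * indicator C (f x) \<partial>m)"
    if m: "finite_measure m" "sets m = sets \<mu>" for m v
  proof -
    interpret finite_measure m by fact
    note [measurable_cong] = m(2)
    have "integrable m w"
      using w0 wK by (intro integrable_const_bound[where B=K]) (auto simp: abs_of_nonneg)
    then have "finite_measure (density m (\<lambda>x. ennreal (w x)))"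
      by (intro finite_measureI) (simp add: emeasure_density nn_integral_eq_integral w0)
    then interpret W: finite_measure "density m (\<lambda>x. ennreal (w x))" .
    show fin: "finite_measure (distr (density m (\<lambda>x. ennreal (w x))) borel f)"
      by (rule W.finite_measure_distr) simp
    interpret D: finite_measure "distr (density m (\<lambda>x. ennreal (w x))) borel f" by fact
    show "char (distr (density m (\<lambda>x. ennreal (w x))) borel f) v = (CLINT x|m. w x *\<^sub>R iexp (v * f x))"
      by (simp add: char_def integral_distr integral_density w0)
    have "measure (distr (density m (\<lambda>x. ennreal (w x))) borel f) C
      = (\<integral>x. indicator C x \<partial>distr (density m (\<lambda>x. ennreal (w x))) borel f)" by simp
    also have "\<dots> = (\<integral>x. w x * indicator C (f x) \<partial>m)"
      by (subst integral_distr; simp?; subst integral_density; simp add: w0)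
    finally show "measure (distr (density m (\<lambda>x. ennreal (w x))) borel f) C = (\<integral>x. w x * indicator C (f x) \<partial>m)" .
  qed
  have "distr (density \<mu> (\<lambda>x. ennreal (w x))) borel f = distr (density \<nu> (\<lambda>x. ennreal (w x))) borel f"
    using fin eq1 ch fm st by (intro finite_measure_eqI_char) (auto simp: fun_eq_iff)
  with eq2[OF fm(1) refl] eq2[OF fm(2) st] show ?thesis by simp
qed

text \<open>A density has to be nonnegative, which excludes \<open>iexp t\<close>,
  \<open>cos t\<close> and \<open>sin t\<close> as weights but admits \<open>1 + cos t\<close> and
  \<open>1 + sin t\<close>. This identity and the next one expand these weights into exponentials;
  \<open>scaleR_iexp_split\<close> recovers \<open>iexp t\<close> from them.\<close>

lemma scaleR_one_plus_cos_iexp: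
  "(p * (1 + cos t)) *\<^sub>R iexp s = p *\<^sub>R iexp s + (p *\<^sub>R iexp (t + s) + p *\<^sub>R iexp (s - t)) / 2"
  unfolding cis_conv_exp[symmetric] by (simp add: complex_eq_iff cos_add sin_add cos_diff sin_diff algebra_simps)

lemma scaleR_one_plus_sin_iexp:
  "(p * (1 + sin t)) *\<^sub>R iexp s = p *\<^sub>R iexp s - \<i> * (p *\<^sub>R iexp (t + s) - p *\<^sub>R iexp (s - t)) / 2"
  unfolding cis_conv_exp[symmetric] by (simp add: complex_eq_iff cos_add sin_add cos_diff sin_diff algebra_simps)

lemma scaleR_iexp_split:
  "(q * p) *\<^sub>R iexp t = (of_real (p * (1 + cos t) * q) - of_real (p * q)) + \<i> * (of_real (p * (1 + sin t) * q) - of_real (p * q))"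
  unfolding cis_conv_exp[symmetric] by (simp add: complex_eq_iff algebra_simps)

text \<open>The coordinates are turned one at a time from exponentials into indicators. An
  exponential with arbitrary frequencies in all coordinates is carried along as part of the weight,
  which is why \<open>u\<close> is general in the induction. With all coordinates converted and
  \<open>u = 0\<close>, the two measures agree on boxes.\<close>

lemma PiM_eqI_char:
  fixes \<mu> \<nu> :: "('i \<Rightarrow> real) measure"
  assumes I: "finite I" and p: "prob_space \<mu>" "prob_space \<nu>"
    and s: "sets \<mu> = sets (PiM I (\<lambda>_. borel))" "sets \<nu> = sets (PiM I (\<lambda>_. borel))"
    and ch: "\<And>u. (CLINT x|\<mu>. iexp (\<Sum>k\<in>I. u k * x k)) = (CLINT x|\<nu>. iexp (\<Sum>k\<in>I. u k * x k))"
  shows "\<mu> = \<nu>"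
proof -
  interpret mu: prob_space \<mu> by fact
  interpret nu: prob_space \<nu> by fact
  note [measurable_cong] = s
  let ?e = "\<lambda>u x. iexp (\<Sum>k\<in>I. u k * x k) :: complex"
  let ?P = "\<lambda>J C x. (\<Prod>j\<in>J. indicator (C j) (x j)) :: real"
  have intg: "integrable m (\<lambda>x. ?P J C x *\<^sub>R ?e u x)"
    if "J \<subseteq> I" "\<And>j. C j \<in> sets borel" "prob_space m" "sets m = sets (PiM I (\<lambda>_. borel))" for J C u m
  proof -
    interpret m: prob_space m by fact
    note that(2)[measurable] and [measurable_cong] = that(4)
    have J: "j \<in> J \<Longrightarrow> j \<in> I" for j using that by auto
    have [measurable]: "?P J C \<in> borel_measurable m"
      by (intro borel_measurable_prod borel_measurable_indicator' ) (auto simp: J)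
    have [measurable]: "?e u \<in> borel_measurable m"
      by measurable
    have le: "\<bar>?P J C x\<bar> \<le> 1" for x
      by (auto simp: abs_prod indicator_def intro!: prod_le_1)
    show "integrable m (\<lambda>x. ?P J C x *\<^sub>R ?e u x)"
      by (intro m.integrable_const_bound[where B=1]) (auto simp: norm_mult le)
  qed
  have step: "(CLINT x|\<mu>. ?P J C x *\<^sub>R ?e u x) = (CLINT x|\<nu>. ?P J C x *\<^sub>R ?e u x)"
    if "finite J" "J \<subseteq> I" "\<And>j. C j \<in> sets borel" for J C u
    using that
  proof (induction J arbitrary: u rule: finite_induct)
    case empty
    then show ?case using ch by simp
  next
    case (insert m J)
    have mI: "m \<in> I" and JI: "J \<subseteq> I" using insert.prems by auto
    note C[measurable] = insert.prems(2)
    have IH: "(CLINT x|\<mu>. ?P J C x *\<^sub>R ?e v x) = (CLINT x|\<nu>. ?P J C x *\<^sub>R ?e v x)" for v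
      using insert.IH[OF JI C] .
    have J: "j \<in> J \<Longrightarrow> j \<in> I" for j using JI by auto
    have Pm: "?P J C \<in> borel_measurable (PiM I (\<lambda>_. borel))"
      by (intro borel_measurable_prod borel_measurable_indicator') (auto simp: J)
    have [measurable]: "(\<lambda>x. x m) \<in> borel_measurable (PiM I (\<lambda>_. borel))" using mI by simp
    have thetam: "(\<lambda>x. \<Sum>k\<in>I. u k * x k) \<in> borel_measurable (PiM I (\<lambda>_. borel))"
      by (intro borel_measurable_sum borel_measurable_times) auto
    have wcm: "(\<lambda>x. ?P J C x * (1 + cos (\<Sum>k\<in>I. u k * x k))) \<in> borel_measurable (PiM I (\<lambda>_. borel))"
      using borel_measurable_times[OF Pm borel_measurable_add[OF borel_measurable_const[of 1] measurable_compose[OF thetam borel_measurable_cos]]] by simp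
    have wsm: "(\<lambda>x. ?P J C x * (1 + sin (\<Sum>k\<in>I. u k * x k))) \<in> borel_measurable (PiM I (\<lambda>_. borel))"
      using borel_measurable_times[OF Pm borel_measurable_add[OF borel_measurable_const[of 1] measurable_compose[OF thetam borel_measurable_sin]]] by simp
    have Cm: "(\<lambda>x. indicator (C m) (x m) :: real) \<in> borel_measurable (PiM I (\<lambda>_. borel))"
      using C[of m] by measurable
    note cms = measurable_cong_sets[OF s(1) refl]
    have P01: "0 \<le> ?P J C x" "?P J C x \<le> 1" for x
      by (auto simp: indicator_def intro!: prod_nonneg prod_le_1)
    let ?\<theta> = "\<lambda>x. \<Sum>k\<in>I. u k * x k"
    \<comment> \<open>Scaling the frequencies \<open>u\<close> by 0, 1 or -1 and adding
      \<open>v\<close> at the coordinate \<open>m\<close> produces exactly the exponentials in the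
      expansions of the cosine and sine weights, so the induction hypothesis covers all of
      them.\<close>
    have sumupd: "(\<Sum>k\<in>I. (a * u k + (if k = m then v else 0)) * x k) = a * ?\<theta> x + v * x m" for a v x
      using mI I by (simp add: algebra_simps sum.distrib sum_distrib_left if_distrib[of "\<lambda>z. _ * z"] sum.delta cong: if_cong)
    define E where "E a v x = (?P J C x *\<^sub>R iexp (a * ?\<theta> x + v * x m) :: complex)" for a v x
    have Eint: "integrable q (E a v)" if "prob_space q" "sets q = sets (PiM I (\<lambda>_. borel))" for a v q
    proof -
      have "integrable q (\<lambda>x. ?P J C x *\<^sub>R ?e (\<lambda>k. a * u k + (if k = m then v else 0)) x)"
        by (rule intg[OF JI C that])
      then show ?thesis unfolding E_def[abs_def] sumupd .
    qed
    have Eeq: "integral\<^sup>L \<mu> (E a v) = integral\<^sup>L \<nu> (E a v)" for a v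
      using IH[of "\<lambda>k. a * u k + (if k = m then v else 0)"]
      unfolding E_def[abs_def] sumupd .
    have arg: "0 * t + s = s" "1 * t + s = t + s" "- 1 * t + s = s - t" for t s :: real by simp_all
    have c1: "(?P J C x * (1 + cos (?\<theta> x))) *\<^sub>R iexp (v * x m) = E 0 v x + (E 1 v x + E (-1) v x) / 2" for v x
      unfolding E_def scaleR_one_plus_cos_iexp arg by (rule refl)
    have c2: "(?P J C x * (1 + sin (?\<theta> x))) *\<^sub>R iexp (v * x m) = E 0 v x - \<i> * (E 1 v x - E (-1) v x) / 2" for v x
      unfolding E_def scaleR_one_plus_sin_iexp arg by (rule refl)
    have w0: "(\<integral>x. ?P J C x * indicator (C m) (x m) \<partial>\<mu>) = (\<integral>x. ?P J C x * indicator (C m) (x m) \<partial>\<nu>)"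
    proof (rule weighted_indicator_eqI_char[where K=1])
      show "(CLINT x|\<mu>. ?P J C x *\<^sub>R iexp (v * x m)) = (CLINT x|\<nu>. ?P J C x *\<^sub>R iexp (v * x m))" for v
        using Eeq[of 0 v] unfolding E_def[abs_def] arg .
    qed (use Pm mI C in \<open>auto simp: s cms P01 mu.finite_measure_axioms nu.finite_measure_axioms\<close>)
    have trig_weight: "(\<integral>x. (?P J C x * (1 + h (?\<theta> x))) * indicator (C m) (x m) \<partial>\<mu>) = (\<integral>x. (?P J C x * (1 + h (?\<theta> x))) * indicator (C m) (x m) \<partial>\<nu>)"
      if hm: "(\<lambda>x. ?P J C x * (1 + h (?\<theta> x))) \<in> borel_measurable (PiM I (\<lambda>_. borel))"
        and hch: "\<And>v. (CLINT x|\<mu>. (?P J C x * (1 + h (?\<theta> x))) *\<^sub>R iexp (v * x m)) = (CLINT x|\<nu>. (?P J C x * (1 + h (?\<theta> x))) *\<^sub>R iexp (v * x m))"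
        and h1: "\<And>y. - 1 \<le> h y" "\<And>y. h y \<le> 1" for h :: "real \<Rightarrow> real"
    proof (rule weighted_indicator_eqI_char[where K=2, OF _ _ _ _ _ _ _ hch])
      show "0 \<le> ?P J C x * (1 + h (?\<theta> x))" for x
        using P01(1)[of x] h1(1)[of "?\<theta> x"] by (intro mult_nonneg_nonneg) linarith+
      show "?P J C x * (1 + h (?\<theta> x)) \<le> 2" for x
        using mult_mono[OF P01(2)[of x], of "1 + h (?\<theta> x)" 2] h1[of "?\<theta> x"] by auto
    qed (use hm mI C in \<open>auto simp: s cms mu.finite_measure_axioms nu.finite_measure_axioms\<close>)
    have wc: "(\<integral>x. (?P J C x * (1 + cos (?\<theta> x))) * indicator (C m) (x m) \<partial>\<mu>) = (\<integral>x. (?P J C x * (1 + cos (?\<theta> x))) * indicator (C m) (x m) \<partial>\<nu>)"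
      by (rule trig_weight[OF wcm]) (unfold c1, use Eint[OF p(1) s(1)] Eint[OF p(2) s(2)] Eeq in simp_all)
    have ws: "(\<integral>x. (?P J C x * (1 + sin (?\<theta> x))) * indicator (C m) (x m) \<partial>\<mu>) = (\<integral>x. (?P J C x * (1 + sin (?\<theta> x))) * indicator (C m) (x m) \<partial>\<nu>)"
      by (rule trig_weight[OF wsm]) (unfold c2, use Eint[OF p(1) s(1)] Eint[OF p(2) s(2)] Eeq in simp_all)
    define g where "g = (\<lambda>x::'i \<Rightarrow> real. ?P J C x * indicator (C m) (x m))"
    define gc where "gc = (\<lambda>x::'i \<Rightarrow> real. ?P J C x * (1 + cos (?\<theta> x)) * indicator (C m) (x m))"
    define gs where "gs = (\<lambda>x::'i \<Rightarrow> real. ?P J C x * (1 + sin (?\<theta> x)) * indicator (C m) (x m))"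
    have trig: "\<bar>1 + sin y\<bar> \<le> 2" "\<bar>1 + cos y\<bar> \<le> 2" for y :: real
      using sin_le_one[of y] sin_ge_minus_one[of y] cos_le_one[of y] cos_ge_minus_one[of y] by linarith+
    have gb: "norm (g x) \<le> 2" "norm (gc x) \<le> 2" "norm (gs x) \<le> 2" for x
    proof -
      have bd: "\<bar>?P J C x * b * indicator (C m) (x m)\<bar> \<le> 2" if "\<bar>b\<bar> \<le> 2" for b :: real
      proof -
        have "\<bar>?P J C x\<bar> * \<bar>b\<bar> \<le> 1 * 2" using P01[of x] that by (intro mult_mono) linarith+
        then have "(\<bar>?P J C x\<bar> * \<bar>b\<bar>) * \<bar>indicator (C m) (x m)\<bar> \<le> 2 * 1"
          by (intro mult_mono) (simp_all add: indicator_def)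
        then show ?thesis by (simp only: abs_mult)
      qed
      show "norm (g x) \<le> 2" using bd[of 1] unfolding g_def by simp
      show "norm (gc x) \<le> 2" using bd[OF trig(2)] unfolding gc_def real_norm_def .
      show "norm (gs x) \<le> 2" using bd[OF trig(1)] unfolding gs_def real_norm_def .
    qed
    have gi: "integrable q g" "integrable q gc" "integrable q gs"
      if "prob_space q" "sets q = sets (PiM I (\<lambda>_. borel))" for q
    proof -
      interpret q: prob_space q by fact
      note [measurable_cong] = that(2)
      have "g \<in> borel_measurable q" "gc \<in> borel_measurable q" "gs \<in> borel_measurable q"
        unfolding g_def gc_def gs_def measurable_cong_sets[OF that(2) refl]
        by (fact borel_measurable_times[OF Pm Cm] borel_measurable_times[OF wcm Cm] borel_measurable_times[OF wsm Cm])+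
      then show "integrable q g" "integrable q gc" "integrable q gs"
        using gb by (auto intro!: q.integrable_const_bound[where B=2])
    qed
    have dec: "?P (insert m J) C x *\<^sub>R ?e u x = (of_real (gc x) - of_real (g x)) + \<i> * (of_real (gs x) - of_real (g x))" for x
      unfolding g_def gc_def gs_def prod.insert[OF insert.hyps] by (rule scaleR_iexp_split)
    have "(CLINT x|q. ?P (insert m J) C x *\<^sub>R ?e u x)
        = (of_real (integral\<^sup>L q gc) - of_real (integral\<^sup>L q g)) + \<i> * (of_real (integral\<^sup>L q gs) - of_real (integral\<^sup>L q g))"
      if "prob_space q" "sets q = sets (PiM I (\<lambda>_. borel))" for q
      unfolding dec using gi[OF that] by (simp add: integral_complex_of_real)
    from this[OF p(1) s(1)] this[OF p(2) s(2)] show ?case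
      using w0 wc ws unfolding g_def gc_def gs_def by simp
  qed
  have box: "emeasure \<mu> (Pi\<^sub>E I A) = emeasure \<nu> (Pi\<^sub>E I A)" if A: "\<And>i. i \<in> I \<Longrightarrow> A i \<in> sets borel" for A
  proof -
    \<comment> \<open>The empty set outside \<open>I\<close> is a default: \<open>step\<close> wants
      a Borel set at every index.\<close>
    define C where "C i = (if i \<in> I then A i else {})" for i
    have C: "C j \<in> sets borel" for j using A by (simp add: C_def)
    have sets: "Pi\<^sub>E I A \<in> sets (PiM I (\<lambda>_. borel))"
      using A I by (intro sets_PiM_I_finite) auto
    have "measure q (Pi\<^sub>E I A) = (\<integral>x. ?P I C x \<partial>q)"
      if "prob_space q" "sets q = sets (PiM I (\<lambda>_. borel))" for q
    proof -
      interpret q: prob_space q by fact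
      have "measure q (Pi\<^sub>E I A) = (\<integral>x. indicator (Pi\<^sub>E I A) x \<partial>q)"
        using sets that by (simp add: sets.Int_space_eq2)
      also have "\<dots> = (\<integral>x. ?P I C x \<partial>q)"
      proof (rule Bochner_Integration.integral_cong)
        fix x assume "x \<in> space q"
        then have x: "x \<in> extensional I"
          using sets_eq_imp_space_eq[OF that(2)] by (auto simp: space_PiM PiE_def)
        show "indicator (Pi\<^sub>E I A) x = ?P I C x"
          using x I by (auto simp: indicator_def C_def PiE_def Pi_iff prod_zero_iff)
      qed simp
      finally show ?thesis .
    qed
    note m = this[OF p(1) s(1)] this[OF p(2) s(2)]
    have "complex_of_real (\<integral>x. ?P I C x \<partial>\<mu>) = complex_of_real (\<integral>x. ?P I C x \<partial>\<nu>)"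
      using step[of I C "\<lambda>_. 0"] C I
      by (simp add: scaleR_conv_of_real integral_complex_of_real del: of_real_prod)
    then have "measure \<mu> (Pi\<^sub>E I A) = measure \<nu> (Pi\<^sub>E I A)" using m by simp
    then show ?thesis by (simp add: mu.emeasure_eq_measure nu.emeasure_eq_measure)
  qed
  show ?thesis
  proof (rule measure_eqI_PiM_finite[where M="\<lambda>_. borel" and A="\<lambda>_. space (PiM I (\<lambda>_. borel))"])
    show "range (\<lambda>_::nat. space (PiM I (\<lambda>_. borel))) \<subseteq> prod_algebra I (\<lambda>_. borel :: real measure)"
      by (auto simp: space_PiM intro!: prod_algebraI_finite I)
  qed (use I s box in auto)
qed

section \<open>Gaussian Hermitian matrices\<close>

lemma space_mat_borel [simp]: "space (mat_borel d) = carrier_mat d d"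
  by (simp add: mat_borel_def)

lemma mat_borel_entry:
  assumes "i < d" "j < d"
  shows "(\<lambda>A. A $$ (i, j)) \<in> borel_measurable (mat_borel d)"
proof -
  have "(\<lambda>A. \<lambda>ij \<in> {..<d} \<times> {..<d}. A $$ ij) \<in> mat_borel d \<rightarrow>\<^sub>M PiM ({..<d} \<times> {..<d}) (\<lambda>_. borel)"
    unfolding mat_borel_def by (rule measurable_vimage_algebra1) (auto simp: space_PiM)
  from measurable_compose[OF this measurable_component_singleton[of "(i, j)"]]
  show ?thesis using assms by simp
qed

lemma measurable_mat_borelI:
  assumes "\<And>x. x \<in> space N \<Longrightarrow> f x \<in> carrier_mat d d"
    and "\<And>i j. i < d \<Longrightarrow> j < d \<Longrightarrow> (\<lambda>x. f x $$ (i, j)) \<in> borel_measurable N"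
  shows "f \<in> N \<rightarrow>\<^sub>M mat_borel d"
  unfolding mat_borel_def
proof (rule measurable_vimage_algebra2)
  show "f \<in> space N \<rightarrow> carrier_mat d d" using assms by auto
  show "(\<lambda>x. \<lambda>ij\<in>{..<d} \<times> {..<d}. f x $$ ij) \<in> N \<rightarrow>\<^sub>M PiM ({..<d} \<times> {..<d}) (\<lambda>_. borel)"
    using assms by (intro measurable_restrict) auto
qed

lemma measurable_mat_entry:
  assumes "f \<in> N \<rightarrow>\<^sub>M mat_borel d" "i < d" "j < d"
  shows "(\<lambda>x. f x $$ (i, j)) \<in> borel_measurable N"
  using measurable_compose[OF assms(1) mat_borel_entry[OF assms(2,3)]] .

lemma mat_adjoint_carrier:
  "A \<in> carrier_mat n m \<Longrightarrow> mat_adjoint A \<in> carrier_mat m n"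
  by (auto simp: mat_adjoint_def)

lemma mat_adjoint_index:
  fixes A :: "complex mat"
  assumes "A \<in> carrier_mat n m" "i < m" "j < n"
  shows "mat_adjoint A $$ (i, j) = cnj (A $$ (j, i))"
  using assms by (auto simp: mat_adjoint_def mat_of_rows_index)

lemma hermitian_matsI:
  assumes "A \<in> carrier_mat d d" "\<And>i j. i < d \<Longrightarrow> j < d \<Longrightarrow> A $$ (i, j) = cnj (A $$ (j, i))"
  shows "A \<in> hermitian_mats d"
  unfolding hermitian_mats_def
proof (intro CollectI conjI eq_matI)
  show "mat_adjoint A $$ (i, j) = A $$ (i, j)" if "i < dim_row A" "j < dim_col A" for i j
    using assms(1) that assms(2)[of i j] by (subst mat_adjoint_index[of _ d d]) auto
qed (use assms(1) mat_adjoint_carrier[OF assms(1)] in auto)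

lemma hermitian_matsD:
  assumes "A \<in> hermitian_mats d"
  shows "A \<in> carrier_mat d d" "\<And>i j. i < d \<Longrightarrow> j < d \<Longrightarrow> A $$ (i, j) = cnj (A $$ (j, i))"
proof -
  show A: "A \<in> carrier_mat d d" using assms by (simp add: hermitian_mats_def)
  fix i j assume "i < d" "j < d"
  then show "A $$ (i, j) = cnj (A $$ (j, i))"
    using assms mat_adjoint_index[OF A, of i j] by (simp add: hermitian_mats_def)
qed

lemma herm_inner_sum:
  assumes "A \<in> carrier_mat d d" "B \<in> carrier_mat d d"
  shows "herm_inner A B = (\<Sum>i<d. \<Sum>j<d. Re (A $$ (i, j) * B $$ (j, i)))"
  using assms by (simp add: herm_inner_def mat_trace_def scalar_prod_def atLeast0LessThan)

lemma herm_inner_hermitian: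
  assumes "A \<in> carrier_mat d d" "X \<in> hermitian_mats d"
  shows "herm_inner A X = (\<Sum>i<d. \<Sum>j<d. Re (A $$ (i, j) * cnj (X $$ (i, j))))"
proof -
  show ?thesis
    unfolding herm_inner_sum[OF assms(1) hermitian_matsD(1)[OF assms(2)]]
  proof (intro sum.cong refl)
    fix i j assume "i \<in> {..<d}" "j \<in> {..<d}"
    then have "X $$ (j, i) = cnj (X $$ (i, j))" by (intro hermitian_matsD(2)[OF assms(2)]) auto
    then show "Re (A $$ (i, j) * X $$ (j, i)) = Re (A $$ (i, j) * cnj (X $$ (i, j)))" by (rule arg_cong)
  qed
qed

lemma herm_inner_commute:
  assumes "A \<in> carrier_mat d d" "B \<in> carrier_mat d d"
  shows "herm_inner A B = herm_inner B A"
  unfolding herm_inner_sum[OF assms] herm_inner_sum[OF assms(2,1)]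
  by (subst sum.swap) (simp add: mult.commute)

lemma herm_inner_add_right:
  assumes "A \<in> carrier_mat d d" "B \<in> carrier_mat d d" "C \<in> carrier_mat d d"
  shows "herm_inner A (B + C) = herm_inner A B + herm_inner A C"
proof -
  have "herm_inner A (B + C) = (\<Sum>i<d. \<Sum>j<d. Re (A $$ (i, j) * B $$ (j, i)) + Re (A $$ (i, j) * C $$ (j, i)))"
    using assms by (subst herm_inner_sum[where d=d]) (auto simp: distrib_left intro!: sum.cong)
  then show ?thesis
    unfolding herm_inner_sum[OF assms(1,2)] herm_inner_sum[OF assms(1,3)] sum.distrib .
qed

lemma herm_inner_smult_right:
  assumes "A \<in> carrier_mat d d" "B \<in> carrier_mat d d"
  shows "herm_inner A (complex_of_real r \<cdot>\<^sub>m B) = r * herm_inner A B"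
proof -
  have "herm_inner A (complex_of_real r \<cdot>\<^sub>m B) = (\<Sum>i<d. \<Sum>j<d. r * Re (A $$ (i, j) * B $$ (j, i)))"
    using assms by (subst herm_inner_sum[where d=d]) (auto simp: algebra_simps intro!: sum.cong)
  then show ?thesis
    unfolding herm_inner_sum[OF assms] sum_distrib_left .
qed

lemma herm_inner_pos:
  assumes "H \<in> hermitian_mats d" "H \<noteq> 0\<^sub>m d d"
  shows "herm_inner H H > 0"
proof -
  have H: "H \<in> carrier_mat d d" using hermitian_matsD(1)[OF assms(1)] .
  have eq: "herm_inner H H = (\<Sum>i<d. \<Sum>j<d. (cmod (H $$ (i, j)))\<^sup>2)"
    using H assms(1) by (simp only: herm_inner_hermitian flip: complex_norm_square) (simp only: Re_complex_of_real)
  have "\<exists>i<d. \<exists>j<d. H $$ (i, j) \<noteq> 0"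
  proof (rule ccontr)
    assume "\<not> ?thesis"
    then have "H = 0\<^sub>m d d" using H by (intro eq_matI) auto
    with assms show False by simp
  qed
  then obtain i j where ij: "i < d" "j < d" "H $$ (i, j) \<noteq> 0" by auto
  then have "0 < (\<Sum>j<d. (cmod (H $$ (i, j)))\<^sup>2)" by (intro sum_pos2[of _ j]) auto
  with ij(1) show ?thesis unfolding eq
    by (rule_tac sum_pos2[of "{..<d}" i]) (simp_all only: sum_nonneg zero_le_power2 finite_lessThan lessThan_iff)
qed

lemma hermitian_mats_add:
  assumes "A \<in> hermitian_mats d" "B \<in> hermitian_mats d"
  shows "A + B \<in> hermitian_mats d"
proof (rule hermitian_matsI)
  fix i j assume "i < d" "j < d"
  then show "(A + B) $$ (i, j) = cnj ((A + B) $$ (j, i))"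
    using hermitian_matsD(1)[OF assms(1)] hermitian_matsD(1)[OF assms(2)]
      hermitian_matsD(2)[OF assms(1), of i j] hermitian_matsD(2)[OF assms(2), of i j] by simp
qed (use hermitian_matsD(1)[OF assms(1)] hermitian_matsD(1)[OF assms(2)] in auto)

lemma hermitian_mats_smult:
  assumes "A \<in> hermitian_mats d"
  shows "complex_of_real r \<cdot>\<^sub>m A \<in> hermitian_mats d"
proof (rule hermitian_matsI)
  fix i j assume "i < d" "j < d"
  then show "(complex_of_real r \<cdot>\<^sub>m A) $$ (i, j) = cnj ((complex_of_real r \<cdot>\<^sub>m A) $$ (j, i))"
    using hermitian_matsD(1)[OF assms] hermitian_matsD(2)[OF assms, of i j] by simp
qed (use hermitian_matsD(1)[OF assms] in auto)

lemma hermitian_mats_minus: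
  assumes "A \<in> hermitian_mats d" "B \<in> hermitian_mats d"
  shows "A - B \<in> hermitian_mats d"
proof (rule hermitian_matsI)
  fix i j assume "i < d" "j < d"
  then show "(A - B) $$ (i, j) = cnj ((A - B) $$ (j, i))"
    using hermitian_matsD(1)[OF assms(1)] hermitian_matsD(1)[OF assms(2)]
      hermitian_matsD(2)[OF assms(1), of i j] hermitian_matsD(2)[OF assms(2), of i j] by simp
qed (use hermitian_matsD(1)[OF assms(1)] hermitian_matsD(1)[OF assms(2)] in auto)

lemma borel_measurable_herm_inner:
  assumes "H \<in> carrier_mat d d"
  shows "herm_inner H \<in> borel_measurable (mat_borel d)"
proof -
  have "(\<lambda>X. \<Sum>i<d. \<Sum>j<d. Re (H $$ (i, j) * X $$ (j, i))) \<in> borel_measurable (mat_borel d)"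
    using mat_borel_entry by (intro borel_measurable_sum borel_measurable_Re borel_measurable_times) auto
  then show ?thesis
    using assms by (subst measurable_cong[where g="\<lambda>X. \<Sum>i<d. \<Sum>j<d. Re (H $$ (i, j) * X $$ (j, i))"])
      (auto simp: herm_inner_sum[where d=d])
qed

lemma borel_measurable_cnj':
  "f \<in> borel_measurable N \<Longrightarrow> (\<lambda>x. cnj (f x)) \<in> borel_measurable N"
  by (rule measurable_compose[OF _ borel_measurable_continuous_onI]) (auto intro: continuous_intros)

lemma sets_hermitian_mats: "hermitian_mats d \<in> sets (mat_borel d)"
proof -
  have "{X \<in> space (mat_borel d). \<forall>i\<in>{..<d}. \<forall>j\<in>{..<d}. X $$ (i, j) = cnj (X $$ (j, i))} \<in> sets (mat_borel d)"
    using mat_borel_entry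
    by (intro sets.sets_Collect_finite_All measurable_equality_set borel_measurable_cnj') auto
  also have "{X \<in> space (mat_borel d). \<forall>i\<in>{..<d}. \<forall>j\<in>{..<d}. X $$ (i, j) = cnj (X $$ (j, i))} = hermitian_mats d"
  proof (intro equalityI subsetI)
    fix X assume "X \<in> {X \<in> space (mat_borel d). \<forall>i\<in>{..<d}. \<forall>j\<in>{..<d}. X $$ (i, j) = cnj (X $$ (j, i))}"
    then have "X \<in> carrier_mat d d \<and> (\<forall>i<d. \<forall>j<d. X $$ (i, j) = cnj (X $$ (j, i)))"
      unfolding mem_Collect_eq space_mat_borel by blast
    then show "X \<in> hermitian_mats d" by (intro hermitian_matsI) blast+
  next
    fix X assume "X \<in> hermitian_mats d"
    from hermitian_matsD[OF this]
    show "X \<in> {X \<in> space (mat_borel d). \<forall>i\<in>{..<d}. \<forall>j\<in>{..<d}. X $$ (i, j) = cnj (X $$ (j, i))}"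
      unfolding mem_Collect_eq space_mat_borel by blast
  qed
  finally show ?thesis .
qed

lemma sets_Collect_hermitian_mats: "{X \<in> space (mat_borel d). X \<in> hermitian_mats d} \<in> sets (mat_borel d)"
  using sets_hermitian_mats[of d] hermitian_matsD(1)[of _ d]
  by (simp add: Collect_conj_eq Int_absorb1 subsetI)

text \<open>On Hermitian matrices every real linear form in the real and imaginary parts of the
  entries equals \<open>herm_inner H\<close> for some Hermitian \<open>H\<close>. The characteristic
  functions in \<open>ch\<close> are therefore all those that \<open>PiM_eqI_char\<close> asks for,
  once matrices are written as real arrays by \<kappa> and rebuilt by \<iota>.\<close>

lemma hermitian_law_eqI:
  assumes p: "prob_space \<mu>" "prob_space \<nu>"
    and s: "sets \<mu> = sets (mat_borel d)" "sets \<nu> = sets (mat_borel d)"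
    and h: "AE X in \<mu>. X \<in> hermitian_mats d" "AE X in \<nu>. X \<in> hermitian_mats d"
    and ch: "\<And>H. H \<in> hermitian_mats d \<Longrightarrow>
      (CLINT X|\<mu>. iexp (herm_inner H X)) = (CLINT X|\<nu>. iexp (herm_inner H X))"
  shows "\<mu> = \<nu>"
proof -
  define I where "I = {..<d} \<times> {..<d} \<times> (UNIV :: bool set)"
  have I: "finite I" by (simp add: I_def)
  define \<kappa> where "\<kappa> X = (\<lambda>(i, j, b)\<in>I. if b then Re (X $$ (i, j)) else Im (X $$ (i, j)))" for X :: "complex mat"
  define \<iota> where "\<iota> x = mat d d (\<lambda>(i, j). Complex (x (i, j, True)) (x (i, j, False)))" for x :: "nat \<times> nat \<times> bool \<Rightarrow> real"
  have k: "\<kappa> \<in> mat_borel d \<rightarrow>\<^sub>M PiM I (\<lambda>_. borel)"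
  proof -
    have "(\<lambda>X :: complex mat. if b then Re (X $$ (i, j)) else Im (X $$ (i, j))) \<in> borel_measurable (mat_borel d)"
      if "i < d" "j < d" for i j b
      using mat_borel_entry[OF that] by (cases b) (auto intro!: borel_measurable_Re borel_measurable_Im)
    then show ?thesis
      unfolding \<kappa>_def[abs_def] by (intro measurable_restrict) (auto simp: I_def)
  qed
  have i: "\<iota> \<in> PiM I (\<lambda>_. borel) \<rightarrow>\<^sub>M mat_borel d"
  proof (rule measurable_mat_borelI)
    fix i j assume "i < d" "j < d"
    then have "(\<lambda>x. Complex (x (i, j, True)) (x (i, j, False))) \<in> borel_measurable (PiM I (\<lambda>_. borel))"
      unfolding Complex_eq by (intro borel_measurable_add borel_measurable_times) (auto simp: I_def)
    then show "(\<lambda>x. \<iota> x $$ (i, j)) \<in> borel_measurable (PiM I (\<lambda>_. borel))"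
      using \<open>i < d\<close> \<open>j < d\<close> by (simp add: \<iota>_def)
  qed (simp add: \<iota>_def)
  have ik: "\<iota> (\<kappa> X) = X" if "X \<in> carrier_mat d d" for X
    using that by (intro eq_matI) (auto simp: \<iota>_def \<kappa>_def I_def)
  have lin: "\<exists>H\<in>hermitian_mats d. \<forall>X\<in>hermitian_mats d. (\<Sum>k\<in>I. u k * \<kappa> X k) = herm_inner H X" for u
  proof -
    define Y where "Y i j = Complex (u (i, j, True)) (u (i, j, False))" for i j
    \<comment> \<open>The Hermitian part of the coefficient matrix \<open>Y\<close>: a Hermitian
      \<open>X\<close> pairs with \<open>Y\<close> and with the adjoint of \<open>Y\<close> to the
      same real part.\<close>
    define H where "H = mat d d (\<lambda>(i, j). (Y i j + cnj (Y j i)) / 2)"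
    have H: "H \<in> hermitian_mats d" by (rule hermitian_matsI) (auto simp: H_def)
    moreover have "(\<Sum>k\<in>I. u k * \<kappa> X k) = herm_inner H X" if X: "X \<in> hermitian_mats d" for X
    proof -
      have "(\<Sum>k\<in>I. u k * \<kappa> X k) = (\<Sum>i<d. \<Sum>j<d. Re (Y i j * cnj (X $$ (i, j))))"
      proof -
        have "(\<Sum>k\<in>I. u k * \<kappa> X k) = (\<Sum>i<d. \<Sum>j<d. \<Sum>b\<in>UNIV. u (i, j, b) * \<kappa> X (i, j, b))"
          unfolding I_def by (simp add: sum.cartesian_product split_def)
        also have "\<dots> = (\<Sum>i<d. \<Sum>j<d. Re (Y i j * cnj (X $$ (i, j))))"
          by (auto intro!: sum.cong simp: \<kappa>_def I_def Y_def UNIV_bool)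
        finally show ?thesis .
      qed
      moreover have "(\<Sum>i<d. \<Sum>j<d. Re (cnj (Y j i) * cnj (X $$ (i, j)))) = (\<Sum>i<d. \<Sum>j<d. Re (Y i j * cnj (X $$ (i, j))))"
      proof (subst sum.swap, intro sum.cong refl)
        fix i j assume "i \<in> {..<d}" "j \<in> {..<d}"
        then show "Re (cnj (Y i j) * cnj (X $$ (j, i))) = Re (Y i j * cnj (X $$ (i, j)))"
          using hermitian_matsD(2)[OF X, of i j] by simp
      qed
      moreover have "herm_inner H X = (\<Sum>i<d. \<Sum>j<d. (Re (Y i j * cnj (X $$ (i, j))) + Re (cnj (Y j i) * cnj (X $$ (i, j)))) / 2)"
        unfolding herm_inner_hermitian[OF hermitian_matsD(1)[OF H] X]
        by (intro sum.cong refl) (simp add: H_def field_simps)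
      ultimately show ?thesis
        by (simp add: sum.distrib flip: sum_divide_distrib)
    qed
    ultimately show ?thesis by blast
  qed
  have dk: "distr \<mu> (PiM I (\<lambda>_. borel)) \<kappa> = distr \<nu> (PiM I (\<lambda>_. borel)) \<kappa>"
  proof (rule PiM_eqI_char[OF I])
    fix u
    obtain H where H: "H \<in> hermitian_mats d" and eq: "\<And>X. X \<in> hermitian_mats d \<Longrightarrow> (\<Sum>k\<in>I. u k * \<kappa> X k) = herm_inner H X"
      using lin by blast
    have um: "(\<lambda>x. iexp (\<Sum>k\<in>I. u k * x k)) \<in> borel_measurable (PiM I (\<lambda>_. borel))"
    proof -
      have "(\<lambda>x. \<Sum>k\<in>I. u k * x k) \<in> borel_measurable (PiM I (\<lambda>_. borel))"
        by (intro borel_measurable_sum borel_measurable_times) auto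
      then show ?thesis by measurable
    qed
    have "(CLINT x|distr m (PiM I (\<lambda>_. borel)) \<kappa>. iexp (\<Sum>k\<in>I. u k * x k)) = (CLINT X|m. iexp (herm_inner H X))"
      if m: "sets m = sets (mat_borel d)" "AE X in m. X \<in> hermitian_mats d" for m
    proof -
      have km: "\<kappa> \<in> m \<rightarrow>\<^sub>M PiM I (\<lambda>_. borel)" using k unfolding measurable_cong_sets[OF m(1) refl] .
      have hm: "(\<lambda>X. iexp (herm_inner H X)) \<in> borel_measurable m"
      proof -
        have "herm_inner H \<in> borel_measurable m"
          using borel_measurable_herm_inner[OF hermitian_matsD(1)[OF H]] unfolding measurable_cong_sets[OF m(1) refl] .
        then show ?thesis by measurable
      qed
      have "(CLINT x|distr m (PiM I (\<lambda>_. borel)) \<kappa>. iexp (\<Sum>k\<in>I. u k * x k)) = (CLINT X|m. iexp (\<Sum>k\<in>I. u k * \<kappa> X k))"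
        by (rule integral_distr[OF km um])
      also have "\<dots> = (CLINT X|m. iexp (herm_inner H X))"
      proof (rule integral_cong_AE[OF measurable_compose[OF km um] hm])
        show "AE X in m. iexp (\<Sum>k\<in>I. u k * \<kappa> X k) = iexp (herm_inner H X)"
          using m(2) by eventually_elim (simp only: eq)
      qed
      finally show ?thesis .
    qed
    from this[OF s(1) h(1)] this[OF s(2) h(2)] ch[OF H]
    show "(CLINT x|distr \<mu> (PiM I (\<lambda>_. borel)) \<kappa>. iexp (\<Sum>k\<in>I. u k * x k)) = (CLINT x|distr \<nu> (PiM I (\<lambda>_. borel)) \<kappa>. iexp (\<Sum>k\<in>I. u k * x k))"
      by simp
  qed (use k p in \<open>auto intro!: prob_space.prob_space_distr simp: measurable_cong_sets[OF s(1) refl] measurable_cong_sets[OF s(2) refl]\<close>)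
  have "distr (distr m (PiM I (\<lambda>_. borel)) \<kappa>) (mat_borel d) \<iota> = m" if m: "sets m = sets (mat_borel d)" for m
  proof -
    have "distr (distr m (PiM I (\<lambda>_. borel)) \<kappa>) (mat_borel d) \<iota> = distr m (mat_borel d) (\<iota> \<circ> \<kappa>)"
      using k i by (intro distr_distr) (simp_all add: measurable_cong_sets[OF m(1) refl])
    also have "\<dots> = distr m (mat_borel d) (\<lambda>X. X)"
      using sets_eq_imp_space_eq[OF m] by (intro distr_cong) (auto simp: ik)
    also have "\<dots> = m" using m by (intro distr_id2) simp
    finally show ?thesis .
  qed
  from this[OF s(1)] this[OF s(2)] dk show ?thesis by metis
qed

text \<open>The centred Gaussian law with covariance \<tau> times the identity for
  \<open>herm_inner\<close>, given by its characteristic function because this form determines the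
  law and is easy to follow under linear maps. The measure lives on all square matrices, so being
  Hermitian is an almost sure condition.\<close>

definition hermitian_gaussian :: "nat \<Rightarrow> real \<Rightarrow> complex mat measure \<Rightarrow> bool" where
  "hermitian_gaussian d \<tau> \<mu> \<longleftrightarrow> prob_space \<mu> \<and> sets \<mu> = sets (mat_borel d) \<and>
     (AE X in \<mu>. X \<in> hermitian_mats d) \<and>
     (\<forall>H\<in>hermitian_mats d. (CLINT X|\<mu>. iexp (herm_inner H X)) = exp (- \<tau> * herm_inner H H / 2))"

lemma hermitian_gaussian_unique:
  "hermitian_gaussian d \<tau> \<mu> \<Longrightarrow> hermitian_gaussian d \<tau> \<nu> \<Longrightarrow> \<mu> = \<nu>"
  unfolding hermitian_gaussian_def by (rule hermitian_law_eqI[of _ _ d]) auto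

lemma mat_trace_commute:
  assumes "A \<in> carrier_mat d d" "B \<in> carrier_mat d d"
  shows "mat_trace (A * B) = mat_trace (B * A)"
proof -
  have "mat_trace (A * B) = (\<Sum>i<d. \<Sum>j<d. A $$ (i, j) * B $$ (j, i))"
    using assms by (simp add: mat_trace_def scalar_prod_def atLeast0LessThan)
  also have "\<dots> = (\<Sum>j<d. \<Sum>i<d. B $$ (j, i) * A $$ (i, j))"
    by (subst sum.swap) (simp add: mult.commute)
  also have "\<dots> = mat_trace (B * A)"
    using assms by (simp add: mat_trace_def scalar_prod_def atLeast0LessThan)
  finally show ?thesis .
qed

text \<open>Cyclicity of the trace moves the conjugation from \<open>X\<close> to the test matrix
  \<open>H\<close>. Conjugation by a unitary matrix is an isometry of \<open>herm_inner\<close>, so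
  the characteristic function does not change, and it determines the law.\<close>

lemma hermitian_gaussian_conj:
  assumes g: "hermitian_gaussian d \<tau> \<mu>"
    and U: "U \<in> carrier_mat d d" "W \<in> carrier_mat d d" "U * W = 1\<^sub>m d" "W = mat_adjoint U"
  shows "distr \<mu> (mat_borel d) (\<lambda>X. U * X * W) = \<mu>"
proof (rule hermitian_gaussian_unique[OF _ g])
  have p: "prob_space \<mu>" and s: "sets \<mu> = sets (mat_borel d)"
    and h: "AE X in \<mu>. X \<in> hermitian_mats d"
    and ch: "\<And>H. H \<in> hermitian_mats d \<Longrightarrow> (CLINT X|\<mu>. iexp (herm_inner H X)) = exp (- \<tau> * herm_inner H H / 2)"
    using g by (auto simp: hermitian_gaussian_def)
  have Wij: "W $$ (i, j) = cnj (U $$ (j, i))" if "i < d" "j < d" for i j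
    using that U mat_adjoint_index[of U d d i j] by auto
  have meas: "(\<lambda>X. U * X * W) \<in> mat_borel d \<rightarrow>\<^sub>M mat_borel d"
  proof (rule measurable_mat_borelI)
    fix i j assume ij: "i < d" "j < d"
    have "(\<lambda>X. \<Sum>k<d. (\<Sum>l<d. U $$ (i, l) * X $$ (l, k)) * W $$ (k, j)) \<in> borel_measurable (mat_borel d)"
      using mat_borel_entry by (intro borel_measurable_sum borel_measurable_times) auto
    then show "(\<lambda>X. (U * X * W) $$ (i, j)) \<in> borel_measurable (mat_borel d)"
      using U ij by (subst measurable_cong[where g="\<lambda>X. \<Sum>k<d. (\<Sum>l<d. U $$ (i, l) * X $$ (l, k)) * W $$ (k, j)"])
        (auto simp: scalar_prod_def atLeast0LessThan simp del: assoc_mult_mat)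
  qed (use U in auto)
  then have meas': "(\<lambda>X. U * X * W) \<in> \<mu> \<rightarrow>\<^sub>M mat_borel d" unfolding measurable_cong_sets[OF s refl] .
  have herm: "U * X * W \<in> hermitian_mats d" "W * X * U \<in> hermitian_mats d" if X: "X \<in> hermitian_mats d" for X
  proof -
    have Xc: "X \<in> carrier_mat d d" using hermitian_matsD(1)[OF X] .
    have 1: "(U * X * W) $$ (i, j) = (\<Sum>k<d. \<Sum>l<d. U $$ (i, l) * X $$ (l, k) * cnj (U $$ (j, k)))"
      if "i < d" "j < d" for i j
      using U(1,2) Xc that by (simp add: scalar_prod_def atLeast0LessThan Wij sum_distrib_right del: assoc_mult_mat)
    have 2: "(W * X * U) $$ (i, j) = (\<Sum>k<d. \<Sum>l<d. cnj (U $$ (l, i)) * X $$ (l, k) * U $$ (k, j))"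
      if "i < d" "j < d" for i j
      using U(1,2) Xc that by (simp add: scalar_prod_def atLeast0LessThan Wij sum_distrib_right del: assoc_mult_mat)
    show "U * X * W \<in> hermitian_mats d"
    proof (rule hermitian_matsI)
      fix i j assume ij: "i < d" "j < d"
      show "(U * X * W) $$ (i, j) = cnj ((U * X * W) $$ (j, i))"
        unfolding 1[OF ij] 1[OF ij(2,1)] cnj_sum
      proof (subst sum.swap, intro sum.cong refl)
        fix k l assume "k \<in> {..<d}" "l \<in> {..<d}"
        then show "U $$ (i, k) * X $$ (k, l) * cnj (U $$ (j, l)) = cnj (U $$ (j, l) * X $$ (l, k) * cnj (U $$ (i, k)))"
          using hermitian_matsD(2)[OF X, of k l] by simp
      qed
    qed (use U Xc in auto)
    show "W * X * U \<in> hermitian_mats d"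
    proof (rule hermitian_matsI)
      fix i j assume ij: "i < d" "j < d"
      show "(W * X * U) $$ (i, j) = cnj ((W * X * U) $$ (j, i))"
        unfolding 2[OF ij] 2[OF ij(2,1)] cnj_sum
      proof (subst sum.swap, intro sum.cong refl)
        fix k l assume "k \<in> {..<d}" "l \<in> {..<d}"
        then show "cnj (U $$ (k, i)) * X $$ (k, l) * U $$ (l, j) = cnj (cnj (U $$ (l, j)) * X $$ (l, k) * U $$ (k, i))"
          using hermitian_matsD(2)[OF X, of k l] by simp
      qed
    qed (use U Xc in auto)
  qed
  have cyc: "herm_inner H (U * X * W) = herm_inner (W * H * U) X"
    if "H \<in> carrier_mat d d" "X \<in> carrier_mat d d" for H X
  proof -
    have "H * (U * X * W) = (H * U * X) * W" using that U by (simp add: assoc_mult_mat[of _ d d _ d _ d])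
    also have "mat_trace \<dots> = mat_trace (W * (H * U * X))" using that U by (intro mat_trace_commute) auto
    also have "W * (H * U * X) = (W * H * U) * X" using that U by (simp add: assoc_mult_mat[of _ d d _ d _ d])
    finally show ?thesis by (simp add: herm_inner_def)
  qed
  have norm: "herm_inner (W * H * U) (W * H * U) = herm_inner H H" if H: "H \<in> carrier_mat d d" for H
  proof -
    have "herm_inner (W * H * U) (W * H * U) = herm_inner H (U * (W * H * U) * W)"
      using U H by (subst cyc) auto
    also have "U * (W * H * U) * W = (U * W) * H * (U * W)"
      using U(1,2) H by (simp add: assoc_mult_mat[of _ d d _ d _ d])
    also have "\<dots> = H" using U H by simp
    finally show ?thesis .
  qed
  show "hermitian_gaussian d \<tau> (distr \<mu> (mat_borel d) (\<lambda>X. U * X * W))"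
    unfolding hermitian_gaussian_def
  proof (intro conjI ballI)
    show "prob_space (distr \<mu> (mat_borel d) (\<lambda>X. U * X * W))"
      using p meas' by (rule prob_space.prob_space_distr)
    show "AE X in distr \<mu> (mat_borel d) (\<lambda>X. U * X * W). X \<in> hermitian_mats d"
    proof (subst AE_distr_iff[OF meas' sets_Collect_hermitian_mats])
      show "AE X in \<mu>. U * X * W \<in> hermitian_mats d"
        using h by eventually_elim (rule herm(1))
    qed
    fix H assume H: "H \<in> hermitian_mats d"
    have Hc: "H \<in> carrier_mat d d" using hermitian_matsD(1)[OF H] .
    have "herm_inner H \<in> borel_measurable (mat_borel d)" using Hc by (rule borel_measurable_herm_inner)
    then have "(\<lambda>X. iexp (herm_inner H X)) \<in> borel_measurable (mat_borel d)" by measurable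
    then have "(CLINT X|distr \<mu> (mat_borel d) (\<lambda>X. U * X * W). iexp (herm_inner H X)) = (CLINT X|\<mu>. iexp (herm_inner H (U * X * W)))"
      using meas' by (intro integral_distr)
    also have "\<dots> = (CLINT X|\<mu>. iexp (herm_inner (W * H * U) X))"
      using sets_eq_imp_space_eq[OF s] Hc by (intro Bochner_Integration.integral_cong) (auto simp: cyc)
    also have "\<dots> = exp (- \<tau> * herm_inner H H / 2)"
      using ch[OF herm(2)[OF H]] norm[OF Hc] by simp
    finally show "(CLINT X|distr \<mu> (mat_borel d) (\<lambda>X. U * X * W). iexp (herm_inner H X)) = exp (- \<tau> * herm_inner H H / 2)" .
  qed simp
qed

section \<open>Law of the increments and null sets of Gaussian matrices\<close>

lemma measurable_mat_borel_minus:
  assumes "f \<in> N \<rightarrow>\<^sub>M mat_borel d" "g \<in> N \<rightarrow>\<^sub>M mat_borel d"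
  shows "(\<lambda>x. f x - g x) \<in> N \<rightarrow>\<^sub>M mat_borel d"
proof (rule measurable_mat_borelI)
  have c: "f x \<in> carrier_mat d d" "g x \<in> carrier_mat d d" if "x \<in> space N" for x
    using measurable_space[OF assms(1) that] measurable_space[OF assms(2) that] by auto
  show "f x - g x \<in> carrier_mat d d" if "x \<in> space N" for x by (rule minus_carrier_mat[OF c(2)[OF that]])
  fix i j assume ij: "i < d" "j < d"
  have "(\<lambda>x. f x $$ (i, j) - g x $$ (i, j)) \<in> borel_measurable N"
    using measurable_mat_entry[OF assms(1) ij] measurable_mat_entry[OF assms(2) ij] by (rule borel_measurable_diff)
  then show "(\<lambda>x. (f x - g x) $$ (i, j)) \<in> borel_measurable N"
  proof (rule measurable_cong[THEN iffD2, rotated])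
    fix x assume "x \<in> space N"
    then show "(f x - g x) $$ (i, j) = f x $$ (i, j) - g x $$ (i, j)"
      using ij c[of x] by (intro index_minus_mat(1)) auto
  qed
qed

lemma measurable_mat_borel_add:
  assumes "f \<in> N \<rightarrow>\<^sub>M mat_borel d" "g \<in> N \<rightarrow>\<^sub>M mat_borel d"
  shows "(\<lambda>x. f x + g x) \<in> N \<rightarrow>\<^sub>M mat_borel d"
proof (rule measurable_mat_borelI)
  have c: "f x \<in> carrier_mat d d" "g x \<in> carrier_mat d d" if "x \<in> space N" for x
    using measurable_space[OF assms(1) that] measurable_space[OF assms(2) that] by auto
  show "f x + g x \<in> carrier_mat d d" if "x \<in> space N" for x by (rule add_carrier_mat[OF c(2)[OF that]])
  fix i j assume ij: "i < d" "j < d"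
  have "(\<lambda>x. f x $$ (i, j) + g x $$ (i, j)) \<in> borel_measurable N"
    using measurable_mat_entry[OF assms(1) ij] measurable_mat_entry[OF assms(2) ij] by (rule borel_measurable_add)
  then show "(\<lambda>x. (f x + g x) $$ (i, j)) \<in> borel_measurable N"
  proof (rule measurable_cong[THEN iffD2, rotated])
    fix x assume "x \<in> space N"
    then show "(f x + g x) $$ (i, j) = f x $$ (i, j) + g x $$ (i, j)"
      using ij c[of x] by (intro index_add_mat(1)) auto
  qed
qed

lemma measurable_mat_borel_smult:
  assumes "\<alpha> \<in> borel_measurable N" "A \<in> carrier_mat d d"
  shows "(\<lambda>x. complex_of_real (\<alpha> x) \<cdot>\<^sub>m A) \<in> N \<rightarrow>\<^sub>M mat_borel d"
proof (rule measurable_mat_borelI)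
  fix i j assume ij: "i < d" "j < d"
  have "(\<lambda>x. complex_of_real (\<alpha> x) * A $$ (i, j)) \<in> borel_measurable N"
    using assms(1) by measurable
  then show "(\<lambda>x. (complex_of_real (\<alpha> x) \<cdot>\<^sub>m A) $$ (i, j)) \<in> borel_measurable N"
    using ij assms(2) by simp
qed (use assms in auto)

lemma increment_hermitian_gaussian:
  assumes bm: "standard_hermitian_bm M d B" and st: "0 \<le> s" "s < t"
  shows "hermitian_gaussian d (t - s) (distr M (mat_borel d) (\<lambda>\<omega>. B t \<omega> - B s \<omega>))"
proof -
  have p: "prob_space M" and Bm: "\<And>u. 0 \<le> u \<Longrightarrow> B u \<in> M \<rightarrow>\<^sub>M mat_borel d"
    and Bh: "\<And>u \<omega>. 0 \<le> u \<Longrightarrow> \<omega> \<in> space M \<Longrightarrow> B u \<omega> \<in> hermitian_mats d"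
    and dist: "\<And>H. H \<in> hermitian_mats d \<Longrightarrow> H \<noteq> 0\<^sub>m d d \<Longrightarrow>
      distributed M lborel (\<lambda>\<omega>. herm_inner H (B t \<omega> - B s \<omega>)) (normal_density 0 (sqrt ((t - s) * herm_inner H H)))"
    using bm st unfolding standard_hermitian_bm_def by auto
  interpret prob_space M by fact
  let ?D = "\<lambda>\<omega>. B t \<omega> - B s \<omega>"
  have Dm: "?D \<in> M \<rightarrow>\<^sub>M mat_borel d" using st by (intro measurable_mat_borel_minus Bm) auto
  have Dh: "?D \<omega> \<in> hermitian_mats d" if "\<omega> \<in> space M" for \<omega>
    using st that by (intro hermitian_mats_minus Bh) auto
  show ?thesis
    unfolding hermitian_gaussian_def
  proof (intro conjI ballI)
    show "prob_space (distr M (mat_borel d) ?D)" using Dm by (rule prob_space_distr)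
    show "AE X in distr M (mat_borel d) ?D. X \<in> hermitian_mats d"
    proof (subst AE_distr_iff[OF Dm sets_Collect_hermitian_mats])
    qed (use Dh in auto)
    fix H assume H: "H \<in> hermitian_mats d"
    have Hm: "herm_inner H \<in> borel_measurable (mat_borel d)"
      by (rule borel_measurable_herm_inner[OF hermitian_matsD(1)[OF H]])
    have "(CLINT X|distr M (mat_borel d) ?D. iexp (herm_inner H X)) = (CLINT \<omega>|M. iexp (herm_inner H (?D \<omega>)))"
      using Hm by (intro integral_distr Dm) measurable
    also have "\<dots> = exp (- (t - s) * herm_inner H H / 2)"
    \<comment> \<open>The projection on \<open>H = 0\<close> is constant and has no normal density,
      so its characteristic function is computed directly. Otherwise the projection is standardised
      by \<sigma>.\<close>
    proof (cases "H = 0\<^sub>m d d")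
      case True
      have "herm_inner H X = 0" if "X \<in> carrier_mat d d" for X
        using that True by (subst herm_inner_sum[where d=d]) auto
      then have "(CLINT \<omega>|M. iexp (herm_inner H (?D \<omega>))) = (CLINT \<omega>|M. 1)"
        using hermitian_matsD(1)[OF Dh] by (intro Bochner_Integration.integral_cong) auto
      moreover have "herm_inner H H = 0"
        using True by (subst herm_inner_sum[where d=d]) auto
      ultimately show ?thesis by (simp add: prob_space)
    next
      case False
      define \<sigma> where "\<sigma> = sqrt ((t - s) * herm_inner H H)"
      have \<sigma>: "\<sigma> > 0" using st herm_inner_pos[OF H False] by (simp add: \<sigma>_def)
      have \<sigma>2: "\<sigma>\<^sup>2 = (t - s) * herm_inner H H"
        using st herm_inner_pos[OF H False] by (simp add: \<sigma>_def)
      let ?Y = "\<lambda>\<omega>. (herm_inner H (?D \<omega>) - 0) / \<sigma>"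
      have Y: "distributed M lborel ?Y std_normal_density"
        using dist[OF H False] normal_standard_normal_convert[OF \<sigma>, of "\<lambda>\<omega>. herm_inner H (?D \<omega>)" 0]
        unfolding \<sigma>_def[symmetric] by simp
      have Ym: "?Y \<in> M \<rightarrow>\<^sub>M lborel" using Y by (rule distributed_measurable)
      have "(CLINT \<omega>|M. iexp (herm_inner H (?D \<omega>))) = (CLINT \<omega>|M. iexp (\<sigma> * ?Y \<omega>))"
        using \<sigma> by simp
      also have "\<dots> = (CLINT x|distr M lborel ?Y. iexp (\<sigma> * x))"
        by (rule integral_distr[OF Ym, symmetric]) measurable
      also have "\<dots> = char std_normal_distribution \<sigma>"
        using distributed_distr_eq_density[OF Y] by (simp add: char_def)
      also have "\<dots> = exp (- (t - s) * herm_inner H H / 2)"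
        by (simp add: char_std_normal_distribution \<sigma>2, simp add: algebra_simps)
      finally show ?thesis .
    qed
    finally show "(CLINT X|distr M (mat_borel d) ?D. iexp (herm_inner H X)) = exp (- (t - s) * herm_inner H H / 2)" .
  qed simp
qed

text \<open>Replacing the component of \<open>X\<close> along \<open>X0\<close> by an independent normal variable does not change
  the law, and along each line parallel to \<open>X0\<close> there are finitely many zeros.\<close>

lemma hermitian_gaussian_AE_nonzero:
  fixes q :: "complex mat \<Rightarrow> complex"
  assumes g: "hermitian_gaussian d \<tau> \<mu>" and \<tau>: "\<tau> > 0"
    and X0: "X0 \<in> hermitian_mats d" "X0 \<noteq> 0\<^sub>m d d"
    and q: "q \<in> borel_measurable (mat_borel d)"
    and fin: "\<And>X. X \<in> hermitian_mats d \<Longrightarrow> finite {r :: real. q (X + complex_of_real r \<cdot>\<^sub>m X0) = 0}"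
  shows "AE X in \<mu>. q X \<noteq> 0"
proof -
  have p: "prob_space \<mu>" and s: "sets \<mu> = sets (mat_borel d)"
    and h: "AE X in \<mu>. X \<in> hermitian_mats d"
    and ch: "\<And>H. H \<in> hermitian_mats d \<Longrightarrow> (CLINT X|\<mu>. iexp (herm_inner H X)) = exp (- \<tau> * herm_inner H H / 2)"
    using g by (auto simp: hermitian_gaussian_def)
  let ?S = "std_normal_distribution"
  interpret mu: prob_space \<mu> by fact
  interpret S: prob_space ?S by (rule prob_space_normal_density) simp
  interpret P: pair_prob_space \<mu> ?S ..
  define n2 where "n2 = herm_inner X0 X0"
  have n2: "n2 > 0" using herm_inner_pos[OF X0] by (simp add: n2_def)
  have X0c: "X0 \<in> carrier_mat d d" by (rule hermitian_matsD(1)[OF X0(1)])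
  \<comment> \<open>The coefficient of \<open>X\<close> along \<open>X0\<close> is
    \<open>herm_inner X0 X / n2\<close>, a centred normal variable of variance
    \<open>\<tau> / n2\<close>. It is subtracted and replaced by \<open>sqrt (\<tau> / n2)\<close>
    times an independent standard normal variable.\<close>
  define \<alpha> where "\<alpha> x = snd x * sqrt (\<tau> / n2) - herm_inner X0 (fst x) / n2" for x
  define W where "W x = fst x + complex_of_real (\<alpha> x) \<cdot>\<^sub>m X0" for x
  have f1: "fst \<in> \<mu> \<Otimes>\<^sub>M ?S \<rightarrow>\<^sub>M mat_borel d"
    using measurable_fst[of \<mu> ?S] unfolding measurable_cong_sets[OF refl s] .
  have hm: "(\<lambda>x. herm_inner H (fst x)) \<in> borel_measurable (\<mu> \<Otimes>\<^sub>M ?S)" if "H \<in> carrier_mat d d" for H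
    by (rule measurable_compose[OF f1 borel_measurable_herm_inner[OF that]])
  have sm: "snd \<in> borel_measurable (\<mu> \<Otimes>\<^sub>M ?S)" by measurable
  have \<alpha>m: "\<alpha> \<in> borel_measurable (\<mu> \<Otimes>\<^sub>M ?S)"
    unfolding \<alpha>_def[abs_def] using hm[OF X0c] sm by measurable
  have Wm: "W \<in> \<mu> \<Otimes>\<^sub>M ?S \<rightarrow>\<^sub>M mat_borel d"
    unfolding W_def[abs_def] by (intro measurable_mat_borel_add f1 measurable_mat_borel_smult \<alpha>m X0c)
  have "hermitian_gaussian d \<tau> (distr (\<mu> \<Otimes>\<^sub>M ?S) (mat_borel d) W)"
    unfolding hermitian_gaussian_def
  proof (intro conjI ballI)
    show "prob_space (distr (\<mu> \<Otimes>\<^sub>M ?S) (mat_borel d) W)" using Wm by (rule P.prob_space_distr)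
    show "AE X in distr (\<mu> \<Otimes>\<^sub>M ?S) (mat_borel d) W. X \<in> hermitian_mats d"
    proof (subst AE_distr_iff[OF Wm sets_Collect_hermitian_mats])
      show "AE x in \<mu> \<Otimes>\<^sub>M ?S. W x \<in> hermitian_mats d"
      proof (rule P.AE_pair_measure)
        have "W -` hermitian_mats d \<inter> space (\<mu> \<Otimes>\<^sub>M ?S) \<in> sets (\<mu> \<Otimes>\<^sub>M ?S)"
          by (rule measurable_sets[OF Wm sets_hermitian_mats])
        then show "{x \<in> space (\<mu> \<Otimes>\<^sub>M ?S). W x \<in> hermitian_mats d} \<in> sets (\<mu> \<Otimes>\<^sub>M ?S)"
          by (simp add: vimage_def Int_def conj_commute)
        show "AE x in \<mu>. AE y in ?S. W (x, y) \<in> hermitian_mats d"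
          using h by eventually_elim (auto simp: W_def intro!: hermitian_mats_add hermitian_mats_smult X0)
      qed
    qed
    fix H assume H: "H \<in> hermitian_mats d"
    have Hc: "H \<in> carrier_mat d d" by (rule hermitian_matsD(1)[OF H])
    define b where "b = herm_inner H X0"
    \<comment> \<open>The component of \<open>H\<close> orthogonal to \<open>X0\<close>. The pairing
      of \<open>H\<close> with \<open>W\<close> splits into that of \<open>H'\<close> with
      \<open>X\<close> and an independent normal term, and the two variances add up by
      Pythagoras.\<close>
    define H' where "H' = H + complex_of_real (- b / n2) \<cdot>\<^sub>m X0"
    have H': "H' \<in> hermitian_mats d" unfolding H'_def by (intro hermitian_mats_add hermitian_mats_smult H X0)
    have H'c: "H' \<in> carrier_mat d d" by (rule hermitian_matsD(1)[OF H'])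
    have inner': "herm_inner H' X = herm_inner H X - b / n2 * herm_inner X0 X" if X: "X \<in> carrier_mat d d" for X
    proof -
      have "herm_inner X H' = herm_inner X H + (- b / n2) * herm_inner X X0"
        unfolding H'_def using X Hc X0c
        by (simp add: herm_inner_add_right[where d=d] herm_inner_smult_right[where d=d] del: of_real_minus of_real_divide)
      then show ?thesis
        using herm_inner_commute[OF H'c X] herm_inner_commute[OF Hc X] herm_inner_commute[OF X0c X] by simp
    qed
    have nn: "herm_inner H' H' = herm_inner H H - b\<^sup>2 / n2"
    proof -
      have "herm_inner H H' = herm_inner H H + (- b / n2) * b"
        unfolding H'_def b_def using Hc X0c
        by (simp add: herm_inner_add_right[where d=d] herm_inner_smult_right[where d=d] del: of_real_minus of_real_divide)
      moreover have "herm_inner X0 H' = b + (- b / n2) * n2"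
        unfolding H'_def b_def n2_def using Hc X0c
        using herm_inner_commute[OF X0c Hc]
        by (simp add: herm_inner_add_right[where d=d] herm_inner_smult_right[where d=d] del: of_real_minus of_real_divide)
      ultimately show ?thesis
        using n2 by (simp add: inner'[OF H'c] power2_eq_square)
    qed
    have innerW: "herm_inner H (W (X, y)) = herm_inner H' X + y * (sqrt (\<tau> / n2) * b)" if X: "X \<in> carrier_mat d d" for X y
      using X Hc X0c inner'[OF X] unfolding W_def
      by (simp add: herm_inner_add_right[where d=d] herm_inner_smult_right[where d=d] \<alpha>_def b_def algebra_simps
          del: of_real_minus of_real_divide of_real_diff of_real_mult)
    have m1: "(\<lambda>X. iexp (herm_inner H X)) \<in> borel_measurable (mat_borel d)"
      using borel_measurable_herm_inner[OF Hc] by measurable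
    have "(CLINT X|distr (\<mu> \<Otimes>\<^sub>M ?S) (mat_borel d) W. iexp (herm_inner H X)) = (CLINT x|\<mu> \<Otimes>\<^sub>M ?S. iexp (herm_inner H (W x)))"
      by (rule integral_distr[OF Wm m1])
    also have "\<dots> = (CLINT X|\<mu>. CLINT y|?S. iexp (herm_inner H (W (X, y))))"
    proof (rule P.integral_fst'[symmetric])
      show "integrable (\<mu> \<Otimes>\<^sub>M ?S) (\<lambda>x. iexp (herm_inner H (W x)))"
        using measurable_compose[OF Wm m1] by (intro P.integrable_const_bound[where B=1]) auto
    qed
    also have "\<dots> = (CLINT X|\<mu>. iexp (herm_inner H' X) * exp (- (sqrt (\<tau> / n2) * b)\<^sup>2 / 2))"
    proof (rule Bochner_Integration.integral_cong[OF refl])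
      fix X assume "X \<in> space \<mu>"
      then have X: "X \<in> carrier_mat d d" using sets_eq_imp_space_eq[OF s] by simp
      have "(CLINT y|?S. iexp (herm_inner H (W (X, y)))) = (CLINT y|?S. iexp (herm_inner H' X) * iexp ((sqrt (\<tau> / n2) * b) * y))"
        by (simp only: innerW[OF X] of_real_add distrib_left exp_add mult.commute[of _ "sqrt (\<tau> / n2) * b"])
      also have "\<dots> = iexp (herm_inner H' X) * char ?S (sqrt (\<tau> / n2) * b)"
        unfolding char_def by (rule integral_mult_right_zero)
      finally show "(CLINT y|?S. iexp (herm_inner H (W (X, y)))) = iexp (herm_inner H' X) * exp (- (sqrt (\<tau> / n2) * b)\<^sup>2 / 2)"
        by (simp add: char_std_normal_distribution)
    qed
    also have "\<dots> = exp (- \<tau> * herm_inner H' H' / 2) * exp (- (sqrt (\<tau> / n2) * b)\<^sup>2 / 2)"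
      by (simp only: integral_mult_left_zero ch[OF H'] of_real_mult)
    also have "exp (- \<tau> * herm_inner H' H' / 2) * exp (- (sqrt (\<tau> / n2) * b)\<^sup>2 / 2) = exp (- \<tau> * herm_inner H H / 2)"
      unfolding nn exp_add[symmetric] using n2 \<tau> by (simp add: power_mult_distrib field_simps)
    finally show "(CLINT X|distr (\<mu> \<Otimes>\<^sub>M ?S) (mat_borel d) W. iexp (herm_inner H X)) = exp (- \<tau> * herm_inner H H / 2)" .
  qed simp
  then have eq: "distr (\<mu> \<Otimes>\<^sub>M ?S) (mat_borel d) W = \<mu>" using g by (rule hermitian_gaussian_unique)
  have "AE x in \<mu> \<Otimes>\<^sub>M ?S. q (W x) \<noteq> 0"
  proof (rule P.AE_pair_measure)
    have "(\<lambda>x. q (W x)) -` (- {0}) \<inter> space (\<mu> \<Otimes>\<^sub>M ?S) \<in> sets (\<mu> \<Otimes>\<^sub>M ?S)"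
      by (rule measurable_sets[OF measurable_compose[OF Wm q]]) auto
    then show "{x \<in> space (\<mu> \<Otimes>\<^sub>M ?S). q (W x) \<noteq> 0} \<in> sets (\<mu> \<Otimes>\<^sub>M ?S)"
      by (simp add: vimage_def Int_def conj_commute)
    show "AE X in \<mu>. AE y in ?S. q (W (X, y)) \<noteq> 0"
      using h
    proof eventually_elim
      fix X assume X: "X \<in> hermitian_mats d"
      \<comment> \<open>The normal variable enters as an injective affine reparametrisation of the
        line through \<open>X\<close> with direction \<open>X0\<close>, so finitely many zeros on
        that line are finitely many values of \<open>y\<close>, a Lebesgue null set.\<close>
      have "finite ((\<lambda>y. y * sqrt (\<tau> / n2) - herm_inner X0 X / n2) -` {r :: real. q (X + complex_of_real r \<cdot>\<^sub>m X0) = 0})"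
        using n2 \<tau> by (intro finite_vimageI[OF fin[OF X]]) (auto simp: inj_def)
      then have "finite {y. q (W (X, y)) = 0}" by (simp add: W_def \<alpha>_def vimage_def)
      then have "{y. q (W (X, y)) = 0} \<in> null_sets lborel" by (rule finite_imp_null_set_lborel)
      then have "AE y in lborel. q (W (X, y)) \<noteq> 0" using AE_not_in by fastforce
      then show "AE y in ?S. q (W (X, y)) \<noteq> 0"
        by (subst AE_density) auto
    qed
  qed
  moreover have "{X \<in> space (mat_borel d). q X \<noteq> 0} \<in> sets (mat_borel d)"
  proof -
    have "q -` (- {0}) \<inter> space (mat_borel d) \<in> sets (mat_borel d)"
      by (rule measurable_sets[OF q]) auto
    then show ?thesis by (simp add: vimage_def Int_def conj_commute)
  qed
  ultimately have "AE X in distr (\<mu> \<Otimes>\<^sub>M ?S) (mat_borel d) W. q X \<noteq> 0"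
    by (subst AE_distr_iff[OF Wm]) auto
  then show ?thesis unfolding eq .
qed

section \<open>Measurability of roots of polynomials\<close>

lemma measurable_mset_borelI:
  assumes "\<And>C k. C \<in> sets borel \<Longrightarrow> {x \<in> space N. size (filter_mset (\<lambda>z. z \<in> C) (f x)) = k} \<in> sets N"
  shows "f \<in> N \<rightarrow>\<^sub>M mset_borel"
  unfolding mset_borel_def
proof (rule measurable_measure_of)
  fix y assume "y \<in> {{m. size (filter_mset (\<lambda>z. z \<in> A) m) = k} | A k. A \<in> sets (borel :: complex measure)}"
  then obtain A k where "A \<in> sets borel" and y: "y = {m. size (filter_mset (\<lambda>z. z \<in> A) m) = k}" by auto
  moreover have "f -` y \<inter> space N = {x \<in> space N. size (filter_mset (\<lambda>z. z \<in> A) (f x)) = k}"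
    using y by auto
  ultimately show "f -` y \<inter> space N \<in> sets N"
    using assms[of A k] by simp
qed auto

lemma space_mset_borel [simp]: "space mset_borel = UNIV"
  by (simp add: mset_borel_def)

lemma size_filter_measurable:
  assumes "C \<in> sets (borel :: complex measure)"
  shows "(\<lambda>m. size (filter_mset (\<lambda>z. z \<in> C) m)) \<in> mset_borel \<rightarrow>\<^sub>M count_space UNIV"
proof (subst measurable_count_space_eq2_countable, intro conjI ballI)
  fix k
  have "{m. size (filter_mset (\<lambda>z. z \<in> C) m) = k} \<in> sets mset_borel"
    unfolding mset_borel_def using assms by (intro in_measure_of) auto
  then show "(\<lambda>m. size (filter_mset (\<lambda>z. z \<in> C) m)) -` {k} \<inter> space mset_borel \<in> sets mset_borel"
    by (simp add: vimage_def)
qed auto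

text \<open>If \<open>g\<close> takes finitely many values, the product is a finite product of
  powers whose exponents are counts of points in Borel sets, and these are measurable by the choice
  of \<open>mset_borel\<close>. The general case is a pointwise limit, since a finite product is
  continuous in its factors.\<close>

lemma prod_mset_measurable:
  fixes g :: "complex \<Rightarrow> complex"
  assumes g: "g \<in> borel_measurable borel"
  shows "(\<lambda>m. \<Prod>z\<in>#m. g z) \<in> borel_measurable mset_borel"
proof -
  obtain F where F: "\<And>i. simple_function borel (F i)" and lim: "\<And>x. (\<lambda>i. F i x) \<longlonglongrightarrow> g x"
    using borel_measurable_implies_sequence_metric[OF g, of 0] by auto
  have eq: "(\<Prod>z\<in>#m. F i z) = (\<Prod>v\<in>range (F i). v ^ size (filter_mset (\<lambda>z. z \<in> F i -` {v}) m))" for i m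
  proof (induction m)
    case (add z m)
    have fin: "finite (range (F i))" using simple_functionD(1)[OF F[of i]] by simp
    have "(\<Prod>v\<in>range (F i). v ^ size (filter_mset (\<lambda>z. z \<in> F i -` {v}) (add_mset z m)))
      = (\<Prod>v\<in>range (F i). (if v = F i z then v else 1) * v ^ size (filter_mset (\<lambda>z. z \<in> F i -` {v}) m))"
      by (intro prod.cong) auto
    also have "\<dots> = F i z * (\<Prod>v\<in>range (F i). v ^ size (filter_mset (\<lambda>z. z \<in> F i -` {v}) m))"
      using fin by (simp add: prod.distrib prod.delta)
    finally show ?case using add by simp
  qed simp
  have "(\<lambda>m. \<Prod>z\<in>#m. F i z) \<in> borel_measurable mset_borel" for i
    unfolding eq
  proof (rule borel_measurable_prod)
    fix v
    have "F i -` {v} \<in> sets borel"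
      using simple_functionD(2)[OF F[of i], of "{v}"] by simp
    from measurable_compose[OF size_filter_measurable[OF this], of "\<lambda>k. v ^ k" borel]
    show "(\<lambda>m. v ^ size (filter_mset (\<lambda>z. z \<in> F i -` {v}) m)) \<in> borel_measurable mset_borel" by simp
  qed
  moreover have "(\<lambda>i. \<Prod>z\<in>#m. F i z) \<longlonglongrightarrow> (\<Prod>z\<in>#m. g z)" for m
    by (induction m) (auto intro!: tendsto_mult lim)
  ultimately show ?thesis by (rule borel_measurable_LIMSEQ_metric)
qed

lemma size_filter_sum_singletons:
  fixes n :: nat
  shows "size (filter_mset (\<lambda>z. z \<in> C) (\<Sum>i<n. {#r i#})) = card {i. i < n \<and> r i \<in> C}"
proof (induction n)
  case (Suc n)
  have "{i. i < Suc n \<and> r i \<in> C} = (if r n \<in> C then insert n {i. i < n \<and> r i \<in> C} else {i. i < n \<and> r i \<in> C})"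
    by (auto simp: less_Suc_eq)
  then show ?case using Suc by auto
qed simp

text \<open>The natural numbers are infinite, so they determine a polynomial, and countable, so the
  values there form one point of a countable product. Polynomials are handled in this form wherever
  topology or measurability is involved.\<close>

lemma poly_eqI_of_nat:
  fixes P Q :: "complex poly"
  assumes "\<And>m::nat. poly P (of_nat m) = poly Q (of_nat m)"
  shows "P = Q"
proof (rule ccontr)
  assume "P \<noteq> Q"
  then have "finite {x. poly (P - Q) x = 0}" by (intro poly_roots_finite) simp
  moreover have "range (of_nat :: nat \<Rightarrow> complex) \<subseteq> {x. poly (P - Q) x = 0}" using assms by auto
  ultimately have "finite (range (of_nat :: nat \<Rightarrow> complex))" by (rule finite_subset[rotated])
  then show False using range_inj_infinite[of "of_nat :: nat \<Rightarrow> complex"] by (simp add: inj_def)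
qed

text \<open>Having at least \<open>k\<close> of the first \<open>n\<close> coordinates in
  \<open>C\<close> is a finite union, over the possible index sets, of closed conditions; the
  remaining constraint is a product of compact sets. Tuples are sequences with coordinates pinned to
  0 from \<open>n\<close> on, so that the function type supplies the product topology.\<close>

lemma compact_bounded_tuples:
  assumes "closed (C :: complex set)"
  shows "compact {z :: nat \<Rightarrow> complex. (\<forall>i. z i \<in> (if i < n then cball 0 R else {0})) \<and> k \<le> card {i. i < n \<and> z i \<in> C}}"
proof -
  have "compactin (product_topology (\<lambda>_::nat. euclidean) UNIV) (\<Pi>\<^sub>E i\<in>UNIV. (if i < n then cball 0 R else {0 :: complex}))"
    by (subst compactin_PiE) (auto simp: compactin_euclidean_iff)
  then have K: "compact (\<Pi>\<^sub>E i\<in>UNIV. (if i < n then cball 0 R else {0 :: complex}))"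
    by (simp add: euclidean_product_topology compactin_euclidean_iff)
  have "{z :: nat \<Rightarrow> complex. k \<le> card {i. i < n \<and> z i \<in> C}} = (\<Union>J\<in>{J. J \<subseteq> {..<n} \<and> k \<le> card J}. \<Inter>i\<in>J. (\<lambda>z. z i) -` C)"
  proof (intro Set.set_eqI iffI)
    fix z :: "nat \<Rightarrow> complex"
    assume "z \<in> {z. k \<le> card {i. i < n \<and> z i \<in> C}}"
    then show "z \<in> (\<Union>J\<in>{J. J \<subseteq> {..<n} \<and> k \<le> card J}. \<Inter>i\<in>J. (\<lambda>z. z i) -` C)"
      by (intro UN_I[where a="{i. i < n \<and> z i \<in> C}"]) auto
  next
    fix z :: "nat \<Rightarrow> complex"
    assume "z \<in> (\<Union>J\<in>{J. J \<subseteq> {..<n} \<and> k \<le> card J}. \<Inter>i\<in>J. (\<lambda>z. z i) -` C)"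
    then obtain J where "J \<subseteq> {..<n}" "k \<le> card J" "\<forall>i\<in>J. z i \<in> C" by auto
    moreover from this have "card J \<le> card {i. i < n \<and> z i \<in> C}" by (intro card_mono) auto
    ultimately show "z \<in> {z. k \<le> card {i. i < n \<and> z i \<in> C}}" by simp
  qed
  moreover have "closed (\<Union>J\<in>{J. J \<subseteq> {..<n} \<and> k \<le> card J}. \<Inter>i\<in>J. (\<lambda>z::nat \<Rightarrow> complex. z i) -` C)"
    using assms by (intro closed_UN closed_INT ballI closed_vimage continuous_on_product_coordinates)
      (auto intro: finite_subset[OF _ finite_Pow_iff[THEN iffD2, OF finite_lessThan[of n]]])
  ultimately have "compact ((\<Pi>\<^sub>E i\<in>UNIV. (if i < n then cball 0 R else {0 :: complex})) \<inter> {z. k \<le> card {i. i < n \<and> z i \<in> C}})"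
    using K by (intro compact_Int_closed) auto
  then show ?thesis by (simp add: PiE_def Pi_def Int_def)
qed

text \<open>No choice of the roots is made. Having at least \<open>k\<close> roots in a closed set
  means that the vector of values at the natural numbers lies in a continuous image of root tuples:
  these values determine the polynomial, hence its multiset of roots, whichever tuple produced them.
  Closed sets are stable under intersection and generate the Borel sets, so a Dynkin argument
  extends the counts.\<close>

lemma proots_measurable:
  fixes P :: "'a \<Rightarrow> complex poly"
  assumes mon: "\<And>x. x \<in> space N \<Longrightarrow> lead_coeff (P x) = 1" and deg: "\<And>x. x \<in> space N \<Longrightarrow> degree (P x) = n"
    and ev: "\<And>m::nat. (\<lambda>x. poly (P x) (of_nat m)) \<in> borel_measurable N"
  shows "(\<lambda>x. proots (P x)) \<in> N \<rightarrow>\<^sub>M mset_borel"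
proof -
  define V :: "(nat \<Rightarrow> complex) \<Rightarrow> nat \<Rightarrow> complex" where "V z m = (\<Prod>i<n. (of_nat m - z i))" for z m
  have contV: "continuous_on S V" for S
    unfolding V_def
    by (intro continuous_on_coordinatewise_then_product continuous_intros
        continuous_on_subset[OF continuous_on_product_coordinates]) auto
  have VP: "poly (\<Prod>i<n. [:- z i, 1:]) (of_nat m) = V z m" for z m
    by (simp add: V_def poly_prod)
  have pr: "proots (\<Prod>i<n. [:- z i, 1:]) = (\<Sum>i<n. {#z i#})" for z :: "nat \<Rightarrow> complex"
    by (subst proots_prod) auto
  let ?N = "\<lambda>C x. size (filter_mset (\<lambda>z. z \<in> C) (proots (P x)))"
  have meas: "(\<lambda>x m. poly (P x) (of_nat m)) \<in> N \<rightarrow>\<^sub>M (borel :: (nat \<Rightarrow> complex) measure)"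
    by (intro measurable_coordinatewise_then_product ev)
  have closed_ge: "{x \<in> space N. k \<le> ?N C x} \<in> sets N" if C: "closed C" for C k
  proof -
    \<comment> \<open>Bounding the roots by \<open>R\<close> makes the set of tuples compact; the
      union of the images over all \<open>R\<close> is then a countable union of compact sets, hence
      Borel.\<close>
    define E where "E R = {z :: nat \<Rightarrow> complex. (\<forall>i. z i \<in> (if i < n then cball 0 (real R) else {0})) \<and> k \<le> card {i. i < n \<and> z i \<in> C}}" for R :: nat
    have "compact (V ` E R)" for R
      unfolding E_def by (intro compact_continuous_image contV compact_bounded_tuples C)
    then have T: "(\<Union>R. V ` E R) \<in> sets borel"
      by (intro sets.countable_UN) (auto intro: borel_compact)
    have "{x \<in> space N. k \<le> ?N C x} = (\<lambda>x m. poly (P x) (of_nat m)) -` (\<Union>R. V ` E R) \<inter> space N"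
    proof (intro Set.set_eqI iffI)
      fix x assume x: "x \<in> {x \<in> space N. k \<le> ?N C x}"
      obtain root where "Polynomial.smult (lead_coeff (P x)) (\<Prod>i<degree (P x). [:-root i, 1:]) = P x"
        by (rule complex_poly_decompose')
      then have Px: "P x = (\<Prod>i<n. [:-root i, 1:])" using x mon deg by simp
      define z where "z i = (if i < n then root i else 0)" for i
      have Pz: "P x = (\<Prod>i<n. [:-z i, 1:])" unfolding Px z_def by (intro prod.cong) auto
      obtain R :: nat where R: "(\<Sum>i<n. norm (z i)) \<le> real R" using real_arch_simple by blast
      have "norm (z i) \<le> real R" if "i < n" for i
        using R member_le_sum[of i "{..<n}" "\<lambda>i. norm (z i)"] that by simp
      moreover have "k \<le> card {i. i < n \<and> z i \<in> C}"
        using x by (simp add: Pz pr size_filter_sum_singletons)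
      ultimately have "z \<in> E R" by (auto simp: E_def z_def)
      moreover have "(\<lambda>m. poly (P x) (of_nat m)) = V z" by (simp add: Pz VP)
      ultimately show "x \<in> (\<lambda>x m. poly (P x) (of_nat m)) -` (\<Union>R. V ` E R) \<inter> space N"
        using x by auto
    next
      fix x assume "x \<in> (\<lambda>x m. poly (P x) (of_nat m)) -` (\<Union>R. V ` E R) \<inter> space N"
      then obtain R z where x: "x \<in> space N" and z: "z \<in> E R" "(\<lambda>m. poly (P x) (of_nat m)) = V z" by auto
      have "P x = (\<Prod>i<n. [:-z i, 1:])"
        using fun_cong[OF z(2)] by (intro poly_eqI_of_nat) (simp add: VP)
      then show "x \<in> {x \<in> space N. k \<le> ?N C x}"
        using x z(1) by (simp add: pr size_filter_sum_singletons E_def)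
    qed
    then show ?thesis using measurable_sets[OF meas T] by simp
  qed
  \<comment> \<open>Counting in \<open>ennreal\<close> turns a countable disjoint union into a
    series of measurable functions.\<close>
  have gen: "(\<lambda>x. of_nat (?N C x) :: ennreal) \<in> borel_measurable N" if "C \<in> sets borel" for C
  proof -
    have "C \<in> sigma_sets UNIV (Collect closed)"
      using that by (simp add: borel_eq_closed)
    have IS: "Int_stable (Collect closed :: complex set set)" by (auto simp: Int_stable_def)
    have Pw: "Collect closed \<subseteq> Pow (UNIV :: complex set)" by simp
    show ?thesis
      using IS Pw \<open>C \<in> sigma_sets UNIV (Collect closed)\<close>
    proof (induction rule: sigma_sets_induct_disjoint)
      case (basic C)
      have "?N C \<in> N \<rightarrow>\<^sub>M count_space UNIV"
      proof (subst measurable_count_space_eq2_countable, intro conjI ballI)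
        fix k
        have "?N C -` {k} \<inter> space N = {x \<in> space N. k \<le> ?N C x} - {x \<in> space N. Suc k \<le> ?N C x}"
          by auto
        then show "?N C -` {k} \<inter> space N \<in> sets N" using closed_ge basic by auto
      qed auto
      then show ?case by (rule measurable_compose) simp
    next
      case empty then show ?case by simp
    next
      case (compl C)
      have "(of_nat (?N (UNIV - C) x) :: ennreal) = of_nat n - of_nat (?N C x)" if "x \<in> space N" for x
      proof -
        have "filter_mset (\<lambda>z. z \<in> C) (proots (P x)) + filter_mset (\<lambda>z. z \<in> UNIV - C) (proots (P x)) = proots (P x)"
          using multiset_partition[of "proots (P x)" "\<lambda>z. z \<in> C"] by simp
        from arg_cong[OF this, of size] have "?N C x + ?N (UNIV - C) x = n"
          using deg[OF that] by (simp only: size_union size_proots_complex)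
        then have "(of_nat n :: ennreal) = of_nat (?N C x) + of_nat (?N (UNIV - C) x)"
          by (simp only: flip: of_nat_add)
        then show ?thesis by (simp add: ennreal_add_diff_cancel_left)
      qed
      then show ?case using compl by (subst measurable_cong[where g="\<lambda>x. of_nat n - of_nat (?N C x)"]) auto
    next
      case (union A)
      have "(of_nat (size (filter_mset (\<lambda>z. z \<in> (\<Union>i. A i)) m)) :: ennreal) = (\<Sum>i. of_nat (size (filter_mset (\<lambda>z. z \<in> A i) m)))" for m
      proof (induction m)
        case (add z m)
        have a: "(of_nat (size (filter_mset (\<lambda>z. z \<in> D) (add_mset z m))) :: ennreal) = indicator D z + of_nat (size (filter_mset (\<lambda>z. z \<in> D) m))" for D :: "complex set"
          by (auto simp: indicator_def)
        show ?case unfolding a add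
          by (subst suminf_add[symmetric]) (auto simp: suminf_indicator[OF union(1)])
      qed simp
      then show ?case using union by simp
    qed
  qed
  show ?thesis
  proof (rule measurable_mset_borelI)
    fix C :: "complex set" and k assume C: "C \<in> sets borel"
    have "{x \<in> space N. ?N C x = k} = {x \<in> space N. (of_nat (?N C x) :: ennreal) = of_nat k}" by simp
    also have "\<dots> = (\<lambda>x. of_nat (?N C x) :: ennreal) -` {of_nat k} \<inter> space N" by auto
    also have "\<dots> \<in> sets N" by (rule measurable_sets[OF gen[OF C]]) simp
    finally show "{x \<in> space N. ?N C x = k} \<in> sets N" .
  qed
qed

section \<open>Bordered determinants and moments\<close>

text \<open>The Schur complement formula with denominators cleared by means of the adjugate. It
  holds over any integral domain, in particular for the polynomial matrix x - A, which has no
  inverse over the polynomials.\<close>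

lemma det_four_block_mat_adj:
  fixes A :: "'a :: idom mat"
  assumes A: "A \<in> carrier_mat n n" and u: "u \<in> carrier_mat n m" and v: "v \<in> carrier_mat m n"
    and C: "C \<in> carrier_mat m m" and nz: "det A \<noteq> 0"
  shows "det (four_block_mat A u v C) * det A ^ m = det A * det (det A \<cdot>\<^sub>m C - v * (adj_mat A * u))"
proof -
  note adj = adj_mat[OF A]
  let ?F = "four_block_mat A u v C"
  \<comment> \<open>Right multiplication by \<open>?G\<close> clears the upper right block. The
    product is lower block triangular, with \<open>det A\<close> times the identity and the Schur
    complement \<open>?S\<close> on the diagonal.\<close>
  let ?G = "four_block_mat (adj_mat A) (- (adj_mat A * u)) (0\<^sub>m m n) (det A \<cdot>\<^sub>m 1\<^sub>m m)"
  let ?S = "det A \<cdot>\<^sub>m C - v * (adj_mat A * u)"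
  have au: "adj_mat A * u \<in> carrier_mat n m" using adj u by auto
  have tl: "A * adj_mat A + u * 0\<^sub>m m n = det A \<cdot>\<^sub>m 1\<^sub>m n"
    using adj A u by simp
  have bl: "v * adj_mat A + C * 0\<^sub>m m n = v * adj_mat A"
    using adj v C by (simp add: right_add_zero_mat[of _ m n])
  have Au: "A * (adj_mat A * u) = det A \<cdot>\<^sub>m u"
  proof -
    have "A * (adj_mat A * u) = (A * adj_mat A) * u" by (rule assoc_mult_mat[OF A adj(1) u, symmetric])
    also have "\<dots> = det A \<cdot>\<^sub>m u" using adj(2) u by (simp add: mult_smult_assoc_mat[of _ n n _ m])
    finally show ?thesis .
  qed
  have tr: "A * (- (adj_mat A * u)) + u * (det A \<cdot>\<^sub>m 1\<^sub>m m) = 0\<^sub>m n m"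
  proof (rule eq_matI)
    fix i j assume "i < dim_row (0\<^sub>m n m :: 'a mat)" "j < dim_col (0\<^sub>m n m :: 'a mat)"
    then have ij: "i < n" "j < m" by auto
    have "A * (- (adj_mat A * u)) = - (det A \<cdot>\<^sub>m u)"
      using A adj(1) u Au by (simp add: uminus_mult_right_mat)
    moreover have "u * (det A \<cdot>\<^sub>m 1\<^sub>m m) = det A \<cdot>\<^sub>m u"
      using u by (simp add: mult_smult_distrib[of _ n m _ m])
    ultimately show "(A * (- (adj_mat A * u)) + u * (det A \<cdot>\<^sub>m 1\<^sub>m m)) $$ (i, j) = 0\<^sub>m n m $$ (i, j)"
      using ij u by simp
  qed (use A u adj in auto)
  have br: "v * (- (adj_mat A * u)) + C * (det A \<cdot>\<^sub>m 1\<^sub>m m) = ?S"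
  proof (rule eq_matI)
    fix i j assume "i < dim_row ?S" "j < dim_col ?S"
    then have ij: "i < m" "j < m" using v u adj by auto
    have "v * (- (adj_mat A * u)) = - (v * (adj_mat A * u))"
      using v adj(1) u by (simp add: uminus_mult_right_mat)
    moreover have "C * (det A \<cdot>\<^sub>m 1\<^sub>m m) = det A \<cdot>\<^sub>m C"
      using C by (simp add: mult_smult_distrib[of _ m m _ m])
    ultimately show "(v * (- (adj_mat A * u)) + C * (det A \<cdot>\<^sub>m 1\<^sub>m m)) $$ (i, j) = ?S $$ (i, j)"
      using ij C v au adj(1) u by simp
  qed (use v u C adj in auto)
  have Sc: "?S \<in> carrier_mat m m" by (rule minus_carrier_mat[OF mult_carrier_mat[OF v au]])
  have "?F * ?G = four_block_mat (det A \<cdot>\<^sub>m 1\<^sub>m n) (0\<^sub>m n m) (v * adj_mat A) ?S"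
    using mult_four_block_mat[OF A u v C adj(1) uminus_carrier_mat[OF au] zero_carrier_mat smult_carrier_mat[OF one_carrier_mat, where k="det A"]]
    unfolding tl tr bl br .
  moreover have "det (?F * ?G) = det ?F * det ?G"
    using A C adj by (intro det_mult[of _ "n + m"]) auto
  moreover have "det ?G = det (adj_mat A) * det A ^ m"
    using adj(1) au by (subst det_four_block_mat_lower_left_zero[of _ n _ m]) (simp_all del: assoc_mult_mat)
  moreover have "det (four_block_mat (det A \<cdot>\<^sub>m 1\<^sub>m n) (0\<^sub>m n m) (v * adj_mat A) ?S) = det A ^ n * det ?S"
    using v adj(1) Sc by (subst det_four_block_mat_upper_right_zero[of _ n _ m]) (simp_all del: assoc_mult_mat)
  ultimately have 1: "det ?F * (det (adj_mat A) * det A ^ m) = det A ^ n * det ?S" by simp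
  \<comment> \<open>This trades \<open>det (adj_mat A)\<close>, which is not known to be nonzero at
    this point, for powers of \<open>det A\<close>, which \<open>nz\<close> allows to
    cancel.\<close>
  have 2: "det A * det (adj_mat A) = det A ^ n"
    using det_mult[OF A adj(1)] adj(2) by simp
  have "det A ^ n * (det ?F * det A ^ m) = det A * (det ?F * (det (adj_mat A) * det A ^ m))"
    unfolding 2[symmetric] by (simp add: algebra_simps)
  also have "\<dots> = det A ^ n * (det A * det ?S)" unfolding 1 by (simp add: algebra_simps)
  finally show ?thesis using nz by simp
qed

lemma char_poly_nonzero: "A \<in> carrier_mat n n \<Longrightarrow> char_poly (A :: 'a :: idom mat) \<noteq> 0"
  using degree_monic_char_poly[of A n] by auto

lemma char_poly_matrix_dim [simp]:
  "dim_row (char_poly_matrix A) = dim_row A" "dim_col (char_poly_matrix A) = dim_col A"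
  by (simp_all add: char_poly_matrix_def)

lemma char_poly_matrix_index:
  "A \<in> carrier_mat n n \<Longrightarrow> i < n \<Longrightarrow> j < n \<Longrightarrow>
    char_poly_matrix A $$ (i, j) = (if i = j then [:- A $$ (i, j), 1:] else [:- A $$ (i, j):])"
  by (auto simp: char_poly_matrix_def)

lemma char_poly_matrix_four_block:
  assumes "A \<in> carrier_mat n n" "u \<in> carrier_mat n m" "v \<in> carrier_mat m n" "C \<in> carrier_mat m m"
  shows "char_poly_matrix (four_block_mat A u v C) =
    four_block_mat (char_poly_matrix A) (map_mat (\<lambda>a. [:- a:]) u) (map_mat (\<lambda>a. [:- a:]) v) (char_poly_matrix C)"
proof (rule eq_matI)
  have d: "dim_row (char_poly_matrix A) = n" "dim_col (char_poly_matrix A) = n"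
    "dim_row (char_poly_matrix C) = m" "dim_col (char_poly_matrix C) = m"
    using char_poly_matrix_closed[OF assms(1)] char_poly_matrix_closed[OF assms(4)] by auto
  fix i j
  assume "i < dim_row (four_block_mat (char_poly_matrix A) (map_mat (\<lambda>a. [:- a:]) u) (map_mat (\<lambda>a. [:- a:]) v) (char_poly_matrix C))"
    "j < dim_col (four_block_mat (char_poly_matrix A) (map_mat (\<lambda>a. [:- a:]) u) (map_mat (\<lambda>a. [:- a:]) v) (char_poly_matrix C))"
  then have ij: "i < n + m" "j < n + m" using d by auto
  then show "char_poly_matrix (four_block_mat A u v C) $$ (i, j) =
    four_block_mat (char_poly_matrix A) (map_mat (\<lambda>a. [:- a:]) u) (map_mat (\<lambda>a. [:- a:]) v) (char_poly_matrix C) $$ (i, j)"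
    using assms d
    by (subst char_poly_matrix_index[OF four_block_carrier_mat[OF assms(1,4)]])
      (auto simp: char_poly_matrix_index[OF assms(1)] char_poly_matrix_index[OF assms(4)])
qed (use assms in auto)

text \<open>The polynomial v adj(x - A) u, that is, the resolvent entry of \<open>A\<close> between
  \<open>v\<close> and \<open>u\<close> times the characteristic polynomial.\<close>

definition adj_form :: "nat \<Rightarrow> complex mat \<Rightarrow> (nat \<Rightarrow> complex) \<Rightarrow> (nat \<Rightarrow> complex) \<Rightarrow> complex poly" where
  "adj_form n A v u = (\<Sum>r<n. \<Sum>s<n. [:v r:] * adj_mat (char_poly_matrix A) $$ (r, s) * [:u s:])"

lemma adj_carrier: "A \<in> carrier_mat n n \<Longrightarrow> adj_mat (char_poly_matrix A) \<in> carrier_mat n n"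
  by (intro adj_mat char_poly_matrix_closed)

lemma adj_form_product:
  assumes A: "A \<in> carrier_mat n n" and u: "u \<in> carrier_mat n m" and v: "v \<in> carrier_mat m n"
    and ij: "i < m" "j < m"
  shows "(map_mat (\<lambda>a. [:- a:]) v * (adj_mat (char_poly_matrix A) * map_mat (\<lambda>a. [:- a:]) u)) $$ (i, j)
    = adj_form n A (\<lambda>r. v $$ (i, r)) (\<lambda>s. u $$ (s, j))"
proof -
  have "(map_mat (\<lambda>a. [:- a:]) v * (adj_mat (char_poly_matrix A) * map_mat (\<lambda>a. [:- a:]) u)) $$ (i, j)
    = (\<Sum>r<n. [:- v $$ (i, r):] * (\<Sum>s<n. adj_mat (char_poly_matrix A) $$ (r, s) * [:- u $$ (s, j):]))"
    using adj_carrier[OF A] u v ij by (simp add: scalar_prod_def atLeast0LessThan)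
  also have "\<dots> = adj_form n A (\<lambda>r. v $$ (i, r)) (\<lambda>s. u $$ (s, j))"
    unfolding adj_form_def sum_distrib_left
    by (intro sum.cong refl) simp
  finally show ?thesis .
qed

text \<open>The Schur complement with a border of width one is a scalar. The minus signs that the
  characteristic matrix puts on the border row and on the border column cancel in
  \<open>adj_form\<close>.\<close>

lemma char_poly_bordered:
  assumes A: "A \<in> carrier_mat n n" and u: "u \<in> carrier_mat n 1" and v: "v \<in> carrier_mat 1 n" and C: "C \<in> carrier_mat 1 1"
  shows "char_poly (four_block_mat A u v C) = [:- C $$ (0, 0), 1:] * char_poly A - adj_form n A (\<lambda>r. v $$ (0, r)) (\<lambda>s. u $$ (s, 0))"
proof -
  let ?M = "char_poly_matrix A" and ?u = "map_mat (\<lambda>a. [:- a:]) u" and ?v = "map_mat (\<lambda>a. [:- a:]) v"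
  let ?S = "det ?M \<cdot>\<^sub>m char_poly_matrix C - ?v * (adj_mat ?M * ?u)"
  have S: "?S \<in> carrier_mat 1 1" using adj_carrier[OF A] u v C by auto
  have "char_poly (four_block_mat A u v C) * char_poly A ^ 1 = char_poly A * det ?S"
    unfolding char_poly_def char_poly_matrix_four_block[OF A u v C]
    using A u v C char_poly_nonzero[OF A]
    by (intro det_four_block_mat_adj[of _ n]) (auto simp: char_poly_def)
  then have "char_poly (four_block_mat A u v C) = det ?S" using char_poly_nonzero[OF A] by simp
  also have "det ?S = ?S $$ (0, 0)" using S by (rule det_single)
  also have "\<dots> = char_poly A * [:- C $$ (0, 0), 1:] - adj_form n A (\<lambda>r. v $$ (0, r)) (\<lambda>s. u $$ (s, 0))"
    using adj_form_product[OF A u v, of 0 0] adj_carrier[OF A] u v C char_poly_matrix_closed[OF C]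
    by (simp add: char_poly_def char_poly_matrix_index[OF C])
  finally show ?thesis by (simp only: mult.commute)
qed

lemma det_2x2:
  assumes S: "S \<in> carrier_mat 2 2"
  shows "det (S :: 'a :: idom mat) = S $$ (0, 0) * S $$ (1, 1) - S $$ (0, 1) * S $$ (1, 0)"
proof -
  let ?e = "\<lambda>i j. mat 1 1 (\<lambda>_. S $$ (i, j))"
  have e: "?e i j \<in> carrier_mat 1 1" for i j by auto
  have SF: "S = four_block_mat (?e 0 0) (?e 0 1) (?e 1 0) (?e 1 1)"
    using S by (intro eq_matI) (auto simp: less_Suc_eq numeral_2_eq_2)
  have "det S = det (four_block_mat (?e 0 0) (?e 0 1) (?e 1 0) (?e 1 1))" by (rule arg_cong[OF SF])
  also have "\<dots> = det (?e 0 0 * ?e 1 1 - ?e 0 1 * ?e 1 0)"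
    by (rule det_four_block_mat[OF e e e e]) (auto intro!: eq_matI simp: scalar_prod_def)
  also have "\<dots> = (?e 0 0 * ?e 1 1 - ?e 0 1 * ?e 1 0) $$ (0, 0)"
    by (rule det_single[OF minus_carrier_mat[OF mult_carrier_mat[OF e e]]])
  also have "\<dots> = S $$ (0, 0) * S $$ (1, 1) - S $$ (0, 1) * S $$ (1, 0)"
    by (simp add: scalar_prod_def)
  finally show ?thesis .
qed

text \<open>By the zero pattern only one of the four forms in the two-by-two Schur complement
  survives, the one in position (1, 0). Its cofactor is the entry (0, 1), which comes from
  \<open>C\<close>; this is why the form appears multiplied by \<open>C $$ (0, 1)\<close>.\<close>

lemma char_poly_cyclic:
  assumes A: "A \<in> carrier_mat n n" and u: "u \<in> carrier_mat n 2" and v: "v \<in> carrier_mat 2 n" and C: "C \<in> carrier_mat 2 2"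
    and u1: "\<And>s. s < n \<Longrightarrow> u $$ (s, 1) = 0" and v0: "\<And>r. r < n \<Longrightarrow> v $$ (0, r) = 0"
    and C0: "C $$ (0, 0) = 0" "C $$ (1, 0) = 0" "C $$ (1, 1) = 0"
  shows "char_poly (four_block_mat A u v C)
    = [:0, 0, 1:] * char_poly A - [:C $$ (0, 1):] * adj_form n A (\<lambda>r. v $$ (1, r)) (\<lambda>s. u $$ (s, 0))"
proof -
  let ?M = "char_poly_matrix A" and ?u = "map_mat (\<lambda>a. [:- a:]) u" and ?v = "map_mat (\<lambda>a. [:- a:]) v"
  let ?S = "det ?M \<cdot>\<^sub>m char_poly_matrix C - ?v * (adj_mat ?M * ?u)"
  let ?q = "adj_form n A (\<lambda>r. v $$ (1, r)) (\<lambda>s. u $$ (s, 0))"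
  let ?\<chi> = "char_poly A"
  have S: "?S \<in> carrier_mat 2 2" using adj_carrier[OF A] u v C by auto
  have eq: "char_poly (four_block_mat A u v C) * ?\<chi> ^ 2 = ?\<chi> * det ?S"
    unfolding char_poly_def char_poly_matrix_four_block[OF A u v C]
    using A u v C char_poly_nonzero[OF A]
    by (intro det_four_block_mat_adj[of _ n]) (auto simp: char_poly_def)
  have Sij: "?S $$ (i, j) = ?\<chi> * char_poly_matrix C $$ (i, j) - adj_form n A (\<lambda>r. v $$ (i, r)) (\<lambda>s. u $$ (s, j))"
    if "i < 2" "j < 2" for i j
    using adj_form_product[OF A u v that] adj_carrier[OF A] u v C that char_poly_matrix_closed[OF C]
    by (simp add: char_poly_def)
  have z: "adj_form n A (\<lambda>r. v $$ (0, r)) w = 0" "adj_form n A w (\<lambda>s. u $$ (s, 1)) = 0" for w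
    using u1 v0 by (auto simp: adj_form_def intro!: sum.neutral)
  have "det ?S = (?\<chi> * [:0, 1:]) * (?\<chi> * [:0, 1:]) - (?\<chi> * [:- C $$ (0, 1):]) * (- ?q)"
    unfolding det_2x2[OF S] by (simp add: Sij z char_poly_matrix_index[OF C] C0 del: mult_pCons_right One_nat_def)
  also have "\<dots> = ?\<chi> * ([:0, 0, 1:] * ?\<chi> - [:C $$ (0, 1):] * ?q)"
  proof -
    have "[:0, 0, 1:] = [:0, 1:] * [:0, 1 :: complex:]" by simp
    moreover have "[:- C $$ (0, 1):] = - [:C $$ (0, 1):]" by simp
    ultimately show ?thesis by (simp only:) (simp only: algebra_simps minus_mult_minus)
  qed
  finally have dS: "det ?S = ?\<chi> * ([:0, 0, 1:] * ?\<chi> - [:C $$ (0, 1):] * ?q)" .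
  have "?\<chi> ^ 2 * char_poly (four_block_mat A u v C) = ?\<chi> ^ 2 * ([:0, 0, 1:] * ?\<chi> - [:C $$ (0, 1):] * ?q)"
    using eq unfolding dS mult.commute[of _ "?\<chi> ^ 2"] by (simp only: power2_eq_square mult.assoc)
  then show ?thesis using char_poly_nonzero[OF A] by (metis mult_left_cancel power_not_zero)
qed

text \<open>The entries of the adjugate are, up to sign, minors of size n - 1 of a matrix whose
  entries have degree at most one.\<close>

lemma degree_adj_form:
  assumes A: "A \<in> carrier_mat n n" and n: "0 < n"
  shows "degree (adj_form n A v u) < n"
proof -
  have "degree (adj_mat (char_poly_matrix A) $$ (r, s)) \<le> n - 1" if "r < n" "s < n" for r s
  proof -
    let ?M = "char_poly_matrix A"
    have M: "?M \<in> carrier_mat n n" using A by simp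
    have D: "mat_delete ?M s r \<in> carrier_mat (n - 1) (n - 1)" by (rule mat_delete_carrier[OF M])
    have "degree (det (mat_delete ?M s r)) \<le> 1 * (n - 1)"
    proof (rule degree_det_le[OF _ D])
      fix i j assume "i < n - 1" "j < n - 1"
      then show "degree (mat_delete ?M s r $$ (i, j)) \<le> 1"
        using M A by (auto simp: mat_delete_def char_poly_matrix_index[OF A])
    qed
    moreover have "adj_mat ?M $$ (r, s) = (-1) ^ (s + r) * det (mat_delete ?M s r)"
      using M A that by (auto simp: adj_mat_def cofactor_def)
    moreover have "degree ((-1) ^ k * P) = degree P" for k and P :: "complex poly"
      by (cases "even k") auto
    ultimately show ?thesis by simp
  qed
  then have "degree ([:v r:] * adj_mat (char_poly_matrix A) $$ (r, s) * [:u s:]) \<le> n - 1" if "r < n" "s < n" for r s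
    using that by (intro order_trans[OF degree_mult_le]) (auto intro!: order_trans[OF degree_mult_le])
  then have "degree (adj_form n A v u) \<le> n - 1"
    unfolding adj_form_def by (intro degree_sum_le) auto
  then show ?thesis using n by simp
qed

section \<open>Krylov vectors and moments\<close>

fun row_krylov :: "nat \<Rightarrow> complex mat \<Rightarrow> (nat \<Rightarrow> complex) \<Rightarrow> nat \<Rightarrow> nat \<Rightarrow> complex" where
  "row_krylov n A v 0 r = v r"
| "row_krylov n A v (Suc k) r = (\<Sum>t<n. row_krylov n A v k t * A $$ (t, r))"

fun col_krylov :: "nat \<Rightarrow> complex mat \<Rightarrow> (nat \<Rightarrow> complex) \<Rightarrow> nat \<Rightarrow> nat \<Rightarrow> complex" where
  "col_krylov n A u 0 r = u r"
| "col_krylov n A u (Suc k) r = (\<Sum>t<n. A $$ (r, t) * col_krylov n A u k t)"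

definition moment :: "nat \<Rightarrow> complex mat \<Rightarrow> (nat \<Rightarrow> complex) \<Rightarrow> (nat \<Rightarrow> complex) \<Rightarrow> nat \<Rightarrow> complex" where
  "moment n A v u k = (\<Sum>r<n. row_krylov n A v k r * u r)"

text \<open>A factor \<open>A\<close> can be moved from the column to the row, so the pairing
  depends on \<open>k + l\<close> only.\<close>

lemma row_col_krylov:
  "(\<Sum>r<n. row_krylov n A v k r * col_krylov n A u l r) = moment n A v u (k + l)"
proof (induction l arbitrary: k)
  case (Suc l)
  have "(\<Sum>r<n. row_krylov n A v k r * col_krylov n A u (Suc l) r)
    = (\<Sum>t<n. \<Sum>r<n. row_krylov n A v k r * A $$ (r, t) * col_krylov n A u l t)"
    by (subst sum.swap) (simp add: sum_distrib_left mult.assoc)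
  also have "\<dots> = (\<Sum>t<n. row_krylov n A v (Suc k) t * col_krylov n A u l t)"
    by (simp add: sum_distrib_right)
  also have "\<dots> = moment n A v u (Suc k + l)" by (rule Suc.IH)
  finally show ?case by simp
qed (simp add: moment_def)

text \<open>The identity (x - A) adj(x - A) = \<open>char_poly A\<close> times the identity matrix,
  taken between the row vector \<open>v A\<^sup>k\<close> and the column vector
  \<open>u\<close>.\<close>

lemma adj_form_recursion:
  assumes A: "A \<in> carrier_mat n n"
  shows "[:0, 1:] * adj_form n A (row_krylov n A v k) u - adj_form n A (row_krylov n A v (Suc k)) u
    = char_poly A * [:moment n A v u k:]"
proof -
  let ?M = "char_poly_matrix A" and ?J = "adj_mat (char_poly_matrix A)"
  let ?\<rho> = "row_krylov n A v k"
  have M: "?M \<in> carrier_mat n n" using A by simp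
  have J: "?J \<in> carrier_mat n n" using A by (rule adj_carrier)
  have MJ: "(\<Sum>t<n. ?M $$ (r, t) * ?J $$ (t, s)) = (if r = s then char_poly A else 0)" if "r < n" "s < n" for r s
  proof -
    have "(?M * ?J) $$ (r, s) = (det ?M \<cdot>\<^sub>m 1\<^sub>m n) $$ (r, s)" using adj_mat(2)[OF M] by simp
    then show ?thesis using that M J A by (simp add: scalar_prod_def atLeast0LessThan char_poly_def)
  qed
  have MJ': "(\<Sum>t<n. ?M $$ (r, t) * ?J $$ (t, s)) = [:0, 1:] * ?J $$ (r, s) - (\<Sum>t<n. [:A $$ (r, t):] * ?J $$ (t, s))" if "r < n" "s < n" for r s
  proof -
    have "(\<Sum>t<n. ?M $$ (r, t) * ?J $$ (t, s)) = (\<Sum>t<n. (if t = r then [:0, 1:] * ?J $$ (t, s) else 0) - [:A $$ (r, t):] * ?J $$ (t, s))"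
    proof (intro sum.cong refl)
      fix t assume "t \<in> {..<n}"
      have a: "[:- a, 1:] = [:0, 1:] - [:a:]" "[:- a:] = - [:a:]" for a :: complex by simp_all
      show "?M $$ (r, t) * ?J $$ (t, s) = (if t = r then [:0, 1:] * ?J $$ (t, s) else 0) - [:A $$ (r, t):] * ?J $$ (t, s)"
        using \<open>t \<in> {..<n}\<close> that by (auto simp only: char_poly_matrix_index[OF A] a left_diff_distrib lessThan_iff diff_0 mult_minus_left split: if_splits)
    qed
    then show ?thesis using that by (simp only: sum_subtractf sum.delta finite_lessThan lessThan_iff if_True)
  qed
  have "adj_form n A (row_krylov n A v (Suc k)) u = (\<Sum>r<n. \<Sum>s<n. [:?\<rho> r:] * (\<Sum>t<n. [:A $$ (r, t):] * ?J $$ (t, s)) * [:u s:])"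
  proof -
    have c: "[:row_krylov n A v (Suc k) t:] = (\<Sum>r<n. [:?\<rho> r:] * [:A $$ (r, t):])" for t
      by (simp add: poly_eq_iff coeff_sum coeff_pCons mult.commute split: nat.splits)
    have "adj_form n A (row_krylov n A v (Suc k)) u = (\<Sum>t<n. \<Sum>s<n. \<Sum>r<n. [:?\<rho> r:] * ([:A $$ (r, t):] * ?J $$ (t, s)) * [:u s:])"
      unfolding adj_form_def c by (simp only: sum_distrib_right mult.assoc)
    also have "\<dots> = (\<Sum>s<n. \<Sum>t<n. \<Sum>r<n. [:?\<rho> r:] * ([:A $$ (r, t):] * ?J $$ (t, s)) * [:u s:])" by (rule sum.swap)
    also have "\<dots> = (\<Sum>s<n. \<Sum>r<n. \<Sum>t<n. [:?\<rho> r:] * ([:A $$ (r, t):] * ?J $$ (t, s)) * [:u s:])"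
      by (intro sum.cong refl sum.swap)
    also have "\<dots> = (\<Sum>r<n. \<Sum>s<n. \<Sum>t<n. [:?\<rho> r:] * ([:A $$ (r, t):] * ?J $$ (t, s)) * [:u s:])" by (rule sum.swap)
    finally show ?thesis by (simp only: sum_distrib_left sum_distrib_right)
  qed
  moreover have "[:0, 1:] * adj_form n A ?\<rho> u = (\<Sum>r<n. \<Sum>s<n. [:?\<rho> r:] * ([:0, 1:] * ?J $$ (r, s)) * [:u s:])"
    unfolding adj_form_def sum_distrib_left by (intro sum.cong refl) (simp only: mult.commute mult.left_commute)
  ultimately have "[:0, 1:] * adj_form n A ?\<rho> u - adj_form n A (row_krylov n A v (Suc k)) u
    = (\<Sum>r<n. \<Sum>s<n. [:?\<rho> r:] * ([:0, 1:] * ?J $$ (r, s) - (\<Sum>t<n. [:A $$ (r, t):] * ?J $$ (t, s))) * [:u s:])"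
    by (simp only: sum_subtractf right_diff_distrib left_diff_distrib)
  also have "\<dots> = (\<Sum>r<n. \<Sum>s<n. [:?\<rho> r:] * (if r = s then char_poly A else 0) * [:u s:])"
    by (intro sum.cong refl) (simp only: lessThan_iff MJ'[symmetric] MJ)
  also have "\<dots> = (\<Sum>r<n. [:?\<rho> r:] * char_poly A * [:u r:])"
  proof (intro sum.cong refl)
    fix r assume r: "r \<in> {..<n}"
    have "(\<Sum>s<n. [:?\<rho> r:] * (if r = s then char_poly A else 0) * [:u s:]) = (\<Sum>s<n. if r = s then [:?\<rho> r:] * char_poly A * [:u s:] else 0)"
      by (intro sum.cong refl) simp
    then show "(\<Sum>s<n. [:?\<rho> r:] * (if r = s then char_poly A else 0) * [:u s:]) = [:?\<rho> r:] * char_poly A * [:u r:]"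
      using r by (simp only: sum.delta' finite_lessThan if_True)
  qed
  also have "\<dots> = char_poly A * (\<Sum>r<n. [:?\<rho> r * u r:])"
    unfolding sum_distrib_left by (intro sum.cong refl) (simp add: mult.commute)
  also have "(\<Sum>r<n. [:?\<rho> r * u r:]) = [:moment n A v u k:]"
    by (simp add: moment_def poly_eq_iff coeff_sum coeff_pCons split: nat.splits)
  finally show ?thesis .
qed

text \<open>Division by the characteristic polynomial recovers the moments \<open>v A\<^sup>k u\<close> from \<open>adj_form\<close> one
  after the other, since \<open>adj_form\<close> has smaller degree.\<close>

lemma moment_eqI:
  assumes A: "A \<in> carrier_mat n n" "A' \<in> carrier_mat n n" and n: "0 < n"
    and \<chi>: "char_poly A = char_poly A'"
    and q: "adj_form n A v u = adj_form n A' v' u'"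
  shows "moment n A v u k = moment n A' v' u' k"
proof -
  have diff_diff_cancel: "(a - b) - (a - c) = c - b" for a b c :: "complex poly" by simp
  have key: "moment n A v u k = moment n A' v' u' k \<and>
      adj_form n A (row_krylov n A v (Suc k)) u = adj_form n A' (row_krylov n A' v' (Suc k)) u'"
    if "adj_form n A (row_krylov n A v k) u = adj_form n A' (row_krylov n A' v' k) u'" for k
  proof -
    let ?q = "adj_form n A (row_krylov n A v (Suc k)) u"
    let ?q' = "adj_form n A' (row_krylov n A' v' (Suc k)) u'"
    have eq: "?q' - ?q = char_poly A * [:moment n A v u k - moment n A' v' u' k:]"
    proof -
      have "[:moment n A v u k - moment n A' v' u' k:] = [:moment n A v u k:] - [:moment n A' v' u' k:]" by simp
      then have "char_poly A * [:moment n A v u k - moment n A' v' u' k:]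
        = char_poly A * [:moment n A v u k:] - char_poly A' * [:moment n A' v' u' k:]"
        by (simp only: \<chi> right_diff_distrib)
      also have "\<dots> = ?q' - ?q"
        unfolding adj_form_recursion[OF A(1), symmetric] adj_form_recursion[OF A(2), symmetric] that
        by (rule diff_diff_cancel)
      finally show ?thesis by (rule sym)
    qed
    have "degree (?q' - ?q) < n"
      using degree_adj_form[OF A(1) n] degree_adj_form[OF A(2) n] by (intro degree_diff_less) auto
    moreover have "degree (char_poly A) = n" using degree_monic_char_poly[OF A(1)] by simp
    ultimately have "[:moment n A v u k - moment n A' v' u' k:] = 0"
      using eq degree_mult_eq[of "char_poly A" "[:moment n A v u k - moment n A' v' u' k:]"] char_poly_nonzero[OF A(1)]
      by (metis not_add_less1)
    then show ?thesis using eq by simp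
  qed
  have "adj_form n A (row_krylov n A v k) u = adj_form n A' (row_krylov n A' v' k) u'" for k
  proof (induction k)
    case 0
    have "row_krylov n B w 0 = w" for B w by (rule ext) simp
    then show ?case using q by simp
  qed (use key in blast)
  then show ?thesis using key by blast
qed

section \<open>Separation of orbits\<close>

text \<open>\<open>U\<close> is the matrix taking \<open>K\<close> to \<open>K'\<close>. Equality of
  the products \<open>L K\<close> shows that it also takes \<open>L'\<close> back to
  \<open>L\<close>, and equality of the products \<open>L A K\<close> that it intertwines
  \<open>A\<close> with \<open>A'\<close>, after cancelling \<open>L'\<close> and \<open>K'\<close>.
  The last two conclusions serve to recognise \<open>W\<close> as the adjoint of \<open>U\<close>
  and to compare column vectors through \<open>L'\<close>.\<close>

lemma krylov_intertwiner:
  fixes K K' L L' A A' :: "complex mat"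
  assumes c: "K \<in> carrier_mat n n" "K' \<in> carrier_mat n n" "L \<in> carrier_mat n n" "L' \<in> carrier_mat n n"
    "A \<in> carrier_mat n n" "A' \<in> carrier_mat n n"
    and nz: "det K \<noteq> 0" "det K' \<noteq> 0" "det L \<noteq> 0" "det L' \<noteq> 0"
    and LK: "L * K = L' * K'" and LAK: "L * A * K = L' * A' * K'"
  obtains U W where "U \<in> carrier_mat n n" "W \<in> carrier_mat n n" "U * W = 1\<^sub>m n" "L' * U = L" "U * A * W = A'"
    "\<And>Q. Q \<in> carrier_mat n n \<Longrightarrow> Q * K' = K \<Longrightarrow> Q = W"
    "\<And>x y. x \<in> carrier_mat n 1 \<Longrightarrow> y \<in> carrier_mat n 1 \<Longrightarrow> L' * x = L' * y \<Longrightarrow> x = y"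
proof -
  have inv: "\<exists>P\<in>carrier_mat n n. P * Q = 1\<^sub>m n \<and> Q * P = 1\<^sub>m n" if "Q \<in> carrier_mat n n" "det Q \<noteq> 0" for Q :: "complex mat"
    using det_non_zero_imp_unit[OF that, of "()"] unfolding Units_def by (auto simp: ring_mat_simps)
  obtain Ki where Ki: "Ki \<in> carrier_mat n n" "Ki * K = 1\<^sub>m n" "K * Ki = 1\<^sub>m n" using inv[OF c(1) nz(1)] by blast
  obtain Ki' where Ki': "Ki' \<in> carrier_mat n n" "Ki' * K' = 1\<^sub>m n" "K' * Ki' = 1\<^sub>m n" using inv[OF c(2) nz(2)] by blast
  obtain Li' where Li': "Li' \<in> carrier_mat n n" "Li' * L' = 1\<^sub>m n" "L' * Li' = 1\<^sub>m n" using inv[OF c(4) nz(4)] by blast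
  note as = assoc_mult_mat[of _ n n _ n _ n]
  define U where "U = K' * Ki"
  define W where "W = K * Ki'"
  have U: "U \<in> carrier_mat n n" and W: "W \<in> carrier_mat n n" using c Ki Ki' by (auto simp: U_def W_def)
  have UK: "U * K = K'"
    unfolding U_def using as[OF c(2) Ki(1) c(1)] Ki c by simp
  have WK: "W * K' = K"
    unfolding W_def using as[OF c(1) Ki'(1) c(2)] Ki' c by simp
  have UW: "U * W = 1\<^sub>m n"
    unfolding W_def using as[OF U c(1) Ki'(1)] UK Ki' by simp
  have LU: "L' * U = L"
  proof -
    have "L' * U = (L' * K') * Ki" unfolding U_def by (rule as[OF c(4,2) Ki(1), symmetric])
    also have "\<dots> = L * (K * Ki)" unfolding LK[symmetric] by (rule as[OF c(3,1) Ki(1)])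
    finally show ?thesis using c Ki by simp
  qed
  have "U * A * W = A'"
  proof -
    have UAW: "U * A * W \<in> carrier_mat n n" using U W c by auto
    have "(L' * (U * A * W)) * K' = (L' * U) * A * (W * K')"
    proof -
      have "L' * (U * A * W) * K' = L' * (U * A) * W * K'" using as[OF c(4) _ W, of "U * A"] U c by simp
      also have "\<dots> = (L' * U) * A * W * K'" using as[OF c(4) U c(5)] by simp
      also have "\<dots> = (L' * U) * A * (W * K')" using U W c by (intro as) auto
      finally show ?thesis .
    qed
    also have "\<dots> = L' * A' * K'" unfolding LU WK by (rule LAK)
    finally have eq: "(L' * (U * A * W)) * K' = L' * A' * K'" .
    have canc: "Li' * ((L' * Q) * K') * Ki' = Q" if Q: "Q \<in> carrier_mat n n" for Q
    proof -
      have "Li' * ((L' * Q) * K') * Ki' = Li' * (L' * Q) * K' * Ki'"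
        using as[OF Li'(1) _ c(2), of "L' * Q"] c Q by simp
      also have "\<dots> = (Li' * L') * Q * K' * Ki'" using as[OF Li'(1) c(4) Q] by simp
      also have "\<dots> = Q * (K' * Ki')" unfolding Li'(2) using as[OF Q c(2) Ki'(1)] Q by simp
      finally show ?thesis using Ki' Q by simp
    qed
    show ?thesis
      by (rule trans[OF canc[OF UAW, symmetric] trans[OF arg_cong[OF eq, of "\<lambda>z. Li' * z * Ki'"] canc[OF c(6)]]])
  qed
  moreover have "Q = W" if "Q \<in> carrier_mat n n" "Q * K' = K" for Q
  proof -
    have "Q = Q * (K' * Ki')" using that Ki' by simp
    also have "\<dots> = (Q * K') * Ki'" by (rule as[OF that(1) c(2) Ki'(1), symmetric])
    also have "\<dots> = W" unfolding that(2) W_def ..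
    finally show ?thesis .
  qed
  moreover have "x = y" if "x \<in> carrier_mat n 1" "y \<in> carrier_mat n 1" "L' * x = L' * y" for x y
  proof -
    have eq: "Li' * (L' * z) = z" if z: "z \<in> carrier_mat n 1" for z
    proof -
      have "Li' * (L' * z) = (Li' * L') * z" by (rule assoc_mult_mat[OF Li'(1) c(4) z, symmetric])
      then show ?thesis unfolding Li'(2) using z by simp
    qed
    show ?thesis by (rule trans[OF eq[OF that(1), symmetric] trans[OF arg_cong[OF that(3), of "(*) Li'"] eq[OF that(2)]]])
  qed
  ultimately show thesis using that[OF U W UW LU] by blast
qed

definition unitary_block :: "nat \<Rightarrow> nat \<Rightarrow> complex mat \<Rightarrow> bool" where
  "unitary_block n d V \<longleftrightarrow> V \<in> carrier_mat d d \<and> V * mat_adjoint V = 1\<^sub>m d \<and>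
     (\<forall>r<d. \<forall>c<d. r \<noteq> c \<longrightarrow> n \<le> r \<or> n \<le> c \<longrightarrow> V $$ (r, c) = 0)"

text \<open>A common shape for the leading block, the bordered matrices and the cyclic matrices:
  \<sigma> tells which row and column of \<open>X\<close> an index stands for, and the mask
  \<open>P\<close> tells which entries are kept. Invariance, measurability and continuity of the
  characteristic polynomials are then each proved once.\<close>

definition select_mat :: "nat \<Rightarrow> (nat \<Rightarrow> nat) \<Rightarrow> (nat \<Rightarrow> nat \<Rightarrow> bool) \<Rightarrow> complex mat \<Rightarrow> complex mat" where
  "select_mat m \<sigma> P X = mat m m (\<lambda>(a, c). if P a c then X $$ (\<sigma> a, \<sigma> c) else 0)"

lemma unitary_block_sum:
  fixes V :: "complex mat"
  assumes V: "\<And>r c. r < d \<Longrightarrow> c < d \<Longrightarrow> r \<noteq> c \<Longrightarrow> n \<le> r \<or> n \<le> c \<Longrightarrow> V $$ (r, c) = 0"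
    and nd: "n \<le> d" and r: "r < d"
  shows "(\<Sum>k<d. V $$ (r, k) * f k) = (if r < n then \<Sum>k<n. V $$ (r, k) * f k else V $$ (r, r) * f r)"
proof (cases "r < n")
  case True
  have "(\<Sum>k<d. V $$ (r, k) * f k) = (\<Sum>k<n. V $$ (r, k) * f k)"
    using V nd r True by (intro sum.mono_neutral_right) auto
  then show ?thesis using True by simp
next
  case False
  have "(\<Sum>k<d. V $$ (r, k) * f k) = (\<Sum>k\<in>{r}. V $$ (r, k) * f k)"
    using V nd r False by (intro sum.mono_neutral_right) auto
  then show ?thesis using False by simp
qed

lemma unitary_block_conj_index:
  assumes V: "V \<in> carrier_mat d d" and X: "X \<in> carrier_mat d d" and "r < d" "c < d"
  shows "(V * X * mat_adjoint V) $$ (r, c) = (\<Sum>k<d. V $$ (r, k) * (\<Sum>l<d. cnj (V $$ (c, l)) * X $$ (k, l)))"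
proof -
  have "(V * X * mat_adjoint V) $$ (r, c) = (\<Sum>l<d. (\<Sum>k<d. V $$ (r, k) * X $$ (k, l)) * cnj (V $$ (c, l)))"
    using assms mat_adjoint_carrier[OF V]
    by (simp add: scalar_prod_def atLeast0LessThan mat_adjoint_index[OF V] del: assoc_mult_mat)
  also have "\<dots> = (\<Sum>l<d. \<Sum>k<d. V $$ (r, k) * (cnj (V $$ (c, l)) * X $$ (k, l)))"
    unfolding sum_distrib_right by (intro sum.cong refl) (simp only: mult_ac)
  also have "\<dots> = (\<Sum>k<d. \<Sum>l<d. V $$ (r, k) * (cnj (V $$ (c, l)) * X $$ (k, l)))" by (rule sum.swap)
  finally show ?thesis by (simp add: sum_distrib_left)
qed

text \<open>The selected rows and columns form whole blocks of \<open>V\<close>, so the submatrix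
  \<open>T\<close> of \<open>V\<close> on them is again unitary. The mask is constant on pairs of
  blocks and thus commutes with the action, so conjugating \<open>X\<close> by \<open>V\<close>
  conjugates the selected matrix by \<open>T\<close>.\<close>

lemma char_poly_select_mat_conj:
  assumes V: "unitary_block n d V" and nd: "n \<le> d" and X: "X \<in> carrier_mat d d"
    and nm: "n \<le> m" and \<sigma>1: "\<And>a. a < n \<Longrightarrow> \<sigma> a = a" and \<sigma>2: "\<And>a. n \<le> a \<Longrightarrow> a < m \<Longrightarrow> n \<le> \<sigma> a \<and> \<sigma> a < d"
    and inj: "inj_on \<sigma> {..<m}"
    and P: "\<And>a c a' c'. a = a' \<or> a < n \<and> a' < n \<Longrightarrow> c = c' \<or> c < n \<and> c' < n \<Longrightarrow> P a c \<longleftrightarrow> P a' c'"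
  shows "char_poly (select_mat m \<sigma> P (V * X * mat_adjoint V)) = char_poly (select_mat m \<sigma> P X)"
proof -
  have Vc: "V \<in> carrier_mat d d" and VV: "V * mat_adjoint V = 1\<^sub>m d"
    and V0: "\<And>r c. r < d \<Longrightarrow> c < d \<Longrightarrow> r \<noteq> c \<Longrightarrow> n \<le> r \<or> n \<le> c \<Longrightarrow> V $$ (r, c) = 0"
    using V by (auto simp: unitary_block_def)
  have \<sigma>d: "\<sigma> a < d" if "a < m" for a using \<sigma>1[of a] \<sigma>2[of a] that nd by (cases "a < n") auto
  have \<sigma>lt: "\<sigma> a < n \<longleftrightarrow> a < n" if "a < m" for a using \<sigma>1[of a] \<sigma>2[of a] that by (cases "a < n") auto
  have eqV: "V $$ (\<sigma> a, \<sigma> k) = 0" if "a < m" "k < m" "\<not> (a = k \<or> a < n \<and> k < n)" for a k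
  proof (rule V0)
    show "\<sigma> a \<noteq> \<sigma> k" using inj_onD[OF inj, of a k] that by auto
    show "n \<le> \<sigma> a \<or> n \<le> \<sigma> k" using \<sigma>lt[of a] \<sigma>lt[of k] that by auto
  qed (use \<sigma>d that in auto)
  \<comment> \<open>A column index that is not selected is at least \<open>n\<close>, and there the
    row \<open>\<sigma> a\<close> of \<open>V\<close> vanishes, so a sum over selected indices
    extends to all \<open>d\<close> indices. The function \<open>g\<close> stands for the identity
    or for \<open>cnj\<close>.\<close>
  have reidx: "(\<Sum>k<m. g (V $$ (\<sigma> a, \<sigma> k)) * f (\<sigma> k)) = (\<Sum>k<d. g (V $$ (\<sigma> a, k)) * f k)"
    if a: "a < m" and g: "g 0 = 0" for a f and g :: "complex \<Rightarrow> complex"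
  proof -
    have "(\<Sum>k<m. g (V $$ (\<sigma> a, \<sigma> k)) * f (\<sigma> k)) = (\<Sum>k\<in>\<sigma> ` {..<m}. g (V $$ (\<sigma> a, k)) * f k)"
      by (subst sum.reindex[OF inj]) simp
    also have "\<dots> = (\<Sum>k<d. g (V $$ (\<sigma> a, k)) * f k)"
    proof (rule sum.mono_neutral_left)
      show "\<sigma> ` {..<m} \<subseteq> {..<d}" using \<sigma>d by auto
      show "\<forall>k\<in>{..<d} - \<sigma> ` {..<m}. g (V $$ (\<sigma> a, k)) * f k = 0"
      proof
        fix k assume k: "k \<in> {..<d} - \<sigma> ` {..<m}"
        have "n \<le> k" using k \<sigma>1[of k] nm by (cases "k < n") (force intro: rev_image_eqI[of k])+
        then have "V $$ (\<sigma> a, k) = 0" using k a \<sigma>d[OF a] by (intro V0) auto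
        then show "g (V $$ (\<sigma> a, k)) * f k = 0" using g by simp
      qed
    qed simp
    finally show ?thesis .
  qed
  define T where "T = mat m m (\<lambda>(a, c). V $$ (\<sigma> a, \<sigma> c))"
  have T: "T \<in> carrier_mat m m" by (simp add: T_def)
  note Ta = mat_adjoint_carrier[OF T]
  have TT: "T * mat_adjoint T = 1\<^sub>m m"
  proof (rule eq_matI)
    fix a c assume "a < dim_row (1\<^sub>m m :: complex mat)" "c < dim_col (1\<^sub>m m :: complex mat)"
    then have ac: "a < m" "c < m" by auto
    have "(T * mat_adjoint T) $$ (a, c) = (\<Sum>k<m. V $$ (\<sigma> a, \<sigma> k) * cnj (V $$ (\<sigma> c, \<sigma> k)))"
      using ac T Ta by (simp add: scalar_prod_def atLeast0LessThan mat_adjoint_index[OF T]) (simp add: T_def)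
    also have "\<dots> = (\<Sum>k<d. V $$ (\<sigma> a, k) * cnj (V $$ (\<sigma> c, k)))"
      using reidx[OF ac(1), of "\<lambda>z. z" "\<lambda>k. cnj (V $$ (\<sigma> c, k))"] by simp
    also have "\<dots> = (V * mat_adjoint V) $$ (\<sigma> a, \<sigma> c)"
      using \<sigma>d[OF ac(1)] \<sigma>d[OF ac(2)] Vc mat_adjoint_carrier[OF Vc]
      by (simp add: scalar_prod_def atLeast0LessThan mat_adjoint_index[OF Vc])
    also have "\<dots> = 1\<^sub>m m $$ (a, c)"
      using VV \<sigma>d[OF ac(1)] \<sigma>d[OF ac(2)] ac inj_onD[OF inj, of a c] by auto
    finally show "(T * mat_adjoint T) $$ (a, c) = 1\<^sub>m m $$ (a, c)" .
  qed (use T Ta in auto)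
  have TT': "mat_adjoint T * T = 1\<^sub>m m" by (rule mat_mult_left_right_inverse[OF T Ta TT])
  let ?Z = "select_mat m \<sigma> P X"
  have Z: "?Z \<in> carrier_mat m m" by (simp add: select_mat_def)
  have "select_mat m \<sigma> P (V * X * mat_adjoint V) = T * ?Z * mat_adjoint T"
  proof (rule eq_matI)
    fix a c assume "a < dim_row (T * ?Z * mat_adjoint T)" "c < dim_col (T * ?Z * mat_adjoint T)"
    then have ac: "a < m" "c < m" using T Ta by auto
    have "(T * ?Z * mat_adjoint T) $$ (a, c) = (\<Sum>k<m. V $$ (\<sigma> a, \<sigma> k) * (\<Sum>l<m. cnj (V $$ (\<sigma> c, \<sigma> l)) * (if P k l then X $$ (\<sigma> k, \<sigma> l) else 0)))"
      unfolding unitary_block_conj_index[OF T Z ac] using ac by (simp add: T_def select_mat_def)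
    also have "\<dots> = (\<Sum>k<m. \<Sum>l<m. V $$ (\<sigma> a, \<sigma> k) * (cnj (V $$ (\<sigma> c, \<sigma> l)) * (if P a c then X $$ (\<sigma> k, \<sigma> l) else 0)))"
      unfolding sum_distrib_left
    proof (intro sum.cong refl)
      fix k l assume kl: "k \<in> {..<m}" "l \<in> {..<m}"
      show "V $$ (\<sigma> a, \<sigma> k) * (cnj (V $$ (\<sigma> c, \<sigma> l)) * (if P k l then X $$ (\<sigma> k, \<sigma> l) else 0))
        = V $$ (\<sigma> a, \<sigma> k) * (cnj (V $$ (\<sigma> c, \<sigma> l)) * (if P a c then X $$ (\<sigma> k, \<sigma> l) else 0))"
        using eqV[of a k] eqV[of c l] kl ac P[of a k c l] by (cases "P a c = P k l") auto
    qed
    also have "\<dots> = (if P a c then \<Sum>k<m. V $$ (\<sigma> a, \<sigma> k) * (\<Sum>l<m. cnj (V $$ (\<sigma> c, \<sigma> l)) * X $$ (\<sigma> k, \<sigma> l)) else 0)"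
      by (simp add: sum_distrib_left)
    also have "(\<Sum>k<m. V $$ (\<sigma> a, \<sigma> k) * (\<Sum>l<m. cnj (V $$ (\<sigma> c, \<sigma> l)) * X $$ (\<sigma> k, \<sigma> l)))
      = (\<Sum>k<m. V $$ (\<sigma> a, \<sigma> k) * (\<Sum>l<d. cnj (V $$ (\<sigma> c, l)) * X $$ (\<sigma> k, l)))"
    proof (intro sum.cong refl)
      fix k
      show "V $$ (\<sigma> a, \<sigma> k) * (\<Sum>l<m. cnj (V $$ (\<sigma> c, \<sigma> l)) * X $$ (\<sigma> k, \<sigma> l))
        = V $$ (\<sigma> a, \<sigma> k) * (\<Sum>l<d. cnj (V $$ (\<sigma> c, l)) * X $$ (\<sigma> k, l))"
        using reidx[OF ac(2), of cnj "\<lambda>l. X $$ (\<sigma> k, l)"] by simp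
    qed
    also have "\<dots> = (V * X * mat_adjoint V) $$ (\<sigma> a, \<sigma> c)"
      unfolding unitary_block_conj_index[OF Vc X \<sigma>d[OF ac(1)] \<sigma>d[OF ac(2)]]
      using reidx[OF ac(1), of "\<lambda>z. z" "\<lambda>k. \<Sum>l<d. cnj (V $$ (\<sigma> c, l)) * X $$ (k, l)"] by simp
    finally show "select_mat m \<sigma> P (V * X * mat_adjoint V) $$ (a, c) = (T * ?Z * mat_adjoint T) $$ (a, c)"
      using ac by (simp add: select_mat_def)
  qed (use T Ta in \<open>auto simp: select_mat_def\<close>)
  then have "similar_mat_wit (select_mat m \<sigma> P (V * X * mat_adjoint V)) ?Z T (mat_adjoint T)"
    using T Ta TT TT' Z by (auto simp: similar_mat_wit_def Let_def select_mat_def)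
  then have "similar_mat (select_mat m \<sigma> P (V * X * mat_adjoint V)) ?Z" unfolding similar_mat_def by blast
  then show ?thesis by (rule char_poly_similar)
qed

section \<open>Leading, bordered and cyclic submatrices and their forms\<close>

abbreviation lead_mat :: "nat \<Rightarrow> complex mat \<Rightarrow> complex mat" where
  "lead_mat n X \<equiv> select_mat n (\<lambda>a. a) (\<lambda>_ _. True) X"

abbreviation border_select :: "nat \<Rightarrow> nat \<Rightarrow> complex mat \<Rightarrow> complex mat" where
  "border_select n i X \<equiv> select_mat (n + 1) (\<lambda>a. if a < n then a else i) (\<lambda>_ _. True) X"

abbreviation cyclic_select :: "nat \<Rightarrow> nat \<Rightarrow> nat \<Rightarrow> complex mat \<Rightarrow> complex mat" where
  "cyclic_select n i j X \<equiv> select_mat (n + 2) (\<lambda>a. if a < n then a else if a = n then i else j)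
     (\<lambda>a c. a < n \<and> c \<le> n \<or> a = n \<and> c = n + 1 \<or> a = n + 1 \<and> c < n) X"

abbreviation border_form :: "nat \<Rightarrow> complex mat \<Rightarrow> nat \<Rightarrow> nat \<Rightarrow> complex poly" where
  "border_form n X j i \<equiv> adj_form n (lead_mat n X) (\<lambda>r. X $$ (j, r)) (\<lambda>s. X $$ (s, i))"

lemma select_mat_carrier: "select_mat m \<sigma> P X \<in> carrier_mat m m"
  by (simp add: select_mat_def)

lemma adj_form_cong:
  assumes "\<And>r. r < n \<Longrightarrow> v r = v' r" "\<And>s. s < n \<Longrightarrow> u s = u' s"
  shows "adj_form n A v u = adj_form n A v' u'"
  unfolding adj_form_def using assms by (intro sum.cong refl) simp

lemma char_poly_border_select:
  "char_poly (border_select n i X) = [:- X $$ (i, i), 1:] * char_poly (lead_mat n X) - border_form n X i i"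
proof -
  let ?u = "mat n 1 (\<lambda>(r, c). X $$ (r, i))" and ?v = "mat 1 n (\<lambda>(r, c). X $$ (i, c))" and ?C = "mat 1 1 (\<lambda>_. X $$ (i, i))"
  have eq: "border_select n i X = four_block_mat (lead_mat n X) ?u ?v ?C"
    by (rule eq_matI) (auto simp: select_mat_def)
  have "char_poly (border_select n i X) = [:- ?C $$ (0, 0), 1:] * char_poly (lead_mat n X)
      - adj_form n (lead_mat n X) (\<lambda>r. ?v $$ (0, r)) (\<lambda>s. ?u $$ (s, 0))"
    unfolding eq by (rule char_poly_bordered[OF select_mat_carrier]) auto
  also have "adj_form n (lead_mat n X) (\<lambda>r. ?v $$ (0, r)) (\<lambda>s. ?u $$ (s, 0)) = border_form n X i i"
    by (rule adj_form_cong) auto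
  finally show ?thesis by simp
qed

lemma char_poly_cyclic_select:
  "char_poly (cyclic_select n i j X) = [:0, 0, 1:] * char_poly (lead_mat n X) - [:X $$ (i, j):] * border_form n X j i"
proof -
  let ?u = "mat n 2 (\<lambda>(r, c). if c = 0 then X $$ (r, i) else 0)"
  let ?v = "mat 2 n (\<lambda>(r, c). if r = 1 then X $$ (j, c) else 0)"
  let ?C = "mat 2 2 (\<lambda>(r, c). if r = 0 \<and> c = 1 then X $$ (i, j) else 0)"
  have eq: "cyclic_select n i j X = four_block_mat (lead_mat n X) ?u ?v ?C"
  proof (rule eq_matI)
    fix a c assume "a < dim_row (four_block_mat (lead_mat n X) ?u ?v ?C)" "c < dim_col (four_block_mat (lead_mat n X) ?u ?v ?C)"
    then have ac: "a < n + 2" "c < n + 2" by (auto simp: select_mat_def)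
    have "a < n \<or> a = n \<or> a = n + 1" "c < n \<or> c = n \<or> c = n + 1" using ac by linarith+
    then show "cyclic_select n i j X $$ (a, c) = four_block_mat (lead_mat n X) ?u ?v ?C $$ (a, c)"
      by (elim disjE) (simp_all add: select_mat_def)
  qed (auto simp: select_mat_def)
  have "char_poly (cyclic_select n i j X) = [:0, 0, 1:] * char_poly (lead_mat n X)
      - [:?C $$ (0, 1):] * adj_form n (lead_mat n X) (\<lambda>r. ?v $$ (1, r)) (\<lambda>s. ?u $$ (s, 0))"
    unfolding eq by (rule char_poly_cyclic[OF select_mat_carrier]) auto
  also have "adj_form n (lead_mat n X) (\<lambda>r. ?v $$ (1, r)) (\<lambda>s. ?u $$ (s, 0)) = border_form n X j i"
    by (rule adj_form_cong) auto
  finally show ?thesis by simp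
qed

text \<open>With A the leading block and b the first border column of \<open>X\<close>, the columns
  are b, A b, ..., \<open>A\<^sup>n\<^sup>-\<^sup>1 b\<close>. The matrix is invertible exactly when
  b is a cyclic vector of A.\<close>

definition krylov_mat :: "nat \<Rightarrow> complex mat \<Rightarrow> complex mat" where
  "krylov_mat n X = mat n n (\<lambda>(r, k). col_krylov n X (\<lambda>s. X $$ (s, n)) k r)"

lemma row_krylov_hermitian:
  assumes X: "\<And>r s. r < n \<Longrightarrow> s < n \<Longrightarrow> A $$ (r, s) = cnj (A $$ (s, r))" and v: "\<And>s. s < n \<Longrightarrow> v s = cnj (u s)"
  shows "r < n \<Longrightarrow> row_krylov n A v k r = cnj (col_krylov n A u k r)"
proof (induction k arbitrary: r)
  case (Suc k)
  have "row_krylov n A v k t * A $$ (t, r) = cnj (A $$ (r, t) * col_krylov n A u k t)" if "t < n" for t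
    using Suc.IH[OF that] X[OF that Suc.prems] by simp
  then show ?case by (simp add: cnj_sum)
qed (use v in simp)

lemma det_mat_adjoint:
  fixes A :: "complex mat"
  assumes A: "A \<in> carrier_mat n n"
  shows "det (mat_adjoint A) = cnj (det A)"
proof -
  have "mat_adjoint A = transpose_mat (map_mat cnj A)"
    using A mat_adjoint_carrier[OF A] by (intro eq_matI) (auto simp: mat_adjoint_index[OF A])
  then have "det (mat_adjoint A) = det (map_mat cnj A)"
    using A by (simp add: det_transpose[of _ n])
  also have "\<dots> = (\<Sum>p | p permutes {0..<n}. signof p * (\<Prod>i = 0..<n. cnj (A $$ (i, p i))))"
    using A by (subst det_def'[of _ n]) (auto intro!: sum.cong prod.cong simp: permutes_in_image)
  also have "\<dots> = cnj (det A)"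
    by (subst det_def'[OF A]) (simp add: cnj_sum cnj_prod sign_def)
  finally show ?thesis .
qed

text \<open>For Hermitian \<open>X\<close> the rows of the adjoint Krylov matrix are themselves row
  Krylov vectors. The Gram matrix of the Krylov vectors and the matrix of the leading block in terms
  of them are therefore Hankel matrices of moments, which the statistics control.\<close>

lemma krylov_hankel:
  assumes X: "X \<in> hermitian_mats d" and nd: "n < d"
  defines "A \<equiv> lead_mat n X" and "L \<equiv> mat_adjoint (krylov_mat n (X :: complex mat))"
  shows "k < n \<Longrightarrow> r < n \<Longrightarrow> L $$ (k, r) = row_krylov n A (\<lambda>r. X $$ (n, r)) k r"
    and "k < n \<Longrightarrow> l < n \<Longrightarrow> (L * krylov_mat n X) $$ (k, l) = moment n A (\<lambda>r. X $$ (n, r)) (\<lambda>s. X $$ (s, n)) (k + l)"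
    and "k < n \<Longrightarrow> l < n \<Longrightarrow> (L * A * krylov_mat n X) $$ (k, l) = moment n A (\<lambda>r. X $$ (n, r)) (\<lambda>s. X $$ (s, n)) (k + Suc l)"
proof -
  note Xij = hermitian_matsD(2)[OF X]
  have colk: "col_krylov n X u k r = col_krylov n A u k r" if "r < n" for u k r
    using that
  proof (induction k arbitrary: r)
    case (Suc k)
    then show ?case by (auto simp: A_def select_mat_def intro!: sum.cong)
  qed simp
  have K: "krylov_mat n X \<in> carrier_mat n n" by (simp add: krylov_mat_def)
  have L: "L \<in> carrier_mat n n" unfolding L_def by (rule mat_adjoint_carrier[OF K])
  have A: "A \<in> carrier_mat n n" unfolding A_def by (rule select_mat_carrier)
  have Kij: "krylov_mat n X $$ (r, k) = col_krylov n A (\<lambda>s. X $$ (s, n)) k r" if "r < n" "k < n" for r k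
    using that by (simp add: krylov_mat_def colk)
  show Lij: "L $$ (k, r) = row_krylov n A (\<lambda>r. X $$ (n, r)) k r" if "k < n" "r < n" for k r
  proof -
    have "row_krylov n A (\<lambda>r. X $$ (n, r)) k r = cnj (col_krylov n A (\<lambda>s. X $$ (s, n)) k r)"
    proof (rule row_krylov_hermitian[OF _ _ that(2)])
      fix r s assume rs: "r < n" "s < n"
      show "A $$ (r, s) = cnj (A $$ (s, r))"
        using rs nd Xij[of r s] by (simp add: A_def select_mat_def)
    next
      fix s assume "s < n"
      then show "X $$ (n, s) = cnj (X $$ (s, n))" using nd by (intro Xij) auto
    qed
    then show ?thesis unfolding L_def using that by (simp add: mat_adjoint_index[OF K] Kij)
  qed
  show "(L * krylov_mat n X) $$ (k, l) = moment n A (\<lambda>r. X $$ (n, r)) (\<lambda>s. X $$ (s, n)) (k + l)" if "k < n" "l < n"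
  proof -
    have "(L * krylov_mat n X) $$ (k, l) = (\<Sum>r<n. L $$ (k, r) * krylov_mat n X $$ (r, l))"
      using that L K by (simp add: scalar_prod_def atLeast0LessThan)
    then show ?thesis using that by (simp add: Lij Kij row_col_krylov)
  qed
  show "(L * A * krylov_mat n X) $$ (k, l) = moment n A (\<lambda>r. X $$ (n, r)) (\<lambda>s. X $$ (s, n)) (k + Suc l)" if "k < n" "l < n"
  proof -
    have "L * A * krylov_mat n X = L * (A * krylov_mat n X)" by (rule assoc_mult_mat[OF L A K])
    then have "(L * A * krylov_mat n X) $$ (k, l) = (\<Sum>r<n. L $$ (k, r) * (\<Sum>t<n. A $$ (r, t) * krylov_mat n X $$ (t, l)))"
      using that L K A by (simp add: scalar_prod_def atLeast0LessThan)
    also have "\<dots> = (\<Sum>r<n. row_krylov n A (\<lambda>r. X $$ (n, r)) k r * col_krylov n A (\<lambda>s. X $$ (s, n)) (Suc l) r)"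
      using that by (simp add: Lij Kij)
    finally show ?thesis unfolding row_col_krylov .
  qed
qed

text \<open>The products and triple products of the entries \<open>X $$ (i, j)\<close> with \<open>i, j \<ge> n\<close> determine these
  entries up to a diagonal unitary conjugation \<open>\<theta>\<close>. After this normalisation the statistics give
  all moments of the leading block \<open>A\<close> between the first border vector and the other ones, and
  the Krylov vectors of the first border vector carry one matrix to the other.\<close>

lemma separation:
  assumes n: "0 < n" "n < d" and X: "X \<in> hermitian_mats d" and X': "X' \<in> hermitian_mats d"
    and K: "det (krylov_mat n X) \<noteq> 0" and K': "det (krylov_mat n X') \<noteq> 0"
    and nz: "\<And>i j. i \<in> {n..<d} \<Longrightarrow> j \<in> {n..<d} \<Longrightarrow> i \<noteq> j \<Longrightarrow> X $$ (i, j) \<noteq> 0"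
    and nz': "\<And>i j. i \<in> {n..<d} \<Longrightarrow> j \<in> {n..<d} \<Longrightarrow> i \<noteq> j \<Longrightarrow> X' $$ (i, j) \<noteq> 0"
    and \<chi>: "char_poly (lead_mat n X) = char_poly (lead_mat n X')"
    and bord: "\<And>i. i \<in> {n..<d} \<Longrightarrow> char_poly (border_select n i X) = char_poly (border_select n i X')"
    and cyc: "\<And>i j. i \<in> {n..<d} \<Longrightarrow> j \<in> {n..<d} \<Longrightarrow> i \<noteq> j \<Longrightarrow> char_poly (cyclic_select n i j X) = char_poly (cyclic_select n i j X')"
    and pair: "\<And>i j. i \<in> {n..<d} \<Longrightarrow> j \<in> {n..<d} \<Longrightarrow> i \<noteq> j \<Longrightarrow> X $$ (i, j) * X $$ (j, i) = X' $$ (i, j) * X' $$ (j, i)"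
    and triple: "\<And>i j k. i \<in> {n..<d} \<Longrightarrow> j \<in> {n..<d} \<Longrightarrow> k \<in> {n..<d} \<Longrightarrow> i \<noteq> j \<Longrightarrow> j \<noteq> k \<Longrightarrow> i \<noteq> k \<Longrightarrow>
      X $$ (i, j) * X $$ (j, k) * X $$ (k, i) = X' $$ (i, j) * X' $$ (j, k) * X' $$ (k, i)"
  shows "\<exists>V. unitary_block n d V \<and> X' = V * X * mat_adjoint V"
proof -
  let ?A = "lead_mat n X" and ?A' = "lead_mat n X'"
  have Ac: "?A \<in> carrier_mat n n" "?A' \<in> carrier_mat n n" by (rule select_mat_carrier)+
  note herm = hermitian_matsD(2)
  have Xc: "X \<in> carrier_mat d d" "X' \<in> carrier_mat d d" using X X' by (auto simp: hermitian_mats_def)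
  \<comment> \<open>A common phase acts trivially by conjugation, so \<theta> may be set to 1 at the
    first border index \<open>n\<close>; the other values are read off column \<open>n\<close>.
    Pairs with \<open>n\<close> force modulus one, and triples through \<open>n\<close> carry the
    phases over to the remaining entries.\<close>
  define \<theta> where "\<theta> i = (if i = n then 1 else X' $$ (i, n) / X $$ (i, n))" for i
  have \<theta>n: "\<theta> n = 1" by (simp add: \<theta>_def)
  have first: "X' $$ (i, n) = \<theta> i * X $$ (i, n)" if "i \<in> {n..<d}" "i \<noteq> n" for i
    using that nz[of i n] n by (simp add: \<theta>_def)
  have first': "X' $$ (n, i) = cnj (\<theta> i) * X $$ (n, i)" if i: "i \<in> {n..<d}" "i \<noteq> n" for i
    using first[OF i] herm[OF X, of n i] herm[OF X', of n i] i n by simp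
  have unit: "\<theta> i * cnj (\<theta> i) = 1" if "i \<in> {n..<d}" for i
  proof (cases "i = n")
    case False
    have "X $$ (i, n) * X $$ (n, i) = (\<theta> i * cnj (\<theta> i)) * (X $$ (i, n) * X $$ (n, i))"
      using pair[of i n] first[OF that False] first'[OF that False] that False n by (simp add: mult_ac)
    then show ?thesis using nz[of i n] nz[of n i] that False n by simp
  qed (simp add: \<theta>_def)
  \<comment> \<open>Comparing the bordered polynomials gives a constant times
    \<open>char_poly ?A\<close>, of degree \<open>n\<close>, on one side and a difference of forms,
    of degree below \<open>n\<close>, on the other. Both sides must vanish, which separates the
    diagonal entry from the form.\<close>
  have diag_form: "X $$ (i, i) = X' $$ (i, i) \<and> border_form n X i i = border_form n X' i i" if i: "i \<in> {n..<d}" for i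
  proof -
    have eq: "[:X' $$ (i, i) - X $$ (i, i):] * char_poly ?A = border_form n X i i - border_form n X' i i"
    proof -
      have "[:X' $$ (i, i) - X $$ (i, i):] = [:- X $$ (i, i), 1:] - [:- X' $$ (i, i), 1:]" by simp
      then have "[:X' $$ (i, i) - X $$ (i, i):] * char_poly ?A = [:- X $$ (i, i), 1:] * char_poly ?A - [:- X' $$ (i, i), 1:] * char_poly ?A'"
        by (simp only: \<chi> left_diff_distrib)
      moreover have cancel: "a - b = x - y" if "a - x = b - y" for a b x y :: "complex poly"
        using that by (simp add: algebra_simps)
      have "[:- X $$ (i, i), 1:] * char_poly ?A - [:- X' $$ (i, i), 1:] * char_poly ?A' = border_form n X i i - border_form n X' i i"
        using bord[OF i] unfolding char_poly_border_select by (rule cancel)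
      ultimately show ?thesis by (rule trans)
    qed
    have "degree (border_form n X i i - border_form n X' i i) < n"
      using degree_adj_form[OF Ac(1) n(1)] degree_adj_form[OF Ac(2) n(1)] by (intro degree_diff_less) auto
    moreover have "degree (char_poly ?A) = n" using degree_monic_char_poly[OF Ac(1)] by simp
    ultimately have "[:X' $$ (i, i) - X $$ (i, i):] = 0"
      using eq degree_mult_eq[of "[:X' $$ (i, i) - X $$ (i, i):]" "char_poly ?A"] char_poly_nonzero[OF Ac(1)]
      by (metis not_add_less2)
    then show ?thesis using eq by simp
  qed
  have phase: "X' $$ (i, j) = \<theta> i * X $$ (i, j) * cnj (\<theta> j)" if i: "i \<in> {n..<d}" and j: "j \<in> {n..<d}" for i j
  proof -
    consider "i = j" | "i \<noteq> j" "i = n" | "i \<noteq> j" "j = n" | "i \<noteq> j" "i \<noteq> n" "j \<noteq> n" by blast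
    then show ?thesis
    proof cases
      case 1
      then show ?thesis using diag_form[OF i] unit[OF i] by (simp add: mult_ac)
    next
      case 2
      then show ?thesis using first'[OF j] \<theta>n by simp
    next
      case 3
      then show ?thesis using first[OF i] \<theta>n by simp
    next
      case 4
      have nn: "n \<in> {n..<d}" using n by simp
      have "X $$ (n, i) * X $$ (i, j) * X $$ (j, n) = X' $$ (n, i) * X' $$ (i, j) * X' $$ (j, n)"
        using triple[OF nn i j] 4 by auto
      also have "\<dots> = (cnj (\<theta> i) * X' $$ (i, j) * \<theta> j) * (X $$ (n, i) * X $$ (j, n))"
        using first'[OF i] first[OF j] 4 by (simp add: mult_ac)
      finally have "X $$ (n, i) * X $$ (i, j) * X $$ (j, n) = (cnj (\<theta> i) * X' $$ (i, j) * \<theta> j) * (X $$ (n, i) * X $$ (j, n))" .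
      from this[symmetric] have "(cnj (\<theta> i) * X' $$ (i, j) * \<theta> j) * (X $$ (n, i) * X $$ (j, n)) = X $$ (i, j) * (X $$ (n, i) * X $$ (j, n))"
        by (simp only: mult_ac)
      then have e: "cnj (\<theta> i) * X' $$ (i, j) * \<theta> j = X $$ (i, j)"
        using nz[OF nn i] nz[OF j nn] 4 by simp
      have "\<theta> i * X $$ (i, j) * cnj (\<theta> j) = (\<theta> i * cnj (\<theta> i)) * X' $$ (i, j) * (\<theta> j * cnj (\<theta> j))"
        unfolding e[symmetric] by (simp only: mult_ac)
      then show ?thesis using unit[OF i] unit[OF j] by simp
    qed
  qed
  \<comment> \<open>The cyclic polynomial yields the form only multiplied by the entry
    \<open>(i, n)\<close>. The entries of the two matrices there differ by the factor
    \<open>\<theta> i\<close>, so dividing by the nonzero entry of \<open>X\<close> leaves this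
    factor, which is put on the column vector. For \<open>i = n\<close> the bordered polynomial is
    used instead.\<close>
  have form: "border_form n X n i = adj_form n ?A' (\<lambda>r. X' $$ (n, r)) (\<lambda>s. \<theta> i * X' $$ (s, i))" if i: "i \<in> {n..<d}" for i
  proof (cases "i = n")
    case True
    then show ?thesis using diag_form[OF i] by (simp add: \<theta>n)
  next
    case False
    have nn: "n \<in> {n..<d}" using n by simp
    have e: "[:X $$ (i, n):] * border_form n X n i = [:X' $$ (i, n):] * border_form n X' n i"
      using cyc[OF i nn False] \<chi> unfolding char_poly_cyclic_select by simp
    have "[:X' $$ (i, n):] = [:X $$ (i, n):] * [:\<theta> i:]" using first[OF i False] by simp
    with e have "[:X $$ (i, n):] * border_form n X n i = [:X $$ (i, n):] * ([:\<theta> i:] * border_form n X' n i)"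
      by (simp only: mult.assoc)
    moreover have "[:X $$ (i, n):] \<noteq> 0" using nz[OF i nn False] by simp
    ultimately have "border_form n X n i = [:\<theta> i:] * border_form n X' n i"
      using mult_left_cancel by blast
    also have "\<dots> = adj_form n ?A' (\<lambda>r. X' $$ (n, r)) (\<lambda>s. \<theta> i * X' $$ (s, i))"
      unfolding adj_form_def sum_distrib_left
    proof (intro sum.cong refl)
      fix r s
      have "[:\<theta> i * X' $$ (s, i):] = [:\<theta> i:] * [:X' $$ (s, i):]" by simp
      then show "[:\<theta> i:] * ([:X' $$ (n, r):] * adj_mat (char_poly_matrix ?A') $$ (r, s) * [:X' $$ (s, i):])
        = [:X' $$ (n, r):] * adj_mat (char_poly_matrix ?A') $$ (r, s) * [:\<theta> i * X' $$ (s, i):]"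
        by (simp only: mult_ac)
    qed
    finally show ?thesis .
  qed
  have mom: "moment n ?A (\<lambda>r. X $$ (n, r)) (\<lambda>s. X $$ (s, i)) k
      = moment n ?A' (\<lambda>r. X' $$ (n, r)) (\<lambda>s. \<theta> i * X' $$ (s, i)) k" if "i \<in> {n..<d}" for i k
    by (rule moment_eqI[OF Ac n(1) \<chi> form[OF that]])
  let ?K = "krylov_mat n X" and ?K' = "krylov_mat n X'"
  let ?L = "mat_adjoint ?K" and ?L' = "mat_adjoint ?K'"
  have Kc: "?K \<in> carrier_mat n n" "?K' \<in> carrier_mat n n" by (simp_all add: krylov_mat_def)
  have Lc: "?L \<in> carrier_mat n n" "?L' \<in> carrier_mat n n" by (intro mat_adjoint_carrier Kc)+
  have Ln: "det ?L \<noteq> 0" "det ?L' \<noteq> 0" using K K' by (simp_all add: det_mat_adjoint[OF Kc(1)] det_mat_adjoint[OF Kc(2)])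
  have mom0: "moment n ?A (\<lambda>r. X $$ (n, r)) (\<lambda>s. X $$ (s, n)) k = moment n ?A' (\<lambda>r. X' $$ (n, r)) (\<lambda>s. X' $$ (s, n)) k" for k
    using mom[of n k] n by (simp add: \<theta>n)
  have LK: "?L * ?K = ?L' * ?K'"
    using Kc Lc by (intro eq_matI) (auto simp: krylov_hankel(2)[OF X n(2)] krylov_hankel(2)[OF X' n(2)] mom0 simp del: index_mult_mat(1))
  have LAK: "?L * ?A * ?K = ?L' * ?A' * ?K'"
    using Kc Lc Ac by (intro eq_matI) (auto simp: krylov_hankel(3)[OF X n(2)] krylov_hankel(3)[OF X' n(2)] mom0 simp del: index_mult_mat(1) assoc_mult_mat)
  obtain U W where U: "U \<in> carrier_mat n n" and W: "W \<in> carrier_mat n n" and UW: "U * W = 1\<^sub>m n"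
    and LU: "?L' * U = ?L" and UAW: "U * ?A * W = ?A'"
    and Wuniq: "\<And>Q. Q \<in> carrier_mat n n \<Longrightarrow> Q * ?K' = ?K \<Longrightarrow> Q = W"
    and canc: "\<And>x y. x \<in> carrier_mat n 1 \<Longrightarrow> y \<in> carrier_mat n 1 \<Longrightarrow> ?L' * x = ?L' * y \<Longrightarrow> x = y"
    using krylov_intertwiner[OF Kc Lc Ac K K' Ln LK LAK] by blast
  note Ua = mat_adjoint_carrier[OF U]
  \<comment> \<open>This is the adjoint of \<open>?L' * U = ?L\<close>. The uniqueness clause then
    identifies the adjoint of \<open>U\<close> with its inverse \<open>W\<close>, so
    \<open>U\<close> is unitary.\<close>
  have "mat_adjoint U * ?K' = ?K"
  proof (rule eq_matI)
    fix r k assume "r < dim_row ?K" "k < dim_col ?K"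
    then have rk: "r < n" "k < n" using Kc by auto
    have "(mat_adjoint U * ?K') $$ (r, k) = cnj (\<Sum>t<n. ?L' $$ (k, t) * U $$ (t, r))"
      using rk U Ua Kc by (simp add: scalar_prod_def atLeast0LessThan mat_adjoint_index[OF U] mat_adjoint_index[OF Kc(2)] cnj_sum mult.commute)
    also have "(\<Sum>t<n. ?L' $$ (k, t) * U $$ (t, r)) = (?L' * U) $$ (k, r)"
      using rk U Lc by (simp add: scalar_prod_def atLeast0LessThan)
    also have "cnj \<dots> = ?K $$ (r, k)" unfolding LU using rk by (simp add: mat_adjoint_index[OF Kc(1)])
    finally show "(mat_adjoint U * ?K') $$ (r, k) = ?K $$ (r, k)" .
  qed (use Kc Ua in auto)
  then have UaW: "mat_adjoint U = W" by (rule Wuniq[OF Ua])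
  have Wij: "W $$ (i, j) = cnj (U $$ (j, i))" if "i < n" "j < n" for i j
    unfolding UaW[symmetric] using that by (intro mat_adjoint_index[OF U])
  \<comment> \<open>Both sides have the same image under the injective \<open>?L'\<close>: its
    entries are the moments of border column \<open>i\<close> against the first border vector, which
    \<open>mom\<close> identifies.\<close>
  have Ub: "(\<Sum>k<n. U $$ (r, k) * X $$ (k, i)) = \<theta> i * X' $$ (r, i)" if r: "r < n" and i: "i \<in> {n..<d}" for r i
  proof -
    let ?b = "mat n 1 (\<lambda>(s, _). X $$ (s, i))" and ?b' = "mat n 1 (\<lambda>(s, _). \<theta> i * X' $$ (s, i))"
    have eqL: "?L' * (U * ?b) = ?L' * ?b'"
    proof (rule eq_matI)
      fix k c assume "k < dim_row (?L' * ?b')" "c < dim_col (?L' * ?b')"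
      then have kc: "k < n" "c = 0" using Lc by auto
      have "?L' * (U * ?b) = ?L * ?b" using assoc_mult_mat[OF Lc(2) U, of ?b 1] LU by simp
      then have "(?L' * (U * ?b)) $$ (k, c) = (\<Sum>r<n. ?L $$ (k, r) * X $$ (r, i))"
        using Lc kc by (simp add: scalar_prod_def atLeast0LessThan)
      also have "\<dots> = moment n ?A (\<lambda>r. X $$ (n, r)) (\<lambda>s. X $$ (s, i)) k"
        unfolding moment_def using kc by (intro sum.cong refl) (simp add: krylov_hankel(1)[OF X n(2)])
      also have "\<dots> = (\<Sum>r<n. ?L' $$ (k, r) * (\<theta> i * X' $$ (r, i)))"
        unfolding mom[OF i] unfolding moment_def using kc by (intro sum.cong refl) (simp add: krylov_hankel(1)[OF X' n(2)])
      also have "\<dots> = (?L' * ?b') $$ (k, c)"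
        using Lc kc by (simp add: scalar_prod_def atLeast0LessThan)
      finally show "(?L' * (U * ?b)) $$ (k, c) = (?L' * ?b') $$ (k, c)" .
    qed (use Lc U in auto)
    have "U * ?b = ?b'" by (rule canc[OF mult_carrier_mat[OF U mat_carrier] mat_carrier eqL])
    then have "(U * ?b) $$ (r, 0) = ?b' $$ (r, 0)" by simp
    then show ?thesis using r U by (simp add: scalar_prod_def atLeast0LessThan)
  qed
  \<comment> \<open>\<open>U\<close> acts on the leading coordinates and \<theta> on the border
    ones. As \<open>U\<close> sends border column \<open>i\<close> of \<open>X\<close> to
    \<open>\<theta> i\<close> times that of \<open>X'\<close>, the conjugate phase contributed by
    the right factor restores the column exactly.\<close>
  define V where "V = mat d d (\<lambda>(r, c). if r < n \<and> c < n then U $$ (r, c) else if r = c then \<theta> r else 0)"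
  have Vc: "V \<in> carrier_mat d d" by (simp add: V_def)
  have V0: "V $$ (r, c) = 0" if "r < d" "c < d" "r \<noteq> c" "n \<le> r \<or> n \<le> c" for r c
    using that by (auto simp: V_def)
  have VU: "V $$ (r, c) = U $$ (r, c)" if "r < n" "c < n" for r c using that n by (simp add: V_def)
  have V\<theta>: "V $$ (r, r) = \<theta> r" if "n \<le> r" "r < d" for r using that by (simp add: V_def)
  have nd: "n \<le> d" using n by simp
  have Vsum: "(\<Sum>k<d. V $$ (r, k) * f k) = (if r < n then \<Sum>k<n. V $$ (r, k) * f k else V $$ (r, r) * f r)"
    if "r < d" for r f
    by (rule unitary_block_sum[OF _ nd that]) (rule V0)
  have cVsum: "(\<Sum>k<d. cnj (V $$ (r, k)) * f k) = (if r < n then \<Sum>k<n. cnj (V $$ (r, k)) * f k else cnj (V $$ (r, r)) * f r)" if "r < d" for r f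
    using arg_cong[OF Vsum[OF that, of "\<lambda>k. cnj (f k)"], of cnj] by (auto simp: cnj_sum split: if_splits)
  have "V * mat_adjoint V = 1\<^sub>m d"
  proof (rule eq_matI)
    fix r c assume "r < dim_row (1\<^sub>m d :: complex mat)" "c < dim_col (1\<^sub>m d :: complex mat)"
    then have rc: "r < d" "c < d" by auto
    have eq: "(V * mat_adjoint V) $$ (r, c) = (\<Sum>k<d. V $$ (r, k) * cnj (V $$ (c, k)))"
      using rc Vc mat_adjoint_carrier[OF Vc] by (simp add: scalar_prod_def atLeast0LessThan mat_adjoint_index[OF Vc])
    show "(V * mat_adjoint V) $$ (r, c) = 1\<^sub>m d $$ (r, c)"
    proof (cases "r < n")
      case True
      show ?thesis
      proof (cases "c < n")
        case c: True
        have "(\<Sum>k<n. V $$ (r, k) * cnj (V $$ (c, k))) = (\<Sum>k<n. U $$ (r, k) * W $$ (k, c))"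
          using True c by (intro sum.cong refl) (simp add: VU Wij)
        also have "\<dots> = (U * W) $$ (r, c)" using True c U W by (simp add: scalar_prod_def atLeast0LessThan)
        finally show ?thesis using True c rc eq Vsum[OF rc(1)] UW by simp
      next
        case False
        have "(\<Sum>k<n. V $$ (r, k) * cnj (V $$ (c, k))) = 0"
          using False rc True nd by (intro sum.neutral ballI) (simp add: V0)
        then show ?thesis using True False rc eq Vsum[OF rc(1)] by auto
      qed
    next
      case False
      then have "(V * mat_adjoint V) $$ (r, c) = \<theta> r * cnj (V $$ (c, r))"
        unfolding eq using rc by (subst Vsum) (auto simp: V\<theta>)
      then show ?thesis using False rc unit[of r] V\<theta>[of r] V0[of c r] by (cases "r = c") auto
    qed
  qed (use Vc mat_adjoint_carrier[OF Vc] in auto)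
  then have "unitary_block n d V" using Vc V0 by (auto simp: unitary_block_def)
  moreover have "X' = V * X * mat_adjoint V"
  proof (rule eq_matI)
    fix r c assume "r < dim_row (V * X * mat_adjoint V)" "c < dim_col (V * X * mat_adjoint V)"
    then have rc: "r < d" "c < d" using Vc mat_adjoint_carrier[OF Vc] by auto
    note eq = unitary_block_conj_index[OF Vc Xc(1) rc]
    have low: "X' $$ (r, c) = (V * X * mat_adjoint V) $$ (r, c)" if rn: "r < n" and cn: "n \<le> c"
    proof -
      have ci: "c \<in> {n..<d}" using cn rc by simp
      have "(V * X * mat_adjoint V) $$ (r, c) = (\<Sum>k<n. V $$ (r, k) * (cnj (\<theta> c) * X $$ (k, c)))"
        unfolding eq Vsum[OF rc(1)] cVsum[OF rc(2)] using rn cn rc by (simp add: V\<theta>)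
      also have "\<dots> = cnj (\<theta> c) * (\<Sum>k<n. U $$ (r, k) * X $$ (k, c))"
        using rn by (simp add: VU sum_distrib_left mult_ac)
      also have "\<dots> = (\<theta> c * cnj (\<theta> c)) * X' $$ (r, c)" unfolding Ub[OF rn ci] by (simp only: mult_ac)
      finally show ?thesis using unit[OF ci] by simp
    qed
    consider "r < n" "c < n" | "r < n" "n \<le> c" | "n \<le> r" "c < n" | "n \<le> r" "n \<le> c" by linarith
    then show "X' $$ (r, c) = (V * X * mat_adjoint V) $$ (r, c)"
    proof cases
      case 1
      have "(V * X * mat_adjoint V) $$ (r, c) = (\<Sum>k<n. U $$ (r, k) * (\<Sum>l<n. cnj (U $$ (c, l)) * X $$ (k, l)))"
        unfolding eq Vsum[OF rc(1)] cVsum[OF rc(2)] using 1 by (simp add: VU)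
      also have "\<dots> = (U * ?A * mat_adjoint U) $$ (r, c)"
        unfolding unitary_block_conj_index[OF U Ac(1) 1] using 1
        by (intro sum.cong refl arg_cong2[where f="(*)"]) (simp add: select_mat_def)
      also have "\<dots> = X' $$ (r, c)" unfolding UaW UAW using 1 by (simp add: select_mat_def)
      finally show ?thesis by simp
    next
      case 2 then show ?thesis by (rule low)
    next
      case 3
      have ri: "r \<in> {n..<d}" using 3 rc by simp
      have "(V * X * mat_adjoint V) $$ (r, c) = \<theta> r * (\<Sum>l<n. cnj (U $$ (c, l)) * X $$ (r, l))"
        unfolding eq Vsum[OF rc(1)] cVsum[OF rc(2)] using 3 rc by (simp add: VU V\<theta>)
      also have "(\<Sum>l<n. cnj (U $$ (c, l)) * X $$ (r, l)) = cnj (\<Sum>l<n. U $$ (c, l) * X $$ (l, r))"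
        unfolding cnj_sum using rc n by (intro sum.cong refl) (simp add: herm[OF X, of r])
      also have "\<dots> = cnj (\<theta> r) * X' $$ (r, c)"
        unfolding Ub[OF 3(2) ri] using herm[OF X', of r c] rc by simp
      also have "\<theta> r * (cnj (\<theta> r) * X' $$ (r, c)) = X' $$ (r, c)" using unit[OF ri] by (simp flip: mult.assoc)
      finally show ?thesis by simp
    next
      case 4
      then have "r \<in> {n..<d}" "c \<in> {n..<d}" using rc by auto
      from phase[OF this] show ?thesis
        unfolding eq Vsum[OF rc(1)] cVsum[OF rc(2)] using 4 rc by (simp add: V\<theta> mult_ac)
    qed
  qed (use Xc Vc mat_adjoint_carrier[OF Vc] in auto)
  ultimately show ?thesis by blast
qed

section \<open>Generic matrices\<close>

text \<open>The Leibniz expansion exhibits the value at \<open>z\<close> as a polynomial in the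
  entries of \<open>X\<close>; both measurability and continuity are read off from it.\<close>

lemma poly_char_poly_select_mat:
  "poly (char_poly (select_mat m \<sigma> P X)) z = (\<Sum>p | p permutes {0..<m}. signof p *
     (\<Prod>i = 0..<m. (if i = p i then z else 0) - (if P i (p i) then X $$ (\<sigma> i, \<sigma> (p i)) else 0)))"
proof -
  have S: "select_mat m \<sigma> P X \<in> carrier_mat m m" by (rule select_mat_carrier)
  have M: "- char_matrix (select_mat m \<sigma> P X) z \<in> carrier_mat m m"
    using S by (auto simp: char_matrix_def)
  have "poly (char_poly (select_mat m \<sigma> P X)) z = det (- char_matrix (select_mat m \<sigma> P X) z)"
    unfolding char_poly_def by (rule poly_det_cong[of _ m]) (use S in \<open>auto simp: char_poly_matrix_def char_matrix_def\<close>)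
  also have "\<dots> = (\<Sum>p | p permutes {0..<m}. signof p *
     (\<Prod>i = 0..<m. (if i = p i then z else 0) - (if P i (p i) then X $$ (\<sigma> i, \<sigma> (p i)) else 0)))"
  proof (subst det_def'[OF M], intro sum.cong refl arg_cong2[where f="(*)"] prod.cong)
    fix p i assume "p \<in> {p. p permutes {0..<m}}" "i \<in> {0..<m}"
    then have "i < m" "p i < m" using permutes_in_image[of p "{0..<m}" i] by auto
    then show "(- char_matrix (select_mat m \<sigma> P X) z) $$ (i, p i) =
      (if i = p i then z else 0) - (if P i (p i) then X $$ (\<sigma> i, \<sigma> (p i)) else 0)"
      by (simp add: char_matrix_def select_mat_def)
  qed
  finally show ?thesis .
qed

lemma eigenvalue_mset_select_measurable:
  assumes "\<And>a. a < m \<Longrightarrow> \<sigma> a < d"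
  shows "(\<lambda>X. eigenvalue_mset (select_mat m \<sigma> P X)) \<in> mat_borel d \<rightarrow>\<^sub>M mset_borel"
  unfolding eigenvalue_mset_def
proof (rule proots_measurable[where n=m])
  fix z :: nat
  show "(\<lambda>X. poly (char_poly (select_mat m \<sigma> P X)) (of_nat z)) \<in> borel_measurable (mat_borel d)"
    unfolding poly_char_poly_select_mat
  proof (intro borel_measurable_sum borel_measurable_times borel_measurable_prod borel_measurable_diff borel_measurable_const)
    fix p i assume "p \<in> {p. p permutes {0..<m}}" "i \<in> {0..<m}"
    then have "i < m" "p i < m" using permutes_in_image[of p "{0..<m}" i] by auto
    then show "(\<lambda>X. if P i (p i) then X $$ (\<sigma> i, \<sigma> (p i)) else 0) \<in> borel_measurable (mat_borel d)"
      using mat_borel_entry[of "\<sigma> i" d "\<sigma> (p i)"] assms by (cases "P i (p i)") auto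
  qed
qed (use degree_monic_char_poly[OF select_mat_carrier] in auto)

text \<open>A monic complex polynomial splits over its roots. Together with
  \<open>prod_mset_measurable\<close> this recovers the values of the characteristic polynomial
  measurably from the eigenvalues.\<close>

lemma poly_char_poly_eq_prod_mset:
  assumes "A \<in> carrier_mat m m"
  shows "poly (char_poly A) z = (\<Prod>x\<in>#eigenvalue_mset A. z - x)"
proof -
  have "lead_coeff (char_poly A) = 1" using degree_monic_char_poly[OF assms] by simp
  then have "char_poly A = (\<Prod>x\<in>#proots (char_poly A). [:-x, 1:])"
    using complex_poly_decompose_multiset[of "char_poly A"] by simp
  then have "poly (char_poly A) z = poly (\<Prod>x\<in>#proots (char_poly A). [:-x, 1:]) z" by (rule arg_cong)
  also have "\<dots> = (\<Prod>x\<in>#proots (char_poly A). z - x)"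
    by (simp add: poly_prod_mset image_mset.compositionality comp_def)
  finally show ?thesis by (simp add: eigenvalue_mset_def)
qed

text \<open>The adjacency matrix of the path n, 0, 1, ..., n - 1, with all other vertices isolated.
  It is the witness that the Krylov determinant is not identically zero on Hermitian
  matrices.\<close>

definition path_mat :: "nat \<Rightarrow> nat \<Rightarrow> complex mat" where
  "path_mat n d = mat d d (\<lambda>(r, c). if r < n \<and> c < n \<and> (r = Suc c \<or> c = Suc r) \<or> r = 0 \<and> c = n \<or> r = n \<and> c = 0 then 1 else 0)"

lemma path_mat_hermitian: "path_mat n d \<in> hermitian_mats d"
  by (rule hermitian_matsI) (auto simp: path_mat_def)

text \<open>Walking k steps from vertex 0 along the path reaches no vertex beyond k, and vertex k
  itself in exactly one way. Hence the Krylov matrix is upper triangular with ones on the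
  diagonal.\<close>

lemma col_krylov_path:
  assumes nd: "n < d"
  shows "r < n \<Longrightarrow> k \<le> r \<Longrightarrow> col_krylov n (path_mat n d) (\<lambda>s. path_mat n d $$ (s, n)) k r = (if k = r then 1 else 0)"
proof (induction k arbitrary: r)
  case 0
  then show ?case using nd by (simp add: path_mat_def)
next
  case (Suc k)
  have summand: "path_mat n d $$ (r, t) * col_krylov n (path_mat n d) (\<lambda>s. path_mat n d $$ (s, n)) k t
    = (if t = k then (if Suc k = r then 1 else 0) else 0)" if t: "t < n" for t
  proof (cases "k \<le> t")
    case True
    then show ?thesis using Suc.IH[OF t True] t Suc.prems nd by (auto simp: path_mat_def)
  next
    case False
    then show ?thesis using t Suc.prems nd by (simp add: path_mat_def)
  qed
  have "col_krylov n (path_mat n d) (\<lambda>s. path_mat n d $$ (s, n)) (Suc k) r = (\<Sum>t<n. if t = k then (if Suc k = r then 1 else 0) else 0)"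
    unfolding col_krylov.simps by (intro sum.cong refl) (simp only: summand lessThan_iff)
  also have "\<dots> = (if Suc k = r then 1 else 0)" using Suc.prems by simp
  finally show ?case .
qed

lemma det_krylov_path:
  assumes "n < d"
  shows "det (krylov_mat n (path_mat n d)) = 1"
proof -
  have K: "krylov_mat n (path_mat n d) \<in> carrier_mat n n" by (simp add: krylov_mat_def)
  have "upper_triangular (krylov_mat n (path_mat n d))"
    using col_krylov_path[OF assms] by (auto simp: krylov_mat_def)
  then have "det (krylov_mat n (path_mat n d)) = prod_list (diag_mat (krylov_mat n (path_mat n d)))"
    using K by (rule det_upper_triangular)
  also have "diag_mat (krylov_mat n (path_mat n d)) = map (\<lambda>_. 1) [0..<n]"
    using col_krylov_path[OF assms] by (auto simp: diag_mat_def krylov_mat_def)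
  also have "prod_list \<dots> = (1 :: complex)" by (induction n) auto
  finally show ?thesis .
qed

section \<open>Zeros of the Krylov determinant along lines\<close>

definition poly_on_line :: "(real \<Rightarrow> complex) \<Rightarrow> bool" where
  "poly_on_line f \<longleftrightarrow> (\<exists>P. \<forall>s. f s = poly P (of_real s))"

lemma poly_on_line_affine: "poly_on_line (\<lambda>s. a + of_real s * b)"
  unfolding poly_on_line_def by (intro exI[of _ "[:a, b:]"]) simp

lemma poly_on_line_const: "poly_on_line (\<lambda>s. a)"
  using poly_on_line_affine[of a 0] by simp

lemma poly_on_line_add:
  assumes "poly_on_line f" "poly_on_line g"
  shows "poly_on_line (\<lambda>s. f s + g s)"
proof -
  obtain P Q where "\<And>s. f s = poly P (of_real s)" "\<And>s. g s = poly Q (of_real s)"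
    using assms unfolding poly_on_line_def by blast
  then show ?thesis unfolding poly_on_line_def by (intro exI[of _ "P + Q"]) simp
qed

lemma poly_on_line_mult:
  assumes "poly_on_line f" "poly_on_line g"
  shows "poly_on_line (\<lambda>s. f s * g s)"
proof -
  obtain P Q where "\<And>s. f s = poly P (of_real s)" "\<And>s. g s = poly Q (of_real s)"
    using assms unfolding poly_on_line_def by blast
  then show ?thesis unfolding poly_on_line_def by (intro exI[of _ "P * Q"]) simp
qed

lemma poly_on_line_sum: "(\<And>i. i \<in> I \<Longrightarrow> poly_on_line (f i)) \<Longrightarrow> poly_on_line (\<lambda>s. \<Sum>i\<in>I. f i s)"
  by (induction I rule: infinite_finite_induct) (simp_all add: poly_on_line_const poly_on_line_add)

lemma poly_on_line_prod: "(\<And>i. i \<in> I \<Longrightarrow> poly_on_line (f i)) \<Longrightarrow> poly_on_line (\<lambda>s. \<Prod>i\<in>I. f i s)"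
  by (induction I rule: infinite_finite_induct) (simp_all add: poly_on_line_const poly_on_line_mult)

lemma det_krylov_expand:
  "det (krylov_mat n X) = (\<Sum>p | p permutes {0..<n}. signof p * (\<Prod>i = 0..<n. col_krylov n X (\<lambda>s. X $$ (s, n)) (p i) i))"
proof -
  have K: "krylov_mat n X \<in> carrier_mat n n" by (simp add: krylov_mat_def)
  show ?thesis
  proof (subst det_def'[OF K], intro sum.cong refl arg_cong2[where f="(*)"] prod.cong)
    fix p i assume "p \<in> {p. p permutes {0..<n}}" "i \<in> {0..<n}"
    then have "i < n" "p i < n" using permutes_in_image[of p "{0..<n}" i] by auto
    then show "krylov_mat n X $$ (i, p i) = col_krylov n X (\<lambda>s. X $$ (s, n)) (p i) i" by (simp add: krylov_mat_def)
  qed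
qed

lemma poly_on_line_det_krylov:
  assumes X: "X \<in> carrier_mat d d" and Y: "Y \<in> carrier_mat d d" and nd: "n < d"
  shows "poly_on_line (\<lambda>s. det (krylov_mat n (Y + complex_of_real s \<cdot>\<^sub>m X)))"
proof -
  let ?Z = "\<lambda>s. Y + complex_of_real s \<cdot>\<^sub>m X"
  have Zij: "?Z s $$ (i, j) = Y $$ (i, j) + of_real s * X $$ (i, j)" if "i < d" "j < d" for i j s
    using that X Y by simp
  have ent: "poly_on_line (\<lambda>s. ?Z s $$ (i, j))" if "i < d" "j < d" for i j
    unfolding Zij[OF that] by (rule poly_on_line_affine)
  have "poly_on_line (\<lambda>s. col_krylov n (?Z s) (\<lambda>t. ?Z s $$ (t, n)) k r)" if "r < n" for k r
    using that
  proof (induction k arbitrary: r)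
    case 0
    then show ?case using ent[of r n] nd by simp
  next
    case (Suc k)
    then show ?case using nd unfolding col_krylov.simps
      by (intro poly_on_line_sum poly_on_line_mult ent) auto
  qed
  then show ?thesis
    unfolding det_krylov_expand by (intro poly_on_line_sum poly_on_line_mult poly_on_line_const poly_on_line_prod) auto
qed

lemma det_krylov_smult:
  assumes X: "X \<in> carrier_mat d d" and nd: "n < d"
  shows "det (krylov_mat n (c \<cdot>\<^sub>m X)) = (\<Prod>i = 0..<n. c ^ Suc i) * det (krylov_mat n X)"
proof -
  have k: "col_krylov n (c \<cdot>\<^sub>m X) (\<lambda>s. (c \<cdot>\<^sub>m X) $$ (s, n)) k r = c ^ Suc k * col_krylov n X (\<lambda>s. X $$ (s, n)) k r"
    if "r < n" for k r
    using that
  proof (induction k arbitrary: r)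
    case 0
    then show ?case using X nd by simp
  next
    case (Suc k)
    then show ?case using X nd unfolding col_krylov.simps sum_distrib_left
      by (intro sum.cong refl) simp
  qed
  \<comment> \<open>A permutation only reorders the exponents, so every term of the Leibniz
    expansion carries the same power of \<open>c\<close>.\<close>
  have pp: "(\<Prod>i = 0..<n. c ^ Suc (p i)) = (\<Prod>i = 0..<n. c ^ Suc i)" if "p permutes {0..<n}" for p
    using prod.permute[OF that, of "\<lambda>i. c ^ Suc i"] unfolding comp_def by (rule sym)
  show ?thesis
    unfolding det_krylov_expand sum_distrib_left
  proof (intro sum.cong refl)
    fix p assume p: "p \<in> {p. p permutes {0..<n}}"
    have "(\<Prod>i = 0..<n. col_krylov n (c \<cdot>\<^sub>m X) (\<lambda>s. (c \<cdot>\<^sub>m X) $$ (s, n)) (p i) i)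
      = (\<Prod>i = 0..<n. c ^ Suc (p i) * col_krylov n X (\<lambda>s. X $$ (s, n)) (p i) i)"
      by (intro prod.cong refl k) simp
    also have "\<dots> = (\<Prod>i = 0..<n. c ^ Suc i) * (\<Prod>i = 0..<n. col_krylov n X (\<lambda>s. X $$ (s, n)) (p i) i)"
      using p by (simp only: prod.distrib pp mem_Collect_eq)
    finally show "signof p * (\<Prod>i = 0..<n. col_krylov n (c \<cdot>\<^sub>m X) (\<lambda>s. (c \<cdot>\<^sub>m X) $$ (s, n)) (p i) i)
      = (\<Prod>i = 0..<n. c ^ Suc i) * (signof p * (\<Prod>i = 0..<n. col_krylov n X (\<lambda>s. X $$ (s, n)) (p i) i))"
      by (simp only: mult_ac)
  qed
qed

text \<open>By homogeneity, for r different from 0 the determinant at X + r Y is a nonzero multiple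
  of the one at Y + X / r, where Y is the path matrix. The latter is a polynomial in 1 / r with
  value 1 at 0, so it has finitely many zeros; the point r = 0 is added by hand.\<close>

lemma finite_zeros_det_krylov:
  assumes X: "X \<in> carrier_mat d d" and nd: "n < d"
  shows "finite {r :: real. det (krylov_mat n (X + complex_of_real r \<cdot>\<^sub>m path_mat n d)) = 0}"
proof -
  let ?Y = "path_mat n d"
  have Y: "?Y \<in> carrier_mat d d" by (simp add: path_mat_def)
  obtain P where P: "\<And>s. det (krylov_mat n (?Y + complex_of_real s \<cdot>\<^sub>m X)) = poly P (of_real s)"
    using poly_on_line_det_krylov[OF X Y nd] unfolding poly_on_line_def by blast
  have "?Y + complex_of_real 0 \<cdot>\<^sub>m X = ?Y" using X Y by (intro eq_matI) auto
  then have "poly P 0 = 1" using P[of 0] det_krylov_path[OF nd] by simp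
  then have "P \<noteq> 0" by auto
  then have "finite {z. poly P z = 0}" by (rule poly_roots_finite)
  then have "finite ((\<lambda>r :: real. complex_of_real (inverse r)) -` {z. poly P z = 0})"
    by (rule finite_vimageI) (auto simp: inj_def)
  then have "finite (insert 0 ((\<lambda>r :: real. complex_of_real (inverse r)) -` {z. poly P z = 0}))" by simp
  moreover have "{r :: real. det (krylov_mat n (X + complex_of_real r \<cdot>\<^sub>m ?Y)) = 0}
    \<subseteq> insert 0 ((\<lambda>r :: real. complex_of_real (inverse r)) -` {z. poly P z = 0})"
  proof
    fix r :: real assume r: "r \<in> {r. det (krylov_mat n (X + complex_of_real r \<cdot>\<^sub>m ?Y)) = 0}"
    show "r \<in> insert 0 ((\<lambda>r :: real. complex_of_real (inverse r)) -` {z. poly P z = 0})"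
    proof (cases "r = 0")
      case False
      have "X + complex_of_real r \<cdot>\<^sub>m ?Y = complex_of_real r \<cdot>\<^sub>m (?Y + complex_of_real (inverse r) \<cdot>\<^sub>m X)"
        using X Y False by (intro eq_matI) (auto simp: algebra_simps)
      then have "(\<Prod>i = 0..<n. complex_of_real r ^ Suc i) * poly P (of_real (inverse r)) = 0"
        using r det_krylov_smult[of "?Y + complex_of_real (inverse r) \<cdot>\<^sub>m X" d n "complex_of_real r"] X Y nd
        unfolding P[symmetric] by simp
      then show ?thesis using False by simp
    qed simp
  qed
  ultimately show ?thesis by (rule finite_subset[rotated])
qed

lemma det_krylov_measurable:
  assumes nd: "n < d"
  shows "(\<lambda>X. det (krylov_mat n X)) \<in> borel_measurable (mat_borel d)"
proof -
  have "(\<lambda>X. col_krylov n X (\<lambda>s. X $$ (s, n)) k r) \<in> borel_measurable (mat_borel d)" if "r < n" for k r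
    using that
  proof (induction k arbitrary: r)
    case 0
    then show ?case using nd mat_borel_entry[of r d n] by simp
  next
    case (Suc k)
    then show ?case using nd unfolding col_krylov.simps
      by (intro borel_measurable_sum borel_measurable_times mat_borel_entry) auto
  qed
  then show ?thesis unfolding det_krylov_expand
    by (intro borel_measurable_sum borel_measurable_times borel_measurable_prod borel_measurable_const) auto
qed

definition generic_mats :: "nat \<Rightarrow> nat \<Rightarrow> complex mat set" where
  "generic_mats n d = {X \<in> hermitian_mats d. det (krylov_mat n X) \<noteq> 0 \<and>
     (\<forall>i\<in>{n..<d}. \<forall>j\<in>{n..<d}. i \<noteq> j \<longrightarrow> X $$ (i, j) \<noteq> 0)}"

lemma hermitian_gaussian_generic:
  assumes g: "hermitian_gaussian d \<tau> \<mu>" and \<tau>: "\<tau> > 0" and n: "0 < n" "n < d"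
  shows "AE X in \<mu>. X \<in> generic_mats n d"
proof -
  have h: "AE X in \<mu>. X \<in> hermitian_mats d" using g by (simp add: hermitian_gaussian_def)
  have k: "AE X in \<mu>. det (krylov_mat n X) \<noteq> 0"
  proof (rule hermitian_gaussian_AE_nonzero[OF g \<tau> path_mat_hermitian])
    have "path_mat n d $$ (0, n) = 1" using n by (simp add: path_mat_def)
    then show "path_mat n d \<noteq> 0\<^sub>m d d" using n by auto
    show "finite {r :: real. det (krylov_mat n (X + complex_of_real r \<cdot>\<^sub>m path_mat n d)) = 0}"
      if "X \<in> hermitian_mats d" for X
      by (rule finite_zeros_det_krylov[OF hermitian_matsD(1)[OF that] n(2)])
  qed (rule det_krylov_measurable[OF n(2)])
  have e: "AE X in \<mu>. X $$ (i, j) \<noteq> 0" if ij: "i < d" "j < d" "i \<noteq> j" for i j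
  proof -
    \<comment> \<open>Along this direction the entry \<open>(i, j)\<close> becomes that of
      \<open>X\<close> plus the real parameter, which vanishes at most once.\<close>
    define Y where "Y = mat d d (\<lambda>(r, c). if (r, c) = (i, j) \<or> (r, c) = (j, i) then 1 else 0 :: complex)"
    have Y: "Y \<in> carrier_mat d d" by (simp add: Y_def)
    have Yij: "Y $$ (i, j) = 1" using ij by (simp add: Y_def)
    show ?thesis
    proof (rule hermitian_gaussian_AE_nonzero[OF g \<tau>])
      show "Y \<in> hermitian_mats d" by (rule hermitian_matsI) (auto simp: Y_def)
      show "Y \<noteq> 0\<^sub>m d d" using Yij ij by auto
      show "finite {r :: real. (X + complex_of_real r \<cdot>\<^sub>m Y) $$ (i, j) = 0}" if X: "X \<in> hermitian_mats d" for X
      proof (rule finite_subset)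
        show "{r :: real. (X + complex_of_real r \<cdot>\<^sub>m Y) $$ (i, j) = 0} \<subseteq> {- Re (X $$ (i, j))}"
          using ij Y Yij hermitian_matsD(1)[OF X] by (auto simp: complex_eq_iff)
      qed simp
    qed (rule mat_borel_entry[OF ij(1,2)])
  qed
  have "AE X in \<mu>. \<forall>i\<in>{n..<d}. \<forall>j\<in>{n..<d}. i \<noteq> j \<longrightarrow> X $$ (i, j) \<noteq> 0"
    by (intro AE_ball_countable[THEN iffD2] ballI countable_finite) (use e in \<open>auto intro: AE_impI\<close>)
  with h k show ?thesis by eventually_elim (simp add: generic_mats_def)
qed

section \<open>The joint statistics\<close>

abbreviation border_index :: "nat \<Rightarrow> nat \<Rightarrow> nat \<Rightarrow> nat" where
  "border_index d p i \<equiv> d - p + (i - 2)"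

lemma block_eq_lead_mat: "block d p X 1 1 = lead_mat (d - p) X"
  by (rule eq_matI) (auto simp: block_def block_size_def block_start_def select_mat_def)

lemma block_entry_eq:
  assumes "2 \<le> i" "2 \<le> j"
  shows "block_entry d p X i j = X $$ (border_index d p i, border_index d p j)"
  using assms by (simp add: block_entry_def block_def block_size_def block_start_def)

lemma bordered_mat_eq:
  assumes "2 \<le> i"
  shows "bordered_mat d p X i = border_select (d - p) (border_index d p i) X"
  using assms
  by (intro eq_matI) (auto simp: bordered_mat_def block_def block_size_def block_start_def select_mat_def)

lemma cyclic_mat_eq:
  assumes ij: "2 \<le> i" "2 \<le> j"
  shows "cyclic_mat d p X i j = cyclic_select (d - p) (border_index d p i) (border_index d p j) X"
proof (rule eq_matI)
  let ?n = "d - p"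
  have dims: "dim_row (cyclic_mat d p X i j) = ?n + 2" "dim_col (cyclic_mat d p X i j) = ?n + 2"
    by (simp_all add: cyclic_mat_def block_def block_size_def append_rows_def)
  then show "dim_row (cyclic_mat d p X i j) = dim_row (cyclic_select ?n (border_index d p i) (border_index d p j) X)"
    "dim_col (cyclic_mat d p X i j) = dim_col (cyclic_select ?n (border_index d p i) (border_index d p j) X)"
    by (simp_all add: select_mat_def)
  fix a c assume "a < dim_row (cyclic_select ?n (border_index d p i) (border_index d p j) X)"
    "c < dim_col (cyclic_select ?n (border_index d p i) (border_index d p j) X)"
  then have ac: "a < ?n + 2" "c < ?n + 2" by (simp_all add: select_mat_def)
  then have "a < ?n \<or> a = ?n \<or> a = ?n + 1" "c < ?n \<or> c = ?n \<or> c = ?n + 1" by linarith+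
  then show "cyclic_mat d p X i j $$ (a, c) = cyclic_select ?n (border_index d p i) (border_index d p j) X $$ (a, c)"
    using ij
    by (elim disjE) (simp_all add: cyclic_mat_def block_def block_size_def block_start_def append_rows_def select_mat_def)
qed

lemma joint_statistics_eq:
  "joint_statistics d p X =
    (eigenvalue_mset (lead_mat (d - p) X),
     restrict (\<lambda>i. eigenvalue_mset (border_select (d - p) (border_index d p i) X)) {2..p + 1},
     restrict (\<lambda>(i, j). eigenvalue_mset (cyclic_select (d - p) (border_index d p i) (border_index d p j) X)) (index_pairs p),
     restrict (\<lambda>(i, j). X $$ (border_index d p i, border_index d p j) * X $$ (border_index d p j, border_index d p i)) (index_pairs p),
     restrict (\<lambda>(i, j, k). X $$ (border_index d p i, border_index d p j) * X $$ (border_index d p j, border_index d p k)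
       * X $$ (border_index d p k, border_index d p i)) (index_triples p))"
  unfolding joint_statistics_def block_eq_lead_mat
  by (intro arg_cong2[where f=Pair] refl restrict_ext)
    (auto simp: bordered_mat_eq cyclic_mat_eq block_entry_eq index_pairs_def index_triples_def)

lemma border_index_range:
  assumes "1 \<le> p" "p < d" "i \<in> {2..p + 1}"
  shows "border_index d p i \<in> {d - p..<d}"
  using assms by auto

lemma joint_statistics_measurable:
  assumes p: "1 \<le> p" "p < d"
  shows "joint_statistics d p \<in> mat_borel d \<rightarrow>\<^sub>M joint_space p"
proof -
  have ix: "border_index d p i < d" if "i \<in> {2..p + 1}" for i
    using border_index_range[OF p that] by simp
  have "(\<lambda>X. eigenvalue_mset (lead_mat (d - p) X)) \<in> mat_borel d \<rightarrow>\<^sub>M mset_borel"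
    using p by (intro eigenvalue_mset_select_measurable) auto
  moreover have "(\<lambda>X. restrict (\<lambda>i. eigenvalue_mset (border_select (d - p) (border_index d p i) X)) {2..p + 1})
      \<in> mat_borel d \<rightarrow>\<^sub>M PiM {2..p + 1} (\<lambda>_. mset_borel)"
    using p ix by (intro measurable_restrict eigenvalue_mset_select_measurable) (auto split: if_splits)
  moreover have "(\<lambda>X. restrict (\<lambda>(i, j). eigenvalue_mset (cyclic_select (d - p) (border_index d p i) (border_index d p j) X)) (index_pairs p))
      \<in> mat_borel d \<rightarrow>\<^sub>M PiM (index_pairs p) (\<lambda>_. mset_borel)"
    unfolding split_def using p ix
    by (intro measurable_restrict eigenvalue_mset_select_measurable) (auto simp: index_pairs_def split: if_splits)
  moreover have "(\<lambda>X. restrict (\<lambda>(i, j). X $$ (border_index d p i, border_index d p j) * X $$ (border_index d p j, border_index d p i)) (index_pairs p))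
      \<in> mat_borel d \<rightarrow>\<^sub>M PiM (index_pairs p) (\<lambda>_. borel)"
    unfolding split_def
  proof (intro measurable_restrict borel_measurable_times)
    fix z assume "z \<in> index_pairs p"
    then have z: "border_index d p (fst z) < d" "border_index d p (snd z) < d"
      using ix[of "fst z"] ix[of "snd z"] by (auto simp: index_pairs_def)
    show "(\<lambda>X. X $$ (border_index d p (fst z), border_index d p (snd z))) \<in> borel_measurable (mat_borel d)"
      "(\<lambda>X. X $$ (border_index d p (snd z), border_index d p (fst z))) \<in> borel_measurable (mat_borel d)"
      by (rule mat_borel_entry[OF z] mat_borel_entry[OF z(2,1)])+
  qed
  moreover have "(\<lambda>X. restrict (\<lambda>(i, j, k). X $$ (border_index d p i, border_index d p j) * X $$ (border_index d p j, border_index d p k)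
       * X $$ (border_index d p k, border_index d p i)) (index_triples p))
      \<in> mat_borel d \<rightarrow>\<^sub>M PiM (index_triples p) (\<lambda>_. borel)"
    unfolding split_def
  proof (intro measurable_restrict borel_measurable_times)
    fix z assume "z \<in> index_triples p"
    then have z: "border_index d p (fst z) < d" "border_index d p (fst (snd z)) < d" "border_index d p (snd (snd z)) < d"
      using ix[of "fst z"] ix[of "fst (snd z)"] ix[of "snd (snd z)"] by (auto simp: index_triples_def)
    show "(\<lambda>X. X $$ (border_index d p (fst z), border_index d p (fst (snd z)))) \<in> borel_measurable (mat_borel d)"
      "(\<lambda>X. X $$ (border_index d p (fst (snd z)), border_index d p (snd (snd z)))) \<in> borel_measurable (mat_borel d)"
      "(\<lambda>X. X $$ (border_index d p (snd (snd z)), border_index d p (fst z))) \<in> borel_measurable (mat_borel d)"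
      by (rule mat_borel_entry[OF z(1,2)] mat_borel_entry[OF z(2,3)] mat_borel_entry[OF z(3,1)])+
  qed
  ultimately show ?thesis
    unfolding joint_statistics_eq[abs_def] joint_space_def
    by (intro measurable_Pair)
qed

lemma unitary_block_conj_border:
  assumes V: "unitary_block n d V" and X: "X \<in> carrier_mat d d" and n: "n \<le> d"
    and i: "i \<in> {n..<d}" and j: "j \<in> {n..<d}"
  shows "(V * X * mat_adjoint V) $$ (i, j) = V $$ (i, i) * cnj (V $$ (j, j)) * X $$ (i, j)"
    and "V $$ (i, i) * cnj (V $$ (i, i)) = 1"
proof -
  have Vc: "V \<in> carrier_mat d d" and VV: "V * mat_adjoint V = 1\<^sub>m d"
    and V0: "\<And>r c. r < d \<Longrightarrow> c < d \<Longrightarrow> r \<noteq> c \<Longrightarrow> n \<le> r \<or> n \<le> c \<Longrightarrow> V $$ (r, c) = 0"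
    using V by (auto simp: unitary_block_def)
  have ij: "i < d" "j < d" "\<not> i < n" "\<not> j < n" using i j by auto
  have s: "(\<Sum>k<d. V $$ (r, k) * f k) = V $$ (r, r) * f r" if "r < d" "\<not> r < n" for r f
    using unitary_block_sum[OF V0 n that(1)] that(2) by simp
  have sc: "(\<Sum>k<d. cnj (V $$ (r, k)) * f k) = cnj (V $$ (r, r)) * f r" if "r < d" "\<not> r < n" for r f
    using arg_cong[OF s[OF that, of "\<lambda>k. cnj (f k)"], of cnj] by (simp add: cnj_sum)
  show "(V * X * mat_adjoint V) $$ (i, j) = V $$ (i, i) * cnj (V $$ (j, j)) * X $$ (i, j)"
    unfolding unitary_block_conj_index[OF Vc X ij(1,2)] s[OF ij(1,3)] sc[OF ij(2,4)] by (simp only: mult_ac)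
  have "(V * mat_adjoint V) $$ (i, i) = (\<Sum>k<d. V $$ (i, k) * cnj (V $$ (i, k)))"
    using ij Vc mat_adjoint_carrier[OF Vc] by (simp add: scalar_prod_def atLeast0LessThan mat_adjoint_index[OF Vc])
  then show "V $$ (i, i) * cnj (V $$ (i, i)) = 1"
    unfolding VV s[OF ij(1,3)] using ij by simp
qed

text \<open>On border entries the conjugation multiplies by phases, which cancel in the pair and
  triple products because these run around closed cycles of indices. The eigenvalues are unchanged
  because each selected matrix is itself conjugated by a unitary matrix.\<close>

lemma joint_statistics_conj:
  assumes p: "1 \<le> p" "p < d" and V: "unitary_block (d - p) d V" and X: "X \<in> carrier_mat d d"
  shows "joint_statistics d p (V * X * mat_adjoint V) = joint_statistics d p X"
proof -
  let ?Y = "V * X * mat_adjoint V"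
  let ?n = "d - p"
  have nd: "?n \<le> d" by simp
  note conj = char_poly_select_mat_conj[OF V nd X]
  note ent = unitary_block_conj_border[OF V X nd]
  have ix: "border_index d p i \<in> {?n..<d}" if "i \<in> {2..p + 1}" for i
    by (rule border_index_range[OF p that])
  have ixinj: "border_index d p i \<noteq> border_index d p j" if "i \<in> {2..p + 1}" "j \<in> {2..p + 1}" "i \<noteq> j" for i j
    using that by auto
  have "char_poly (lead_mat ?n ?Y) = char_poly (lead_mat ?n X)"
    by (rule conj) auto
  moreover have "char_poly (border_select ?n (border_index d p i) ?Y) = char_poly (border_select ?n (border_index d p i) X)"
    if "i \<in> {2..p + 1}" for i
    by (rule conj) (use ix[OF that] in \<open>auto simp: inj_on_def split: if_splits\<close>)
  moreover have "char_poly (cyclic_select ?n (border_index d p i) (border_index d p j) ?Y)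
      = char_poly (cyclic_select ?n (border_index d p i) (border_index d p j) X)"
    if "(i, j) \<in> index_pairs p" for i j
  proof (rule conj)
    have ij: "i \<in> {2..p + 1}" "j \<in> {2..p + 1}" "i \<noteq> j" using that by (auto simp: index_pairs_def)
    show "inj_on (\<lambda>a. if a < ?n then a else if a = ?n then border_index d p i else border_index d p j) {..<?n + 2}"
      using ix[OF ij(1)] ix[OF ij(2)] ixinj[OF ij] by (auto simp: inj_on_def split: if_splits)
    show "?n \<le> (if a < ?n then a else if a = ?n then border_index d p i else border_index d p j) \<and>
      (if a < ?n then a else if a = ?n then border_index d p i else border_index d p j) < d"
      if "?n \<le> a" "a < ?n + 2" for a
      using ix[OF ij(1)] ix[OF ij(2)] that by auto
  qed auto
  moreover have "?Y $$ (a, b) * ?Y $$ (b, a) = X $$ (a, b) * X $$ (b, a)"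
    if ab: "a \<in> {?n..<d}" "b \<in> {?n..<d}" for a b
  proof -
    have "?Y $$ (a, b) * ?Y $$ (b, a) = (V $$ (a, a) * cnj (V $$ (a, a))) * (V $$ (b, b) * cnj (V $$ (b, b))) * (X $$ (a, b) * X $$ (b, a))"
      unfolding ent(1)[OF ab] ent(1)[OF ab(2,1)] by (simp only: mult_ac)
    then show ?thesis unfolding ent(2)[OF ab(1,1)] ent(2)[OF ab(2,2)] by simp
  qed
  moreover have "?Y $$ (a, b) * ?Y $$ (b, c) * ?Y $$ (c, a) = X $$ (a, b) * X $$ (b, c) * X $$ (c, a)"
    if abc: "a \<in> {?n..<d}" "b \<in> {?n..<d}" "c \<in> {?n..<d}" for a b c
  proof -
    have "?Y $$ (a, b) * ?Y $$ (b, c) * ?Y $$ (c, a) = (V $$ (a, a) * cnj (V $$ (a, a))) * (V $$ (b, b) * cnj (V $$ (b, b)))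
        * (V $$ (c, c) * cnj (V $$ (c, c))) * (X $$ (a, b) * X $$ (b, c) * X $$ (c, a))"
      unfolding ent(1)[OF abc(1,2)] ent(1)[OF abc(2,3)] ent(1)[OF abc(3,1)] by (simp only: mult_ac)
    then show ?thesis unfolding ent(2)[OF abc(1,1)] ent(2)[OF abc(2,2)] ent(2)[OF abc(3,3)] by simp
  qed
  ultimately show ?thesis
    unfolding joint_statistics_eq eigenvalue_mset_def
    by (intro arg_cong2[where f=Pair] restrict_ext)
      (use ix in \<open>auto simp: index_pairs_def index_triples_def simp del: assoc_mult_mat atLeastLessThan_iff\<close>)
qed

text \<open>The statistics as one continuous map between countable products of the complex plane:
  matrices become arrays of entries, a type with a complete separable topology, and multisets of
  eigenvalues become values of characteristic polynomials at natural numbers. The tag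
  \<open>t\<close> selects the kind of statistic; \<open>k\<close> is the evaluation point for tags
  0, 1, 2 and a matrix index for tag 4.\<close>

definition stat_fun :: "nat \<Rightarrow> nat \<Rightarrow> (nat \<times> nat \<Rightarrow> complex) \<Rightarrow> nat \<times> nat \<times> nat \<times> nat \<Rightarrow> complex" where
  "stat_fun n d x = (\<lambda>(t, i, j, k).
     if t = 0 then poly (char_poly (lead_mat n (mat d d x))) (of_nat k)
     else if t = 1 \<and> i \<in> {n..<d} then poly (char_poly (border_select n i (mat d d x))) (of_nat k)
     else if t = 2 \<and> i \<in> {n..<d} \<and> j \<in> {n..<d} \<and> i \<noteq> j then poly (char_poly (cyclic_select n i j (mat d d x))) (of_nat k)
     else if t = 3 \<and> i \<in> {n..<d} \<and> j \<in> {n..<d} \<and> i \<noteq> j then x (i, j) * x (j, i)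
     else if t = 4 \<and> i \<in> {n..<d} \<and> j \<in> {n..<d} \<and> k \<in> {n..<d} \<and> i \<noteq> j \<and> j \<noteq> k \<and> i \<noteq> k then x (i, j) * x (j, k) * x (k, i)
     else 0)"

lemma continuous_on_if_const:
  assumes "c \<Longrightarrow> continuous_on S f" "\<not> c \<Longrightarrow> continuous_on S g"
  shows "continuous_on S (\<lambda>x. if c then f x else g x)"
  using assms by (cases c) auto

lemma continuous_char_poly_select_mat:
  assumes "\<And>a. a < m \<Longrightarrow> \<sigma> a < d"
  shows "continuous_on UNIV (\<lambda>x. poly (char_poly (select_mat m \<sigma> P (mat d d x))) z)"
  unfolding poly_char_poly_select_mat
proof (intro continuous_on_sum continuous_on_mult continuous_on_prod continuous_on_diff continuous_on_const)
  fix p i assume "p \<in> {p. p permutes {0..<m}}" "i \<in> {0..<m}"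
  then have "i < m" "p i < m" using permutes_in_image[of p "{0..<m}" i] by auto
  then have \<sigma>: "\<sigma> i < d" "\<sigma> (p i) < d" using assms by auto
  show "continuous_on UNIV (\<lambda>x. if P i (p i) then mat d d x $$ (\<sigma> i, \<sigma> (p i)) else 0)"
  proof (rule continuous_on_if_const)
    have "(\<lambda>x. mat d d x $$ (\<sigma> i, \<sigma> (p i))) = (\<lambda>x. x (\<sigma> i, \<sigma> (p i)))"
      using \<sigma> by (intro ext) simp
    then show "continuous_on UNIV (\<lambda>x. mat d d x $$ (\<sigma> i, \<sigma> (p i)))"
      by (rule ssubst) (rule continuous_on_product_coordinates)
  qed (rule continuous_on_const)
qed

lemma continuous_stat_fun:
  assumes n: "n \<le> d"
  shows "continuous_on UNIV (stat_fun n d)"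
proof (rule continuous_on_coordinatewise_then_product)
  fix \<iota> :: "nat \<times> nat \<times> nat \<times> nat"
  obtain t i j k where \<iota>: "\<iota> = (t, i, j, k)" by (cases \<iota>)
  have c: "continuous_on UNIV (\<lambda>x :: nat \<times> nat \<Rightarrow> complex. x ab)" for ab
    by (rule continuous_on_product_coordinates)
  show "continuous_on UNIV (\<lambda>x. stat_fun n d x \<iota>)"
    unfolding stat_fun_def \<iota> prod.case
    by (intro continuous_on_if_const continuous_char_poly_select_mat continuous_on_mult c continuous_on_const)
      (use n in \<open>auto split: if_splits\<close>)
qed
text \<open>The same data read from the joint state, so that a Borel function of
  \<open>stat_fun\<close> becomes a measurable function of the joint process. The shift
  \<open>i - n + 2\<close> converts a matrix index back to the block index.\<close>

definition stat_state :: "nat \<Rightarrow> nat \<Rightarrow> joint_state \<Rightarrow> nat \<times> nat \<times> nat \<times> nat \<Rightarrow> complex" where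
  "stat_state n d st = (\<lambda>(t, i, j, k).
     if t = 0 then (\<Prod>z\<in>#fst st. of_nat k - z)
     else if t = 1 \<and> i \<in> {n..<d} then (\<Prod>z\<in>#fst (snd st) (i - n + 2). of_nat k - z)
     else if t = 2 \<and> i \<in> {n..<d} \<and> j \<in> {n..<d} \<and> i \<noteq> j then (\<Prod>z\<in>#fst (snd (snd st)) (i - n + 2, j - n + 2). of_nat k - z)
     else if t = 3 \<and> i \<in> {n..<d} \<and> j \<in> {n..<d} \<and> i \<noteq> j then fst (snd (snd (snd st))) (i - n + 2, j - n + 2)
     else if t = 4 \<and> i \<in> {n..<d} \<and> j \<in> {n..<d} \<and> k \<in> {n..<d} \<and> i \<noteq> j \<and> j \<noteq> k \<and> i \<noteq> k
       then snd (snd (snd (snd st))) (i - n + 2, j - n + 2, k - n + 2)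
     else 0)"

lemma borel_measurable_if_const:
  assumes "c \<Longrightarrow> f \<in> borel_measurable N" "\<not> c \<Longrightarrow> g \<in> borel_measurable N"
  shows "(\<lambda>x. if c then f x else g x) \<in> borel_measurable N"
  using assms by (cases c) auto

lemma stat_state_measurable:
  assumes p: "p < d"
  shows "stat_state (d - p) d \<in> joint_space p \<rightarrow>\<^sub>M borel"
proof (rule measurable_coordinatewise_then_product)
  fix \<iota> :: "nat \<times> nat \<times> nat \<times> nat"
  obtain t i j k where \<iota>: "\<iota> = (t, i, j, k)" by (cases \<iota>)
  let ?n = "d - p"
  have J: "joint_space p = mset_borel \<Otimes>\<^sub>M PiM {2..p + 1} (\<lambda>_. mset_borel) \<Otimes>\<^sub>M PiM (index_pairs p) (\<lambda>_. mset_borel) \<Otimes>\<^sub>M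
     PiM (index_pairs p) (\<lambda>_. borel) \<Otimes>\<^sub>M PiM (index_triples p) (\<lambda>_. borel)"
    by (rule joint_space_def)
  have pm: "(\<lambda>m. \<Prod>z\<in>#m. of_nat k - z) \<in> borel_measurable mset_borel"
    by (rule prod_mset_measurable) measurable
  have m0: "fst \<in> joint_space p \<rightarrow>\<^sub>M mset_borel" unfolding J by measurable
  have m1: "(\<lambda>st. fst (snd st)) \<in> joint_space p \<rightarrow>\<^sub>M PiM {2..p + 1} (\<lambda>_. mset_borel)" unfolding J by measurable
  have m2: "(\<lambda>st. fst (snd (snd st))) \<in> joint_space p \<rightarrow>\<^sub>M PiM (index_pairs p) (\<lambda>_. mset_borel)" unfolding J by measurable
  have m3: "(\<lambda>st. fst (snd (snd (snd st)))) \<in> joint_space p \<rightarrow>\<^sub>M PiM (index_pairs p) (\<lambda>_. borel)" unfolding J by measurable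
  have m4: "(\<lambda>st. snd (snd (snd (snd st)))) \<in> joint_space p \<rightarrow>\<^sub>M PiM (index_triples p) (\<lambda>_. borel)" unfolding J by measurable
  show "(\<lambda>st. stat_state ?n d st \<iota>) \<in> borel_measurable (joint_space p)"
    unfolding stat_state_def \<iota> prod.case
  proof (intro borel_measurable_if_const borel_measurable_const)
    show "(\<lambda>st. \<Prod>z\<in>#fst st. of_nat k - z) \<in> borel_measurable (joint_space p)"
      by (rule measurable_compose[OF m0 pm])
    show "(\<lambda>st. \<Prod>z\<in>#fst (snd st) (i - ?n + 2). of_nat k - z) \<in> borel_measurable (joint_space p)"
      if "t = 1 \<and> i \<in> {?n..<d}"
      by (rule measurable_compose[OF measurable_compose[OF m1 measurable_component_singleton] pm]) (use that p in auto)
    show "(\<lambda>st. \<Prod>z\<in>#fst (snd (snd st)) (i - ?n + 2, j - ?n + 2). of_nat k - z) \<in> borel_measurable (joint_space p)"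
      if "t = 2 \<and> i \<in> {?n..<d} \<and> j \<in> {?n..<d} \<and> i \<noteq> j"
      by (rule measurable_compose[OF measurable_compose[OF m2 measurable_component_singleton] pm]) (use that p in \<open>auto simp: index_pairs_def\<close>)
    show "(\<lambda>st. fst (snd (snd (snd st))) (i - ?n + 2, j - ?n + 2)) \<in> borel_measurable (joint_space p)"
      if "t = 3 \<and> i \<in> {?n..<d} \<and> j \<in> {?n..<d} \<and> i \<noteq> j"
      by (rule measurable_compose[OF m3 measurable_component_singleton]) (use that p in \<open>auto simp: index_pairs_def\<close>)
    show "(\<lambda>st. snd (snd (snd (snd st))) (i - ?n + 2, j - ?n + 2, k - ?n + 2)) \<in> borel_measurable (joint_space p)"
      if "t = 4 \<and> i \<in> {?n..<d} \<and> j \<in> {?n..<d} \<and> k \<in> {?n..<d} \<and> i \<noteq> j \<and> j \<noteq> k \<and> i \<noteq> k"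
      by (rule measurable_compose[OF m4 measurable_component_singleton]) (use that p in \<open>auto simp: index_triples_def\<close>)
  qed
qed

definition mat_entries :: "nat \<Rightarrow> complex mat \<Rightarrow> nat \<times> nat \<Rightarrow> complex" where
  "mat_entries d X = (\<lambda>(i, j). if i < d \<and> j < d then X $$ (i, j) else 0)"

lemma mat_entries_measurable: "mat_entries d \<in> mat_borel d \<rightarrow>\<^sub>M borel"
proof (rule measurable_coordinatewise_then_product)
  fix \<iota> :: "nat \<times> nat"
  show "(\<lambda>X. mat_entries d X \<iota>) \<in> borel_measurable (mat_borel d)"
    unfolding mat_entries_def split_def
    by (intro borel_measurable_if_const borel_measurable_const mat_borel_entry) auto
qed

lemma mat_of_entries_measurable: "(\<lambda>x. mat d d x) \<in> borel \<rightarrow>\<^sub>M mat_borel d"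
proof (rule measurable_mat_borelI)
  fix i j assume "i < d" "j < d"
  then have eq: "(\<lambda>x :: nat \<times> nat \<Rightarrow> complex. mat d d x $$ (i, j)) = (\<lambda>x. x (i, j))" by (intro ext) simp
  show "(\<lambda>x :: nat \<times> nat \<Rightarrow> complex. mat d d x $$ (i, j)) \<in> borel_measurable borel"
    unfolding eq by (intro borel_measurable_continuous_onI continuous_on_product_coordinates)
qed simp

lemma mat_of_mat_entries: "X \<in> carrier_mat d d \<Longrightarrow> mat d d (mat_entries d X) = X"
  by (intro eq_matI) (auto simp: mat_entries_def)

lemma stat_state_joint_statistics:
  assumes p: "1 \<le> p" "p < d" and X: "X \<in> carrier_mat d d"
  shows "stat_state (d - p) d (joint_statistics d p X) = stat_fun (d - p) d (mat_entries d X)"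
proof
  fix \<iota> :: "nat \<times> nat \<times> nat \<times> nat"
  obtain t i j k where \<iota>: "\<iota> = (t, i, j, k)" by (cases \<iota>)
  let ?n = "d - p"
  have ix: "border_index d p (a - ?n + 2) = a" "a - ?n + 2 \<in> {2..p + 1}" if "a \<in> {?n..<d}" for a
    using that p by auto
  note ev = poly_char_poly_eq_prod_mset[OF select_mat_carrier, symmetric]
  show "stat_state ?n d (joint_statistics d p X) \<iota> = stat_fun ?n d (mat_entries d X) \<iota>"
    unfolding stat_state_def stat_fun_def \<iota> prod.case mat_of_mat_entries[OF X]
  proof (intro if_cong refl)
    show "(\<Prod>z\<in>#fst (joint_statistics d p X). of_nat k - z) = poly (char_poly (lead_mat ?n X)) (of_nat k)"
      unfolding joint_statistics_eq fst_conv by (rule ev)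
    show "(\<Prod>z\<in>#fst (snd (joint_statistics d p X)) (i - ?n + 2). of_nat k - z) = poly (char_poly (border_select ?n i X)) (of_nat k)"
      if "t = 1 \<and> i \<in> {?n..<d}"
    proof -
      have i: "i \<in> {?n..<d}" using that by simp
      show ?thesis unfolding joint_statistics_eq fst_conv snd_conv restrict_apply'[OF ix(2)[OF i]] ix(1)[OF i] by (rule ev)
    qed
    show "(\<Prod>z\<in>#fst (snd (snd (joint_statistics d p X))) (i - ?n + 2, j - ?n + 2). of_nat k - z)
        = poly (char_poly (cyclic_select ?n i j X)) (of_nat k)"
      if "t = 2 \<and> i \<in> {?n..<d} \<and> j \<in> {?n..<d} \<and> i \<noteq> j"
    proof -
      have ij: "i \<in> {?n..<d}" "j \<in> {?n..<d}" using that by auto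
      have mem: "(i - ?n + 2, j - ?n + 2) \<in> index_pairs p" using that p by (auto simp: index_pairs_def)
      show ?thesis unfolding joint_statistics_eq fst_conv snd_conv restrict_apply'[OF mem] prod.case ix(1)[OF ij(1)] ix(1)[OF ij(2)] by (rule ev)
    qed
    show "fst (snd (snd (snd (joint_statistics d p X)))) (i - ?n + 2, j - ?n + 2) = mat_entries d X (i, j) * mat_entries d X (j, i)"
      if "t = 3 \<and> i \<in> {?n..<d} \<and> j \<in> {?n..<d} \<and> i \<noteq> j"
    proof -
      have ij: "i \<in> {?n..<d}" "j \<in> {?n..<d}" using that by auto
      have mem: "(i - ?n + 2, j - ?n + 2) \<in> index_pairs p" using that p by (auto simp: index_pairs_def)
      show ?thesis unfolding joint_statistics_eq fst_conv snd_conv restrict_apply'[OF mem] prod.case ix(1)[OF ij(1)] ix(1)[OF ij(2)]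
        using ij by (simp add: mat_entries_def)
    qed
    show "snd (snd (snd (snd (joint_statistics d p X)))) (i - ?n + 2, j - ?n + 2, k - ?n + 2)
        = mat_entries d X (i, j) * mat_entries d X (j, k) * mat_entries d X (k, i)"
      if "t = 4 \<and> i \<in> {?n..<d} \<and> j \<in> {?n..<d} \<and> k \<in> {?n..<d} \<and> i \<noteq> j \<and> j \<noteq> k \<and> i \<noteq> k"
    proof -
      have ij: "i \<in> {?n..<d}" "j \<in> {?n..<d}" "k \<in> {?n..<d}" using that by auto
      have mem: "(i - ?n + 2, j - ?n + 2, k - ?n + 2) \<in> index_triples p" using that p by (auto simp: index_triples_def)
      show ?thesis unfolding joint_statistics_eq fst_conv snd_conv restrict_apply'[OF mem] prod.case ix(1)[OF ij(1)] ix(1)[OF ij(2)] ix(1)[OF ij(3)]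
        using ij by (simp add: mat_entries_def)
    qed
  qed
qed

lemma stat_fun_eq_imp_conj:
  assumes p: "1 \<le> p" "p < d"
    and x: "mat d d x \<in> generic_mats (d - p) d" and y: "mat d d y \<in> generic_mats (d - p) d"
    and eq: "stat_fun (d - p) d x = stat_fun (d - p) d y"
  shows "\<exists>V. unitary_block (d - p) d V \<and> mat d d y = V * mat d d x * mat_adjoint V"
proof -
  let ?n = "d - p" and ?X = "mat d d x" and ?Y = "mat d d y"
  have e: "stat_fun ?n d x (t, i, j, k) = stat_fun ?n d y (t, i, j, k)" for t i j k using eq by simp
  have n: "0 < ?n" "?n < d" using p by auto
  show ?thesis
  proof (rule separation[OF n])
    show "char_poly (lead_mat ?n ?X) = char_poly (lead_mat ?n ?Y)"
      by (rule poly_eqI_of_nat) (use e[of 0] in \<open>simp add: stat_fun_def\<close>)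
    show "char_poly (border_select ?n i ?X) = char_poly (border_select ?n i ?Y)" if "i \<in> {?n..<d}" for i
      by (rule poly_eqI_of_nat) (use e[of 1 i] that in \<open>simp add: stat_fun_def\<close>)
    show "char_poly (cyclic_select ?n i j ?X) = char_poly (cyclic_select ?n i j ?Y)"
      if "i \<in> {?n..<d}" "j \<in> {?n..<d}" "i \<noteq> j" for i j
      by (rule poly_eqI_of_nat) (use e[of 2 i j] that in \<open>simp add: stat_fun_def\<close>)
    show "?X $$ (i, j) * ?X $$ (j, i) = ?Y $$ (i, j) * ?Y $$ (j, i)"
      if "i \<in> {?n..<d}" "j \<in> {?n..<d}" "i \<noteq> j" for i j
      using e[of 3 i j 0] that by (simp add: stat_fun_def)
    show "?X $$ (i, j) * ?X $$ (j, k) * ?X $$ (k, i) = ?Y $$ (i, j) * ?Y $$ (j, k) * ?Y $$ (k, i)"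
      if "i \<in> {?n..<d}" "j \<in> {?n..<d}" "k \<in> {?n..<d}" "i \<noteq> j" "j \<noteq> k" "i \<noteq> k" for i j k
      using e[of 4 i j k] that by (simp add: stat_fun_def)
  qed (use x y in \<open>auto simp: generic_mats_def\<close>)
qed

section \<open>Almost sure factorisation of functions constant on fibres\<close>

text \<open>The image of a Borel set under \<open>F\<close> need not be Borel, but up to a null set \<open>S\<close> is a countable
  union of compact sets, and their images are compact.\<close>

lemma saturated_set_AE_vimage:
  fixes \<mu> :: "'x::{second_countable_topology, complete_space} measure" and F :: "'x \<Rightarrow> 'y::t2_space"
  assumes fm: "finite_measure \<mu>" and s: "sets \<mu> = sets borel" and F: "continuous_on UNIV F"
    and \<Omega>: "AE x in \<mu>. x \<in> \<Omega>" and S: "S \<in> sets borel"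
    and sat: "\<And>x y. x \<in> S \<Longrightarrow> x \<in> \<Omega> \<Longrightarrow> y \<in> \<Omega> \<Longrightarrow> F x = F y \<Longrightarrow> y \<in> S"
  shows "\<exists>T\<in>sets borel. AE x in \<mu>. x \<in> S \<longleftrightarrow> F x \<in> T"
proof -
  interpret finite_measure \<mu> by fact
  have sp: "space \<mu> = UNIV" using sets_eq_imp_space_eq[OF s] by simp
  obtain N where N: "N \<in> null_sets \<mu>" "{x \<in> space \<mu>. x \<notin> \<Omega>} \<subseteq> N"
    using \<Omega> by (auto simp: eventually_ae_filter)
  \<comment> \<open>\<open>N\<close> contains every point outside \<Omega>, so \<open>S0\<close>
    lies in \<Omega> and \<open>sat\<close> applies to all points of its compact subsets.\<close>
  define S0 where "S0 = S - N"
  have S0: "S0 \<in> sets borel" unfolding S0_def using S N(1) s by (auto dest: null_setsD2)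
  have "emeasure \<mu> S0 = (SUP K \<in> {K. K \<subseteq> S0 \<and> compact K}. emeasure \<mu> K)"
    using inner_regular[OF s _ S0] emeasure_finite by simp
  have ex: "\<exists>K. K \<subseteq> S0 \<and> compact K \<and> measure \<mu> S0 < measure \<mu> K + 1 / real (Suc m)" for m
  proof (rule ccontr)
    assume neg: "\<not> ?thesis"
    have "emeasure \<mu> K \<le> ennreal (measure \<mu> S0 - 1 / real (Suc m))" if "K \<subseteq> S0" "compact K" for K
      using neg that by (auto simp: emeasure_eq_measure not_less intro!: ennreal_leI)
    then have "emeasure \<mu> S0 \<le> ennreal (measure \<mu> S0 - 1 / real (Suc m))"
      unfolding \<open>emeasure \<mu> S0 = _\<close> by (intro SUP_least) auto
    then have "ennreal (measure \<mu> S0) \<le> ennreal (measure \<mu> S0 - 1 / real (Suc m))"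
      by (simp add: emeasure_eq_measure)
    \<comment> \<open>The empty set is one of the compact sets, and it shows that the difference is
      nonnegative; only then does the inequality in \<open>ennreal\<close> say the same as the one
      between reals.\<close>
    moreover have "measure \<mu> S0 - 1 / real (Suc m) \<ge> 0"
      using neg[unfolded not_ex, rule_format, of "{}"] by (simp add: not_less)
    ultimately show False by (simp add: ennreal_le_iff)
  qed
  then obtain K where K: "\<And>m. K m \<subseteq> S0" "\<And>m. compact (K m)" "\<And>m. measure \<mu> S0 < measure \<mu> (K m) + 1 / real (Suc m)"
    by metis
  define T where "T = (\<Union>m. F ` K m)"
  have "compact (F ` K m)" for m
    by (intro compact_continuous_image continuous_on_subset[OF F] K(2)) auto
  then have T: "T \<in> sets borel" unfolding T_def by (intro sets.countable_UN) (auto intro: borel_compact)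
  have Km: "K m \<in> sets \<mu>" for m using K(2)[of m] s by (simp add: borel_compact)
  have D: "S0 - (\<Union>m. K m) \<in> sets \<mu>" using S0 Km s by auto
  have "measure \<mu> (S0 - (\<Union>m. K m)) \<le> 1 / real (Suc m)" for m
  proof -
    have "measure \<mu> (S0 - (\<Union>m. K m)) \<le> measure \<mu> (S0 - K m)"
      using S0 Km s by (intro finite_measure_mono) auto
    also have "\<dots> = measure \<mu> S0 - measure \<mu> (K m)"
      using S0 Km K(1) s by (intro finite_measure_Diff) auto
    finally show ?thesis using K(3)[of m] by simp
  qed
  then have "measure \<mu> (S0 - (\<Union>m. K m)) \<le> 0"
    by (intro LIMSEQ_le_const[OF LIMSEQ_inverse_real_of_nat] exI[of _ 0]) (simp add: inverse_eq_divide)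
  then have "S0 - (\<Union>m. K m) \<in> null_sets \<mu>"
    using D by (simp add: null_sets_def emeasure_eq_measure measure_le_0_iff)
  then have "AE x in \<mu>. x \<notin> S0 - (\<Union>m. K m)" by (rule AE_not_in)
  moreover have "AE x in \<mu>. x \<notin> N" using N(1) by (rule AE_not_in)
  ultimately have "AE x in \<mu>. x \<in> S \<longleftrightarrow> F x \<in> T"
  proof eventually_elim
    fix x assume x: "x \<notin> S0 - (\<Union>m. K m)" "x \<notin> N"
    have x\<Omega>: "x \<in> \<Omega>" using N(2) x(2) sp by auto
    show "x \<in> S \<longleftrightarrow> F x \<in> T"
    proof
      assume "x \<in> S"
      then show "F x \<in> T" using x by (auto simp: S0_def T_def)
    next
      assume "F x \<in> T"
      then obtain m y where y: "y \<in> K m" "F x = F y" by (auto simp: T_def)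
      then have "y \<in> S" "y \<notin> N" using K(1)[of m] by (auto simp: S0_def)
      moreover from this have "y \<in> \<Omega>" using N(2) sp by auto
      ultimately show "x \<in> S" using sat[of y x] x\<Omega> y(2) by simp
    qed
  qed
  with T show ?thesis by blast
qed

text \<open>The superlevel sets of \<open>h\<close> at rational levels are saturated, so each is
  almost surely the preimage of a Borel set under \<open>F\<close>. These countably many sets share
  one null set, and \<open>g\<close> is rebuilt as the supremum of the levels whose set contains the
  point; density of the rationals gives \<open>h \<le> g\<close>. Negative rationals merely repeat
  level 0.\<close>

lemma saturated_fun_AE_factor:
  fixes \<mu> :: "'x::{second_countable_topology, complete_space} measure" and F :: "'x \<Rightarrow> 'y::t2_space"
    and h :: "'x \<Rightarrow> ennreal"
  assumes fm: "finite_measure \<mu>" and s: "sets \<mu> = sets borel" and F: "continuous_on UNIV F"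
    and \<Omega>: "AE x in \<mu>. x \<in> \<Omega>" and h: "h \<in> borel_measurable borel"
    and sat: "\<And>x y. x \<in> \<Omega> \<Longrightarrow> y \<in> \<Omega> \<Longrightarrow> F x = F y \<Longrightarrow> h x = h y"
  shows "\<exists>g\<in>borel_measurable borel. AE x in \<mu>. h x = g (F x)"
proof -
  define e where "e q = ennreal (real_of_rat q)" for q
  have "\<exists>T\<in>sets borel. AE x in \<mu>. x \<in> {x. e q \<le> h x} \<longleftrightarrow> F x \<in> T" for q
  proof (rule saturated_set_AE_vimage[OF fm s F \<Omega>])
    have "h -` {e q..} \<inter> space borel \<in> sets borel" by (rule measurable_sets[OF h]) simp
    then show "{x. e q \<le> h x} \<in> sets borel" by (simp add: vimage_def)
    fix x y assume "x \<in> {x. e q \<le> h x}" and xy: "x \<in> \<Omega>" "y \<in> \<Omega>" "F x = F y"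
    then show "y \<in> {x. e q \<le> h x}" unfolding sat[OF xy] mem_Collect_eq by simp
  qed
  then obtain T where T: "\<And>q. T q \<in> sets borel" "\<And>q. AE x in \<mu>. e q \<le> h x \<longleftrightarrow> F x \<in> T q"
    by (simp only: mem_Collect_eq) metis
  define g where "g y = (SUP q. e q * indicator (T q) y)" for y
  have "g \<in> borel_measurable borel"
    unfolding g_def[abs_def] using T(1) by (intro borel_measurable_SUP borel_measurable_times) auto
  moreover have "AE x in \<mu>. \<forall>q. e q \<le> h x \<longleftrightarrow> F x \<in> T q"
    using T(2) by (simp add: AE_all_countable)
  then have "AE x in \<mu>. h x = g (F x)"
  proof eventually_elim
    fix x assume x: "\<forall>q. e q \<le> h x \<longleftrightarrow> F x \<in> T q"
    have "h x \<le> g (F x)"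
    proof (rule ccontr)
      assume "\<not> h x \<le> g (F x)"
      then have "g (F x) < h x" by simp
      from ennreal_rat_dense[OF this] obtain q where q: "g (F x) < e q" "e q < h x"
        unfolding e_def by blast
      then have "F x \<in> T q" using x by (auto intro: less_imp_le)
      then have "e q \<le> g (F x)" unfolding g_def by (intro SUP_upper2[of q]) auto
      with q(1) show False by simp
    qed
    moreover have "g (F x) \<le> h x"
      unfolding g_def using x by (intro SUP_least) (auto simp: indicator_def)
    ultimately show "h x = g (F x)" by (rule antisym)
  qed
  ultimately show ?thesis by blast
qed

section \<open>Filtrations, the transition kernel and the Markov property\<close>

lemma space_natural_filtration [simp]: "space (natural_filtration M S X s) = space M"
  unfolding natural_filtration_def by (rule space_measure_of) auto

lemma sets_natural_filtration:
  "sets (natural_filtration M S X s) = sigma_sets (space M) {X u -` A \<inter> space M | u A. 0 \<le> u \<and> u \<le> s \<and> A \<in> sets S}"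
  unfolding natural_filtration_def by (rule sets_measure_of) auto

lemma natural_filtration_measurable:
  assumes "X u \<in> M \<rightarrow>\<^sub>M S" "0 \<le> u" "u \<le> s"
  shows "X u \<in> natural_filtration M S X s \<rightarrow>\<^sub>M S"
proof (rule measurableI)
  show "X u \<omega> \<in> space S" if "\<omega> \<in> space (natural_filtration M S X s)" for \<omega>
    using measurable_space[OF assms(1)] that by simp
  show "X u -` A \<inter> space (natural_filtration M S X s) \<in> sets (natural_filtration M S X s)" if "A \<in> sets S" for A
    unfolding sets_natural_filtration space_natural_filtration using assms that by (intro sigma_sets.Basic) auto
qed

lemma natural_filtration_subalgebra:
  assumes "\<And>u. 0 \<le> u \<Longrightarrow> X u \<in> M \<rightarrow>\<^sub>M S"
  shows "subalgebra M (natural_filtration M S X s)"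
  unfolding subalgebra_def sets_natural_filtration space_natural_filtration
  by (intro conjI refl sets.sigma_sets_subset) (auto intro: measurable_sets[OF assms])

text \<open>The past of the statistics lies in the past of \<open>B\<close>, so identities tested on
  events of the latter hold in particular on events of the former.\<close>

lemma natural_filtration_compose_subset:
  assumes X: "\<And>u. 0 \<le> u \<Longrightarrow> X u \<in> M \<rightarrow>\<^sub>M S" and f: "f \<in> S \<rightarrow>\<^sub>M S'"
  shows "sets (natural_filtration M S' (\<lambda>t \<omega>. f (X t \<omega>)) s) \<subseteq> sets (natural_filtration M S X s)"
proof -
  have "{(\<lambda>\<omega>. f (X u \<omega>)) -` A \<inter> space M | u A. 0 \<le> u \<and> u \<le> s \<and> A \<in> sets S'} \<subseteq> sets (natural_filtration M S X s)"
  proof safe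
    fix u A assume u: "0 \<le> u" "u \<le> s" and A: "A \<in> sets S'"
    have "X u \<in> natural_filtration M S X s \<rightarrow>\<^sub>M S" by (rule natural_filtration_measurable[of X, OF X[OF u(1)] u])
    from measurable_sets[OF measurable_compose[OF this f] A]
    show "(\<lambda>\<omega>. f (X u \<omega>)) -` A \<inter> space M \<in> sets (natural_filtration M S X s)" by simp
  qed
  then have "sigma_sets (space (natural_filtration M S X s)) {(\<lambda>\<omega>. f (X u \<omega>)) -` A \<inter> space M | u A. 0 \<le> u \<and> u \<le> s \<and> A \<in> sets S'}
    \<subseteq> sets (natural_filtration M S X s)" by (rule sets.sigma_sets_subset)
  then show ?thesis by (simp add: sets_natural_filtration)
qed

text \<open>The transition kernel of \<open>B\<close> from the matrix \<open>X\<close> into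
  \<open>A\<close>, when \<nu> is the law of the increment.\<close>

definition shifted_prob :: "complex mat measure \<Rightarrow> complex mat set \<Rightarrow> complex mat \<Rightarrow> ennreal" where
  "shifted_prob \<nu> A X = (\<integral>\<^sup>+Y. indicator A (X + Y) \<partial>\<nu>)"

lemma measurable_mat_plus_pair:
  "(\<lambda>z. fst z + snd z) \<in> mat_borel d \<Otimes>\<^sub>M mat_borel d \<rightarrow>\<^sub>M mat_borel d"
  by (intro measurable_mat_borel_add measurable_fst measurable_snd)

lemma shifted_prob_measurable:
  assumes "prob_space \<nu>" and s: "sets \<nu> = sets (mat_borel d)" and A: "A \<in> sets (mat_borel d)"
  shows "shifted_prob \<nu> A \<in> borel_measurable (mat_borel d)"
proof -
  interpret prob_space \<nu> by fact
  have "(\<lambda>z. indicator A (fst z + snd z) :: ennreal) \<in> borel_measurable (mat_borel d \<Otimes>\<^sub>M mat_borel d)"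
    by (rule measurable_compose[OF measurable_mat_plus_pair borel_measurable_indicator[OF A]])
  then have "(\<lambda>z. indicator A (fst z + snd z) :: ennreal) \<in> borel_measurable (mat_borel d \<Otimes>\<^sub>M \<nu>)"
    unfolding measurable_cong_sets[OF sets_pair_measure_cong[OF refl s] refl] .
  from borel_measurable_nn_integral_fst[OF this] show ?thesis
    unfolding shifted_prob_def[abs_def] by simp
qed

text \<open>The law \<nu> is invariant under conjugation by \<open>V\<close>, so the integration
  variable may be conjugated along with \<open>X\<close>. Conjugation is additive, hence acts on the
  sum, and \<open>A\<close> does not notice it.\<close>

lemma shifted_prob_conj:
  assumes g: "hermitian_gaussian d \<tau> \<nu>" and A: "A \<in> sets (mat_borel d)" and X: "X \<in> carrier_mat d d"
    and V: "V \<in> carrier_mat d d" "V * mat_adjoint V = 1\<^sub>m d"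
    and inv: "\<And>Y. Y \<in> carrier_mat d d \<Longrightarrow> V * Y * mat_adjoint V \<in> A \<longleftrightarrow> Y \<in> A"
  shows "shifted_prob \<nu> A (V * X * mat_adjoint V) = shifted_prob \<nu> A X"
proof -
  let ?W = "mat_adjoint V" and ?T = "\<lambda>Y. V * Y * mat_adjoint V"
  have W: "?W \<in> carrier_mat d d" by (rule mat_adjoint_carrier[OF V(1)])
  have p: "prob_space \<nu>" and s: "sets \<nu> = sets (mat_borel d)" using g by (auto simp: hermitian_gaussian_def)
  have Tm: "?T \<in> mat_borel d \<rightarrow>\<^sub>M mat_borel d"
  proof (rule measurable_mat_borelI)
    fix i j assume ij: "i < d" "j < d"
    show "(\<lambda>Y. ?T Y $$ (i, j)) \<in> borel_measurable (mat_borel d)"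
    proof (rule measurable_cong[THEN iffD2])
      show "?T Y $$ (i, j) = (\<Sum>k<d. V $$ (i, k) * (\<Sum>l<d. cnj (V $$ (j, l)) * Y $$ (k, l)))"
        if "Y \<in> space (mat_borel d)" for Y
        using that by (intro unitary_block_conj_index[OF V(1) _ ij]) simp
      show "(\<lambda>Y. \<Sum>k<d. V $$ (i, k) * (\<Sum>l<d. cnj (V $$ (j, l)) * Y $$ (k, l))) \<in> borel_measurable (mat_borel d)"
        by (intro borel_measurable_sum borel_measurable_times borel_measurable_const mat_borel_entry) auto
    qed
  qed (use V W in auto)
  then have Tm': "?T \<in> \<nu> \<rightarrow>\<^sub>M mat_borel d" unfolding measurable_cong_sets[OF s refl] .
  have im: "(\<lambda>Y. indicator A (Z + Y) :: ennreal) \<in> borel_measurable (mat_borel d)" if "Z \<in> carrier_mat d d" for Z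
  proof (rule measurable_compose[OF measurable_mat_borel_add borel_measurable_indicator[OF A]])
    show "(\<lambda>_. Z) \<in> mat_borel d \<rightarrow>\<^sub>M mat_borel d" using that by simp
  qed simp
  have "shifted_prob \<nu> A (?T X) = (\<integral>\<^sup>+Y. indicator A (?T X + Y) \<partial>distr \<nu> (mat_borel d) ?T)"
    unfolding shifted_prob_def hermitian_gaussian_conj[OF g V(1) W V(2) refl] ..
  also have "\<dots> = (\<integral>\<^sup>+Y. indicator A (?T X + ?T Y) \<partial>\<nu>)"
    by (rule nn_integral_distr[OF Tm']) (use im V W X in auto)
  also have "\<dots> = (\<integral>\<^sup>+Y. indicator A (X + Y) \<partial>\<nu>)"
  proof (rule nn_integral_cong)
    fix Y assume "Y \<in> space \<nu>"
    then have Y: "Y \<in> carrier_mat d d" using sets_eq_imp_space_eq[OF s] by simp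
    have "?T X + ?T Y = (V * X + V * Y) * ?W"
      using add_mult_distrib_mat[of "V * X" d d "V * Y" ?W d] V W X Y by simp
    also have "V * X + V * Y = V * (X + Y)"
      using mult_add_distrib_mat[OF V(1) X Y] by simp
    finally have "?T X + ?T Y = ?T (X + Y)" .
    then show "indicator A (?T X + ?T Y) = (indicator A (X + Y) :: ennreal)"
      using inv[of "X + Y"] X Y by (simp add: indicator_def del: assoc_mult_mat)
  qed
  finally show ?thesis by (simp add: shifted_prob_def)
qed

text \<open>By independence the past and the increment have a product law, so the increment can be
  integrated out first with the past frozen. This says that the kernel at \<open>B s\<close> is the
  conditional probability given the past of \<open>B\<close>.\<close>

lemma increment_conditional:
  assumes bm: "standard_hermitian_bm M d B" and st: "0 \<le> s" "s < t"
    and A: "A \<in> sets (mat_borel d)" and E: "E \<in> sets (natural_filtration M (mat_borel d) B s)"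
  shows "emeasure M (E \<inter> (B t -` A \<inter> space M))
    = (\<integral>\<^sup>+\<omega>. indicator E \<omega> * shifted_prob (distr M (mat_borel d) (\<lambda>\<omega>. B t \<omega> - B s \<omega>)) A (B s \<omega>) \<partial>M)"
proof -
  let ?mb = "mat_borel d" and ?FB = "natural_filtration M (mat_borel d) B s" and ?D = "\<lambda>\<omega>. B t \<omega> - B s \<omega>"
  let ?\<nu> = "distr M ?mb ?D"
  have p: "prob_space M" and Bm: "\<And>u. 0 \<le> u \<Longrightarrow> B u \<in> M \<rightarrow>\<^sub>M ?mb"
    and ind: "prob_space.indep_set M (sets ?FB) {?D -` A \<inter> space M | A. A \<in> sets ?mb}"
    using bm st unfolding standard_hermitian_bm_def by auto
  interpret prob_space M by fact
  have sub: "subalgebra M ?FB" by (rule natural_filtration_subalgebra[OF Bm])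
  have Dm: "?D \<in> M \<rightarrow>\<^sub>M ?mb" using st by (intro measurable_mat_borel_minus Bm) auto
  have idm: "(\<lambda>\<omega>. \<omega>) \<in> M \<rightarrow>\<^sub>M ?FB"
    by (rule measurable_from_subalg[OF sub measurable_ident_sets[OF refl]])
  interpret nu: prob_space ?\<nu> using Dm by (rule prob_space_distr)
  interpret FB: prob_space "distr M ?FB (\<lambda>\<omega>. \<omega>)" using idm by (rule prob_space_distr)
  \<comment> \<open>The identity map into the space with the smaller sigma-algebra serves as a
    random element carrying the whole past, so independence of sigma-algebras becomes a product of
    two laws.\<close>
  have joint: "distr M ?FB (\<lambda>\<omega>. \<omega>) \<Otimes>\<^sub>M ?\<nu> = distr M (?FB \<Otimes>\<^sub>M ?mb) (\<lambda>\<omega>. (\<omega>, ?D \<omega>))"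
  proof (rule pair_measure_eqI)
    show "sigma_finite_measure (distr M ?FB (\<lambda>\<omega>. \<omega>))" "sigma_finite_measure ?\<nu>" by unfold_locales
    show "sets (distr M ?FB (\<lambda>\<omega>. \<omega>) \<Otimes>\<^sub>M ?\<nu>) = sets (distr M (?FB \<Otimes>\<^sub>M ?mb) (\<lambda>\<omega>. (\<omega>, ?D \<omega>)))"
      unfolding sets_distr by (intro sets_pair_measure_cong) auto
    fix C H assume "C \<in> sets (distr M ?FB (\<lambda>\<omega>. \<omega>))" "H \<in> sets ?\<nu>"
    then have C: "C \<in> sets ?FB" and H: "H \<in> sets ?mb" by simp_all
    have CM: "C \<in> sets M" "(\<lambda>\<omega>. \<omega>) -` C \<inter> space M = C"
      using C sub sets.sets_into_space[OF C] by (auto simp: subalgebra_def)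
    have "prob (C \<inter> (?D -` H \<inter> space M)) = prob C * prob (?D -` H \<inter> space M)"
      using H by (intro indep_setD[OF ind C]) auto
    moreover have "(\<lambda>\<omega>. (\<omega>, ?D \<omega>)) -` (C \<times> H) \<inter> space M = C \<inter> (?D -` H \<inter> space M)"
      using sets.sets_into_space[OF C] by auto
    moreover have "C \<times> H \<in> sets (?FB \<Otimes>\<^sub>M ?mb)" using C H by simp
    ultimately show "emeasure (distr M ?FB (\<lambda>\<omega>. \<omega>)) C * emeasure ?\<nu> H
        = emeasure (distr M (?FB \<Otimes>\<^sub>M ?mb) (\<lambda>\<omega>. (\<omega>, ?D \<omega>))) (C \<times> H)"
      using CM C H by (simp add: emeasure_distr idm Dm measurable_Pair emeasure_eq_measure ennreal_mult)
  qed
  have Bs: "B s \<in> ?FB \<rightarrow>\<^sub>M ?mb" using st by (intro natural_filtration_measurable Bm) auto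
  let ?f = "\<lambda>z. indicator E (fst z) * indicator A (B s (fst z) + snd z) :: ennreal"
  have fm: "?f \<in> borel_measurable (?FB \<Otimes>\<^sub>M ?mb)"
  proof (intro borel_measurable_times_ennreal)
    show "(\<lambda>z. indicator E (fst z) :: ennreal) \<in> borel_measurable (?FB \<Otimes>\<^sub>M ?mb)"
      by (rule measurable_compose[OF measurable_fst borel_measurable_indicator[OF E]])
    show "(\<lambda>z. indicator A (B s (fst z) + snd z) :: ennreal) \<in> borel_measurable (?FB \<Otimes>\<^sub>M ?mb)"
      by (rule measurable_compose[OF measurable_mat_borel_add borel_measurable_indicator[OF A]])
        (rule measurable_compose[OF measurable_fst Bs] measurable_snd)+
  qed
  have EM: "E \<in> sets M" using E sub by (auto simp: subalgebra_def)
  have AM: "B t -` A \<inter> space M \<in> sets M" using st A by (intro measurable_sets[OF Bm]) auto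
  have "emeasure M (E \<inter> (B t -` A \<inter> space M)) = (\<integral>\<^sup>+\<omega>. indicator (E \<inter> (B t -` A \<inter> space M)) \<omega> \<partial>M)"
    using EM AM by simp
  also have "\<dots> = (\<integral>\<^sup>+\<omega>. ?f (\<omega>, ?D \<omega>) \<partial>M)"
  proof (rule nn_integral_cong)
    fix \<omega> assume \<omega>: "\<omega> \<in> space M"
    have c: "B s \<omega> \<in> carrier_mat d d" "B t \<omega> \<in> carrier_mat d d"
      using measurable_space[OF Bm \<omega>] st by (metis space_mat_borel, metis less_imp_le order_trans space_mat_borel)
    have "B s \<omega> + ?D \<omega> = B t \<omega>" using c by (intro eq_matI) auto
    then show "indicator (E \<inter> (B t -` A \<inter> space M)) \<omega> = ?f (\<omega>, ?D \<omega>)"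
      using \<omega> by (simp add: indicator_def)
  qed
  also have "\<dots> = (\<integral>\<^sup>+z. ?f z \<partial>distr M (?FB \<Otimes>\<^sub>M ?mb) (\<lambda>\<omega>. (\<omega>, ?D \<omega>)))"
    using fm by (subst nn_integral_distr[OF measurable_Pair[OF idm Dm]]) simp_all
  also have "\<dots> = (\<integral>\<^sup>+z. ?f z \<partial>(distr M ?FB (\<lambda>\<omega>. \<omega>) \<Otimes>\<^sub>M ?\<nu>))" unfolding joint ..
  also have "\<dots> = (\<integral>\<^sup>+\<omega>. \<integral>\<^sup>+Y. ?f (\<omega>, Y) \<partial>?\<nu> \<partial>distr M ?FB (\<lambda>\<omega>. \<omega>))"
  proof (rule nu.nn_integral_fst[symmetric])
    have "sets (distr M ?FB (\<lambda>\<omega>. \<omega>) \<Otimes>\<^sub>M ?\<nu>) = sets (?FB \<Otimes>\<^sub>M ?mb)" by (intro sets_pair_measure_cong) auto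
    then show "?f \<in> borel_measurable (distr M ?FB (\<lambda>\<omega>. \<omega>) \<Otimes>\<^sub>M ?\<nu>)"
      using fm by (simp cong: measurable_cong_sets)
  qed
  also have "\<dots> = (\<integral>\<^sup>+\<omega>. indicator E \<omega> * shifted_prob ?\<nu> A (B s \<omega>) \<partial>distr M ?FB (\<lambda>\<omega>. \<omega>))"
  proof (rule nn_integral_cong)
    fix \<omega> assume "\<omega> \<in> space (distr M ?FB (\<lambda>\<omega>. \<omega>))"
    then have c: "B s \<omega> \<in> carrier_mat d d" using measurable_space[OF Bs, of \<omega>] by simp
    have "(\<lambda>Y. indicator A (B s \<omega> + Y) :: ennreal) \<in> borel_measurable ?mb"
      by (rule measurable_compose[OF measurable_mat_borel_add borel_measurable_indicator[OF A]]) (use c in auto)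
    then have "(\<lambda>Y. indicator A (B s \<omega> + Y) :: ennreal) \<in> borel_measurable ?\<nu>" by simp
    then show "(\<integral>\<^sup>+Y. ?f (\<omega>, Y) \<partial>?\<nu>) = indicator E \<omega> * shifted_prob ?\<nu> A (B s \<omega>)"
      unfolding shifted_prob_def fst_conv snd_conv by (rule nn_integral_cmult)
  qed
  also have "\<dots> = (\<integral>\<^sup>+\<omega>. indicator E \<omega> * shifted_prob ?\<nu> A (B s \<omega>) \<partial>M)"
  proof (rule nn_integral_distr[OF idm])
    have "(\<lambda>\<omega>. shifted_prob ?\<nu> A (B s \<omega>)) \<in> borel_measurable ?FB"
      by (rule measurable_compose[OF Bs shifted_prob_measurable[OF nu.prob_space_axioms _ A]]) simp
    with borel_measurable_indicator[OF E]
    have "(\<lambda>\<omega>. indicator E \<omega> * shifted_prob ?\<nu> A (B s \<omega>)) \<in> borel_measurable ?FB"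
      by (rule borel_measurable_times_ennreal)
    then show "(\<lambda>\<omega>. indicator E \<omega> * shifted_prob ?\<nu> A (B s \<omega>)) \<in> borel_measurable (distr M ?FB (\<lambda>\<omega>. \<omega>))" by simp
  qed
  finally show ?thesis .
qed

text \<open>For s > 0 the kernel, read on arrays of entries, takes equal values at generic points
  with equal \<open>stat_fun\<close>, so it factors almost surely through \<open>stat_fun\<close>
  and hence through the joint state. At s = 0 the matrix is almost surely 0, which is not generic,
  but there a constant \<open>G\<close> serves.\<close>

lemma shifted_prob_factor:
  assumes bm: "standard_hermitian_bm M d B" and p: "1 \<le> p" "p < d" and s: "0 \<le> s"
    and g: "hermitian_gaussian d \<tau> \<nu>" and A: "A \<in> sets (joint_space p)"
  defines "A' \<equiv> joint_statistics d p -` A \<inter> carrier_mat d d"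
  shows "\<exists>G\<in>borel_measurable (vimage_algebra (space M) (\<lambda>\<omega>. joint_statistics d p (B s \<omega>)) (joint_space p)).
    AE \<omega> in M. shifted_prob \<nu> A' (B s \<omega>) = G \<omega>"
proof (cases "s = 0")
  case True
  have "AE \<omega> in M. B 0 \<omega> = 0\<^sub>m d d" using bm by (simp add: standard_hermitian_bm_def)
  then have "AE \<omega> in M. shifted_prob \<nu> A' (B s \<omega>) = shifted_prob \<nu> A' (0\<^sub>m d d)"
    unfolding True by eventually_elim simp
  then show ?thesis by (intro bexI[of _ "\<lambda>_. shifted_prob \<nu> A' (0\<^sub>m d d)"]) simp_all
next
  case False
  let ?mb = "mat_borel d" and ?n = "d - p" and ?f = "joint_statistics d p"
  have n: "0 < ?n" "?n < d" using p by auto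
  have pM: "prob_space M" and Bm: "\<And>u. 0 \<le> u \<Longrightarrow> B u \<in> M \<rightarrow>\<^sub>M ?mb"
    and B0: "AE \<omega> in M. B 0 \<omega> = 0\<^sub>m d d"
    using bm unfolding standard_hermitian_bm_def by auto
  interpret prob_space M by fact
  have p\<nu>: "prob_space \<nu>" and s\<nu>: "sets \<nu> = sets ?mb" using g by (auto simp: hermitian_gaussian_def)
  have fmeas: "?f \<in> ?mb \<rightarrow>\<^sub>M joint_space p" by (rule joint_statistics_measurable[OF p])
  have A': "A' \<in> sets ?mb" unfolding A'_def using measurable_sets[OF fmeas A] by simp
  have Bsm: "B s \<in> M \<rightarrow>\<^sub>M ?mb" using s by (rule Bm)
  have Bc: "B u \<omega> \<in> carrier_mat d d" if "0 \<le> u" "\<omega> \<in> space M" for u \<omega>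
    using measurable_space[OF Bm[OF that(1)] that(2)] by simp
  have gen: "AE \<omega> in M. B s \<omega> \<in> generic_mats ?n d"
  proof -
    have Dm: "(\<lambda>\<omega>. B s \<omega> - B 0 \<omega>) \<in> M \<rightarrow>\<^sub>M ?mb" using s by (intro measurable_mat_borel_minus Bm) auto
    have "hermitian_gaussian d (s - 0) (distr M ?mb (\<lambda>\<omega>. B s \<omega> - B 0 \<omega>))"
      using False s by (intro increment_hermitian_gaussian[OF bm]) auto
    then have "AE X in distr M ?mb (\<lambda>\<omega>. B s \<omega> - B 0 \<omega>). X \<in> generic_mats ?n d"
      using False s n by (intro hermitian_gaussian_generic) auto
    then have "AE \<omega> in M. B s \<omega> - B 0 \<omega> \<in> generic_mats ?n d" by (rule AE_distrD[OF Dm])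
    moreover have "AE \<omega> in M. \<omega> \<in> space M" by simp
    ultimately show ?thesis
      using B0
    proof eventually_elim
      fix \<omega> assume \<omega>: "B s \<omega> - B 0 \<omega> \<in> generic_mats ?n d" "\<omega> \<in> space M" "B 0 \<omega> = 0\<^sub>m d d"
      have "B s \<omega> - 0\<^sub>m d d = B s \<omega>" using Bc[OF s \<omega>(2)] by (intro eq_matI) auto
      then show "B s \<omega> \<in> generic_mats ?n d" using \<omega> by simp
    qed
  qed
  let ?\<kappa> = "\<lambda>\<omega>. mat_entries d (B s \<omega>)"
  have \<kappa>m: "?\<kappa> \<in> borel_measurable M" by (rule measurable_compose[OF Bsm mat_entries_measurable])
  let ?\<mu> = "distr M borel ?\<kappa>"
  define \<Omega> where "\<Omega> = {x. mat d d x \<in> generic_mats ?n d}"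
  have "\<exists>g\<in>borel_measurable borel. AE x in ?\<mu>. shifted_prob \<nu> A' (mat d d x) = g (stat_fun ?n d x)"
  proof (rule saturated_fun_AE_factor[where \<Omega>=\<Omega>])
    show "finite_measure ?\<mu>" using prob_space_distr[OF \<kappa>m] by (rule prob_space.finite_measure)
    show "continuous_on UNIV (stat_fun ?n d)" by (rule continuous_stat_fun) simp
    show "(\<lambda>x. shifted_prob \<nu> A' (mat d d x)) \<in> borel_measurable borel"
      by (rule measurable_compose[OF mat_of_entries_measurable shifted_prob_measurable[OF p\<nu> s\<nu> A']])
    have gs: "generic_mats ?n d \<in> sets ?mb"
    proof -
      have "generic_mats ?n d = {X \<in> space ?mb. X \<in> hermitian_mats d} \<inter> {X \<in> space ?mb. det (krylov_mat ?n X) \<noteq> 0} \<inter>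
        {X \<in> space ?mb. \<forall>i\<in>{?n..<d}. \<forall>j\<in>{?n..<d}. i \<noteq> j \<longrightarrow> X $$ (i, j) \<noteq> 0}"
        using hermitian_matsD(1)[of _ d] by (auto simp: generic_mats_def)
      moreover have "{X \<in> space ?mb. X \<in> hermitian_mats d} \<in> sets ?mb"
        by (rule sets_Collect_hermitian_mats)
      moreover have nz: "{X \<in> space ?mb. f X \<noteq> 0} \<in> sets ?mb" if "f \<in> borel_measurable ?mb" for f :: "complex mat \<Rightarrow> complex"
      proof -
        have "f -` (- {0}) \<inter> space ?mb \<in> sets ?mb" by (rule measurable_sets[OF that]) auto
        then show ?thesis by (simp add: vimage_def Int_def conj_commute)
      qed
      moreover have "{X \<in> space ?mb. det (krylov_mat ?n X) \<noteq> 0} \<in> sets ?mb" by (rule nz[OF det_krylov_measurable[OF n(2)]])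
      moreover have "{X \<in> space ?mb. \<forall>i\<in>{?n..<d}. \<forall>j\<in>{?n..<d}. i \<noteq> j \<longrightarrow> X $$ (i, j) \<noteq> 0} \<in> sets ?mb"
      proof (intro sets.sets_Collect_finite_All sets.sets_Collect_imp)
        fix i j assume "i \<in> {?n..<d}" "j \<in> {?n..<d}"
        then show "{X \<in> space ?mb. X $$ (i, j) \<noteq> 0} \<in> sets ?mb" by (intro nz mat_borel_entry) auto
      qed (rule finite_atLeastLessThan sets.sets_Collect_const)+
      ultimately show ?thesis by (simp only: sets.Int)
    qed
    show "AE x in ?\<mu>. x \<in> \<Omega>"
    proof (subst AE_distr_iff[OF \<kappa>m])
      have "(\<lambda>x. mat d d x) -` generic_mats ?n d \<inter> space borel \<in> sets borel"
        by (rule measurable_sets[OF mat_of_entries_measurable gs])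
      then show "{x \<in> space borel. x \<in> \<Omega>} \<in> sets borel" by (simp add: \<Omega>_def vimage_def)
      have "AE \<omega> in M. \<omega> \<in> space M" by simp
      then show "AE \<omega> in M. ?\<kappa> \<omega> \<in> \<Omega>"
        using gen by eventually_elim (simp add: \<Omega>_def mat_of_mat_entries[OF Bc[OF s]])
    qed
    fix x y assume xy: "x \<in> \<Omega>" "y \<in> \<Omega>" "stat_fun ?n d x = stat_fun ?n d y"
    then obtain V where V: "unitary_block ?n d V" and y: "mat d d y = V * mat d d x * mat_adjoint V"
      using stat_fun_eq_imp_conj[OF p, of x y] by (auto simp: \<Omega>_def)
    have "shifted_prob \<nu> A' (V * mat d d x * mat_adjoint V) = shifted_prob \<nu> A' (mat d d x)"
    proof (rule shifted_prob_conj[OF g A'])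
      show Vc: "V \<in> carrier_mat d d" and "V * mat_adjoint V = 1\<^sub>m d" using V by (auto simp: unitary_block_def)
      show "V * Y * mat_adjoint V \<in> A' \<longleftrightarrow> Y \<in> A'" if Y: "Y \<in> carrier_mat d d" for Y
      proof -
        have "V * Y * mat_adjoint V \<in> carrier_mat d d"
          by (rule mult_carrier_mat[OF mult_carrier_mat[OF Vc Y] mat_adjoint_carrier[OF Vc]])
        then show ?thesis unfolding A'_def using Y by (simp only: Int_iff vimage_eq joint_statistics_conj[OF p V Y])
      qed
    qed simp
    then show "shifted_prob \<nu> A' (mat d d x) = shifted_prob \<nu> A' (mat d d y)" unfolding y by (rule sym)
  qed simp
  then obtain g where gm: "g \<in> borel_measurable borel" and ae: "AE x in ?\<mu>. shifted_prob \<nu> A' (mat d d x) = g (stat_fun ?n d x)"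
    by blast
  \<comment> \<open>Going through \<open>stat_state\<close> makes the function depend on
    \<open>B s\<close> only via the joint state, which gives measurability for the sigma-algebra of
    the present and not just for that of \<open>B s\<close>.\<close>
  let ?G = "\<lambda>\<omega>. g (stat_state ?n d (?f (B s \<omega>)))"
  have "(\<lambda>\<omega>. ?f (B s \<omega>)) \<in> vimage_algebra (space M) (\<lambda>\<omega>. ?f (B s \<omega>)) (joint_space p) \<rightarrow>\<^sub>M joint_space p"
    using measurable_space[OF measurable_compose[OF Bsm fmeas]] by (intro measurable_vimage_algebra1) auto
  from measurable_compose[OF measurable_compose[OF this stat_state_measurable[OF p(2)]] gm]
  have Gm: "?G \<in> borel_measurable (vimage_algebra (space M) (\<lambda>\<omega>. ?f (B s \<omega>)) (joint_space p))" .
  have Gae: "AE \<omega> in M. shifted_prob \<nu> A' (B s \<omega>) = ?G \<omega>"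
  proof -
    have "AE \<omega> in M. shifted_prob \<nu> A' (mat d d (?\<kappa> \<omega>)) = g (stat_fun ?n d (?\<kappa> \<omega>))"
      by (rule AE_distrD[OF \<kappa>m ae])
    moreover have "AE \<omega> in M. \<omega> \<in> space M" by simp
    ultimately show ?thesis
      by eventually_elim (simp add: mat_of_mat_entries[OF Bc[OF s]] stat_state_joint_statistics[OF p Bc[OF s]])
  qed
  show ?thesis by (rule bexI[of _ "?G"]) (rule Gae Gm)+
qed

text \<open>A single \<open>G\<close>, measurable with respect to the present, is shown to have the
  right integrals over every event of the past. It is then a version of the conditional probability
  given the past and, the present being contained in the past, also of the one given the
  present.\<close>

lemma markov_process_joint_statistics:
  assumes bm: "standard_hermitian_bm M d B" and p: "1 \<le> p" "p < d"
  shows "markov_process M (joint_space p) (\<lambda>t \<omega>. joint_statistics d p (B t \<omega>))"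
proof -
  let ?mb = "mat_borel d" and ?f = "joint_statistics d p" and ?S = "joint_space p"
  let ?X = "\<lambda>t \<omega>. joint_statistics d p (B t \<omega>)"
  have pM: "prob_space M" and Bm: "\<And>u. 0 \<le> u \<Longrightarrow> B u \<in> M \<rightarrow>\<^sub>M ?mb"
    using bm unfolding standard_hermitian_bm_def by auto
  interpret prob_space M by fact
  have fmeas: "?f \<in> ?mb \<rightarrow>\<^sub>M ?S" by (rule joint_statistics_measurable[OF p])
  have Xm: "?X u \<in> M \<rightarrow>\<^sub>M ?S" if "0 \<le> u" for u by (rule measurable_compose[OF Bm[OF that] fmeas])
  have cond: "AE \<omega> in M. real_cond_exp M (natural_filtration M ?S ?X s) (indicat_real (?X t -` A \<inter> space M)) \<omega> =
      real_cond_exp M (vimage_algebra (space M) (?X s) ?S) (indicat_real (?X t -` A \<inter> space M)) \<omega>"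
    if A: "A \<in> sets ?S" and st: "0 \<le> s" "s \<le> t" for A s t
  proof -
    let ?F = "natural_filtration M ?S ?X s" and ?C = "vimage_algebra (space M) (?X s) ?S"
    let ?Z = "?X t -` A \<inter> space M"
    have Z: "?Z \<in> sets M" using Xm[of t] st A by (intro measurable_sets) auto
    have Zi: "integrable M (indicat_real ?Z)" using Z by (simp add: emeasure_eq_measure)
    have subF: "subalgebra M ?F" by (rule natural_filtration_subalgebra[OF Xm])
    have Cset: "sets ?C = {?X s -` D \<inter> space M | D. D \<in> sets ?S}"
      using measurable_space[OF Xm[OF st(1)]] by (intro sets_vimage_algebra2) auto
    have "?X s \<in> ?F \<rightarrow>\<^sub>M ?S"
      by (rule natural_filtration_measurable[where X="?X", OF Xm[OF st(1)] st(1) order_refl])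
    from measurable_sets[OF this] have CF: "sets ?C \<subseteq> sets ?F"
      unfolding Cset by auto
    have subC: "subalgebra M ?C" using CF subF by (auto simp: subalgebra_def)
    interpret F: sigma_finite_subalgebra M ?F
      by (intro finite_measure_subalgebra_is_sigma_finite finite_measure_subalgebra.intro finite_measure_axioms
          finite_measure_subalgebra_axioms.intro subF)
    interpret C: sigma_finite_subalgebra M ?C
      by (intro finite_measure_subalgebra_is_sigma_finite finite_measure_subalgebra.intro finite_measure_axioms
          finite_measure_subalgebra_axioms.intro subC)
    obtain G :: "'a \<Rightarrow> real" where Gm: "G \<in> borel_measurable ?C" and Gi: "integrable M G"
      and Geq: "\<And>E. E \<in> sets ?F \<Longrightarrow> (\<integral>\<omega>\<in>E. indicat_real ?Z \<omega> \<partial>M) = (\<integral>\<omega>\<in>E. G \<omega> \<partial>M)"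
    proof (cases "s = t")
      case True
      \<comment> \<open>For s = t there is no increment, but the event already belongs to the
        present and its indicator serves as \<open>G\<close>.\<close>
      have "?Z \<in> sets ?C" unfolding Cset using A True by auto
      then show thesis using Zi by (intro that[of "indicat_real ?Z"]) auto
    next
      case False
      with st have st': "s < t" by simp
      let ?\<nu> = "distr M ?mb (\<lambda>\<omega>. B t \<omega> - B s \<omega>)"
      define A' where "A' = ?f -` A \<inter> carrier_mat d d"
      have A': "A' \<in> sets ?mb" unfolding A'_def using measurable_sets[OF fmeas A] by simp
      have g: "hermitian_gaussian d (t - s) ?\<nu>" by (rule increment_hermitian_gaussian[OF bm st(1) st'])
      interpret nu: prob_space ?\<nu> using g by (simp add: hermitian_gaussian_def)
      obtain H where Hm: "H \<in> borel_measurable ?C" and H: "AE \<omega> in M. shifted_prob ?\<nu> A' (B s \<omega>) = H \<omega>"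
        using shifted_prob_factor[OF bm p st(1) g A] unfolding A'_def by blast
      have HM: "H \<in> borel_measurable M" by (rule measurable_from_subalg[OF subC Hm])
      have ZA: "B t -` A' \<inter> space M = ?Z"
        using measurable_space[OF Bm[of t]] st by (auto simp: A'_def)
      have le1: "shifted_prob ?\<nu> A' X \<le> 1" for X
      proof -
        have "shifted_prob ?\<nu> A' X \<le> (\<integral>\<^sup>+Y. 1 \<partial>?\<nu>)"
          unfolding shifted_prob_def by (intro nn_integral_mono) (simp add: indicator_def)
        then show ?thesis using nu.emeasure_space_1 by simp
      qed
      \<comment> \<open>The bound by 1 makes \<open>H\<close> almost surely finite, so that passing
        to real values keeps it up to a null set.\<close>
      have H1: "AE \<omega> in M. H \<omega> \<le> 1" using H by eventually_elim (metis le1)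
      have Hr: "AE \<omega> in M. ennreal (enn2real (H \<omega>)) = H \<omega>"
        using H1 by eventually_elim (auto intro!: ennreal_enn2real intro: le_less_trans)
      have Hrm: "(\<lambda>\<omega>. enn2real (H \<omega>)) \<in> borel_measurable M" using HM by measurable
      show thesis
      proof (rule that[of "\<lambda>\<omega>. enn2real (H \<omega>)"])
        show "(\<lambda>\<omega>. enn2real (H \<omega>)) \<in> borel_measurable ?C" using Hm by measurable
        have "AE \<omega> in M. norm (enn2real (H \<omega>)) \<le> 1"
          using H1 by eventually_elim (auto intro: enn2real_leI)
        then show "integrable M (\<lambda>\<omega>. enn2real (H \<omega>))"
          using Hrm by (intro integrable_const_bound) auto
        fix E assume E: "E \<in> sets ?F"
        have EM: "E \<in> sets M" using E subF by (auto simp: subalgebra_def)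
        have EB: "E \<in> sets (natural_filtration M ?mb B s)"
          using E natural_filtration_compose_subset[where X=B, OF Bm fmeas] by blast
        have "emeasure M (E \<inter> ?Z) = (\<integral>\<^sup>+\<omega>. indicator E \<omega> * shifted_prob ?\<nu> A' (B s \<omega>) \<partial>M)"
          using increment_conditional[OF bm st(1) st' A' EB] unfolding ZA .
        also have "\<dots> = (\<integral>\<^sup>+\<omega>. ennreal (indicator E \<omega> * enn2real (H \<omega>)) \<partial>M)"
        proof (rule nn_integral_cong_AE)
          show "AE \<omega> in M. indicator E \<omega> * shifted_prob ?\<nu> A' (B s \<omega>) = ennreal (indicator E \<omega> * enn2real (H \<omega>))"
            using H Hr by eventually_elim (simp add: indicator_def)
        qed
        finally have "(\<integral>\<omega>. indicator E \<omega> * enn2real (H \<omega>) \<partial>M) = measure M (E \<inter> ?Z)"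
          using EM Hrm by (subst integral_eq_nn_integral) (auto simp: measure_def)
        moreover have "(\<integral>\<omega>\<in>E. indicat_real ?Z \<omega> \<partial>M) = measure M (E \<inter> ?Z)"
          using EM Z by (simp add: set_lebesgue_integral_def indicator_inter_arith[symmetric] sets.Int_space_eq2)
        ultimately show "(\<integral>\<omega>\<in>E. indicat_real ?Z \<omega> \<partial>M) = (\<integral>\<omega>\<in>E. enn2real (H \<omega>) \<partial>M)"
          by (simp add: set_lebesgue_integral_def)
      qed
    qed
    have "AE \<omega> in M. real_cond_exp M ?F (indicat_real ?Z) \<omega> = G \<omega>"
    proof (rule F.real_cond_exp_charact[OF Geq Zi Gi])
      have "subalgebra ?F ?C" using CF by (simp add: subalgebra_def)
      then show "G \<in> borel_measurable ?F" using Gm by (rule measurable_from_subalg)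
    qed
    moreover have "AE \<omega> in M. real_cond_exp M ?C (indicat_real ?Z) \<omega> = G \<omega>"
      using CF by (intro C.real_cond_exp_charact Geq Zi Gi Gm) auto
    ultimately show ?thesis by eventually_elim simp
  qed
  show ?thesis
    unfolding markov_process_def using pM Xm cond by blast
qed

theorem theorem5p9:
  fixes d p :: nat
    and M :: "'a measure"
    and B :: "real \<Rightarrow> 'a \<Rightarrow> complex mat"
  assumes "2 \<le> d"
    and "p \<in> {1..d - 1}"
    and "standard_hermitian_bm M d B"
  shows "markov_process M (joint_space p) (\<lambda>t \<omega>. joint_statistics d p (B t \<omega>))"
  using assms by (intro markov_process_joint_statistics) auto

end
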